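(* For every integer $N\ge 2$ let $F_N$ be a probability density on $\mathbb{S}^{N-1}(\sqrt N)$ with respect to $d\sigma^N$. Assume that there exists $k>2$ with $$\mathcal{A}_k=\sup_{N}\frac{\sum_{j=1}^N M_k\left(\Pi_1^{(j)}(F_N)\right)}{N}<\infty,$$ that $$\mathcal{A}_I=\sup_{N}\frac{\sum_{j=1}^N I\left(\Pi_1^{(j)}(F_N)\right)}{N}<\infty,$$ and that there exists $C_H>0$ such that $\inf_{N}\frac{H_N(F_N)}{N}\ge C_H$. Then there exist $C_1,C_2>0$, independent of $N$ and $F_N$, such that for any $0<\beta<\frac k2-1$, any $1<p<\min\left(\frac{k+1}{3},\frac k2\right)$ and every $N$, $$\sum_{j=1}^N\int_{\mathbb{S}^{N-1}(\sqrt N)}F_j^{(N)}\log F_j^{(N)}\,d\sigma^N\le\Bigg(1+\frac{C_1}{C_HN}+\frac{4C_2\left(1+\frac{C_k}{2}\right)^{\frac1k}}{C_H(2N)^{\frac14-\frac1{2k}}}\left(\mathcal{A}_I-1\right)^{\frac12}\left(1+\mathcal{A}_k\right)^{\frac1k}+\frac{\mathcal{A}_k}{2C_HN^{\frac k2-1-\beta}}+\frac{C_p\,\mathcal{A}_I^{\frac{p-1}{2p}}\mathcal{A}_k^{\frac1p}}{2C_H\left(1-\frac1{N^\beta}\right)^{\frac{k}{2p}}N^{\frac12\left(\frac{k+1}{p}-3\right)}}\Bigg)H_N(F_N),$$ where $C_p=\left(\int_{|x|<1}\left|\log(1-x^2)\right|^{\frac{p}{p-1}}dx\right)^{\frac{p-1}{p}}$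 and $C_k=\sup_{N}\left(\frac2N\right)^{\frac k2}\frac{\Gamma\left(\frac{N+k}{2}\right)}{\Gamma\left(\frac N2\right)}$.
   Context: $\mathbb{S}^{N-1}(r)\subset\mathbb{R}^N$ is the sphere of radius $r$ centred at the origin; $d\sigma^N_r$ is the uniform probability measure on $\mathbb{S}^{N-1}(r)$ and $d\sigma^N=d\sigma^N_{\sqrt N}$. For a probability density $F_N$ on $\mathbb{S}^{N-1}(\sqrt N)$ (with respect to $d\sigma^N$), $H_N(F_N)=\int_{\mathbb{S}^{N-1}(\sqrt N)}F_N\log F_N\,d\sigma^N$. $\Pi_1^{(j)}(F_N)$ is the density with respect to Lebesgue measure on $\mathbb{R}$ of the law of the $j$-th coordinate $v_j$ under $F_Nd\sigma^N$ (it is supported in $[-\sqrt N,\sqrt N]$). The first marginal on the sphere in the $j$-th variable is $F_j^{(N)}(v)=\int_{\mathbb{S}^{N-2}(\sqrt{N-v^2})}F_N\,d\sigma^{N-1}_{\sqrt{N-v^2}}$, i.e. the average of $F_N$ over the slice $\{v_j=v\}$ of $\mathbb{S}^{N-1}(\sqrt N)$; it is regarded as a function on $\mathbb{S}^{N-1}(\sqrt N)$ depending only on $v_j$. For a non-negative measurable $f$ on $\mathbb{R}$, $M_k(f)=\int_{\mathbb{R}}|v|^kf(v)\,dv$. For a probability density $f$ on $\mathbb{R}$, $I(f)=\int_{\mathbb{R}}\left|\frac{d}{dv}\log f(v)\right|^2f(v)\,dv$ is its Fisher information with respect to Lebesgue measure ($+\infty$ if not defined). *)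

theory Defs
  imports "HOL-Analysis.Analysis"
begin

(* Vectors with coordinates indexed by a finite set I are the extensional functions in the space
   of PiM I (%_. borel), and L2_set x I is the Euclidean norm.  R^N is the case I = {1..N};
   deleting coordinate j gives the case I = {1..N} - {j}. *)

definition euclidean_sphere :: "nat set \<Rightarrow> real \<Rightarrow> (nat \<Rightarrow> real) set" where
  "euclidean_sphere I r = {x \<in> space (Pi\<^sub>M I (\<lambda>_. borel)). L2_set x I = r}"

(* The uniform probability measure on the sphere of radius r in R^I: the image of the uniform
   distribution on the unit ball under the radial projection x |-> r x / |x|.  The origin, a null
   set, is sent to 0 by the convention 0 / 0 = 0.  The underlying space is the sphere itself. *)

definition sphere_measure :: "nat set \<Rightarrow> real \<Rightarrow> (nat \<Rightarrow> real) measure" where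
  "sphere_measure I r =
     restrict_space
       (distr
         (uniform_measure (Pi\<^sub>M I (\<lambda>_. lborel))
            {x \<in> space (Pi\<^sub>M I (\<lambda>_. lborel)). L2_set x I \<le> 1})
         (Pi\<^sub>M I (\<lambda>_. borel))
         (\<lambda>x. \<lambda>i\<in>I. r * x i / L2_set x I))
       (euclidean_sphere I r)"

definition kac_sphere :: "nat \<Rightarrow> (nat \<Rightarrow> real) measure" where
  "kac_sphere N = sphere_measure {1..N} (sqrt (real N))"

definition prob_density_on :: "'a measure \<Rightarrow> ('a \<Rightarrow> real) \<Rightarrow> bool" where
  "prob_density_on M f \<longleftrightarrow>
     f \<in> borel_measurable M \<and> (\<forall>x\<in>space M. 0 \<le> f x) \<and> (\<integral>\<^sup>+x. ennreal (f x) \<partial>M) = 1"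

(* The integral of f log f as an extended real number.  Since f log f >= -1/e for f >= 0, on a
   probability space the second term is finite, so the value is well defined in (-oo, oo].
   The convention 0 log 0 = 0 is automatic. *)

definition entropy_functional :: "'a measure \<Rightarrow> ('a \<Rightarrow> real) \<Rightarrow> ereal" where
  "entropy_functional M f =
     enn2ereal (\<integral>\<^sup>+x. ennreal (f x * ln (f x)) \<partial>M)
     - enn2ereal (\<integral>\<^sup>+x. ennreal (- (f x * ln (f x))) \<partial>M)"

definition sphere_entropy :: "nat \<Rightarrow> ((nat \<Rightarrow> real) \<Rightarrow> real) \<Rightarrow> ereal" where
  "sphere_entropy N F = entropy_functional (kac_sphere N) F"

definition line_marginal :: "nat \<Rightarrow> nat \<Rightarrow> ((nat \<Rightarrow> real) \<Rightarrow> real) \<Rightarrow> real \<Rightarrow> real" where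
  "line_marginal N j F v =
     enn2real (RN_deriv lborel
       (distr (density (kac_sphere N) (\<lambda>x. ennreal (F x))) borel (\<lambda>x. x j)) v)"

(* For almost every v the slice integral is finite; on the remaining null set it is 0 here. *)

definition sphere_marginal :: "nat \<Rightarrow> nat \<Rightarrow> ((nat \<Rightarrow> real) \<Rightarrow> real) \<Rightarrow> real \<Rightarrow> real" where
  "sphere_marginal N j F v =
     (\<integral>w. F (w(j := v)) \<partial>sphere_measure ({1..N} - {j}) (sqrt (real N - v\<^sup>2)))"

definition abs_moment :: "real \<Rightarrow> (real \<Rightarrow> real) \<Rightarrow> ennreal" where
  "abs_moment k f = (\<integral>\<^sup>+v. ennreal (\<bar>v\<bar> powr k * f v) \<partial>lborel)"

(* g is the weak derivative of f: g is locally integrable and f agrees almost everywhere with a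
   locally absolutely continuous function whose derivative is g. *)

definition has_weak_derivative :: "(real \<Rightarrow> real) \<Rightarrow> (real \<Rightarrow> real) \<Rightarrow> bool" where
  "has_weak_derivative f g \<longleftrightarrow>
     (\<forall>a b. set_integrable lborel {a..b} g) \<and>
     (\<exists>c. AE v in lborel. f v = c + (LBINT t=0..ereal v. g t))"

(* The integral of |(log f)'|^2 f, with (log f)' = g / f for the weak derivative g of f.
   The set {f = 0} does not contribute (x / 0 = 0).  As g is unique up to a null set, the infimum
   is over a single value; it is over the empty set, hence oo, if f has no weak derivative. *)

definition fisher_information :: "(real \<Rightarrow> real) \<Rightarrow> ennreal" where
  "fisher_information f =
     (INF g\<in>{g. has_weak_derivative f g}. \<integral>\<^sup>+v. ennreal ((g v / f v)\<^sup>2 * f v) \<partial>lborel)"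

definition sup_avg_moment :: "real \<Rightarrow> (nat \<Rightarrow> (nat \<Rightarrow> real) \<Rightarrow> real) \<Rightarrow> ennreal" where
  "sup_avg_moment k F =
     (SUP N\<in>{2..}. (\<Sum>j=1..N. abs_moment k (line_marginal N j (F N))) / of_nat N)"

definition sup_avg_fisher :: "(nat \<Rightarrow> (nat \<Rightarrow> real) \<Rightarrow> real) \<Rightarrow> ennreal" where
  "sup_avg_fisher F =
     (SUP N\<in>{2..}. (\<Sum>j=1..N. fisher_information (line_marginal N j (F N))) / of_nat N)"

definition log_const :: "real \<Rightarrow> real" where
  "log_const p =
     (LBINT x:{-1<..<1}. \<bar>ln (1 - x\<^sup>2)\<bar> powr (p / (p - 1))) powr ((p - 1) / p)"

definition gamma_const :: "real \<Rightarrow> real" where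
  "gamma_const k =
     (SUP N\<in>{2::nat..}. (2 / real N) powr (k / 2) * Gamma ((real N + k) / 2) / Gamma (real N / 2))"

end

(* Write f_j for the density of the j-th coordinate v_j under F_N d sigma^N and g_N for the density of
   v_j under d sigma^N, so that F_j = f_j / g_N and the entropy of F_j is int f_j ln f_j - int f_j ln g_N.

   Gibbs' variational principle on the sphere with the test function sum_j ln f_j(v_j) gives
   sum_j int f_j ln f_j <= H_N(F_N) + ln (int prod_j f_j(v_j) d sigma^N).  Since all but two of the
   coordinates of a uniform point of the sphere form a uniform point of a ball (Archimedes), the last
   integral is at most the inverse volume of that ball times sup f_1 * sup f_2, and sup f_j is bounded by
   the square root of the Fisher information of f_j.

   In ln g_N the singular function - ln (1 - x), x = v_j^2 / N, is compared with x.  The linear terms add up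
   to 1 because the v_j^2 add up to N, and they cancel the exponential growth of the volume of the ball.  The
   quadratic remainder is interpolated between the second and the k-th moment, which produces the power of N
   in the second error term.

   The product structure of that term requires A_I - 1 to be bounded below.  For N = 2 the f_j live on
   [- sqrt 2, sqrt 2], so that their Fisher information is at least 4.  The last two error terms are
   only needed to be nonnegative. *)

theory Submission
  imports Defs
begin

text \<open>The bound obtained first is additive: the sum of the marginal entropies exceeds H_N(F_N)
  by at most a multiple of N^(1 - eps), where eps = 1/4 - 1/(2k). It becomes multiplicative because
  the lower bound on the entropy reads C_H N <= H_N(F_N), so that the defect is at most a multiple
  of N^(- eps) / C_H times H_N(F_N). The obstacle is the singularity of - ln (1 - x) at x = 1.
  Moments do not control how the mass of f_j concentrates at the poles v_j^2 = N, but boundedness of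
  f_j does; hence the Fisher information enters a second time, as a sup bound against the integrable
  weight (1 - x)^(-1/2). Away from the poles the logarithm costs a factor N^eps. The interpolated
  remainder gains N^(- 2 eps), so half of that gain can be spent there. The sphere measure is a
  projected ball, with no surface measure at hand. All slicing formulas therefore come from Fubini
  and from scaling Lebesgue measure, and averages over directions appear as integrals over unit
  balls.\<close>

section \<open>Weak derivatives and Fisher information on the line\<close>

text \<open>The base point is minus infinity, so no orientation of intervals enters and the product
  of two primitives is a single integral over a quadrant.\<close>

definition primitive :: "(real \<Rightarrow> real) \<Rightarrow> real \<Rightarrow> real" where
  "primitive p v = (\<integral>s. indicator {..v} s * p s \<partial>lborel)"

lemma primitive_integrable:
  fixes p :: "real \<Rightarrow> real"
  assumes "integrable lborel p"
  shows "integrable lborel (\<lambda>s. indicator {..v} s * p s)"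
  using integrable_mult_indicator[of "{..v}" lborel p] assms by simp

lemma abs_primitive_le:
  assumes "integrable lborel p"
  shows "\<bar>primitive p v\<bar> \<le> (\<integral>s. \<bar>p s\<bar> \<partial>lborel)"
proof -
  have "\<bar>primitive p v\<bar> \<le> (\<integral>s. \<bar>indicator {..v} s * p s\<bar> \<partial>lborel)"
    unfolding primitive_def by (rule integral_abs_bound)
  also have "\<dots> \<le> (\<integral>s. \<bar>p s\<bar> \<partial>lborel)"
    using assms primitive_integrable[OF assms]
    by (intro integral_mono integrable_abs) (auto simp: indicator_def)
  finally show ?thesis .
qed

lemma continuous_on_primitive:
  assumes "integrable lborel p"
  shows "continuous_on UNIV (primitive p)"
proof (rule continuous_at_imp_continuous_on, rule ballI)
  fix v
  show "isCont (primitive p) v"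
    unfolding continuous_at_sequentially
  proof (intro allI impI)
    fix x :: "nat \<Rightarrow> real" assume x: "x \<longlonglongrightarrow> v"
    show "(primitive p \<circ> x) \<longlonglongrightarrow> primitive p v"
      unfolding primitive_def comp_def
    proof (rule integral_dominated_convergence[where w="\<lambda>s. \<bar>p s\<bar>"])
      have "AE s in lborel. s \<noteq> v" by (rule AE_lborel_singleton)
      then show "AE s in lborel. (\<lambda>i. indicator {..x i} s * p s) \<longlonglongrightarrow> indicator {..v} s * p s"
      proof eventually_elim
        case (elim s)
        consider "s < v" | "v < s" using elim by linarith
        then have "eventually (\<lambda>i. indicator {..x i} s * p s = indicator {..v} s * p s) sequentially"
        proof cases
          case 1
          from order_tendstoD(1)[OF x this] show ?thesis
            by eventually_elim (use 1 in auto)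
        next
          case 2
          from order_tendstoD(2)[OF x this] show ?thesis
            by eventually_elim (use 2 in auto)
        qed
        then show ?case by (rule tendsto_eventually)
      qed
    qed (use assms in \<open>auto simp: indicator_def\<close>)
  qed
qed

lemma borel_measurable_primitive:
  "integrable lborel p \<Longrightarrow> primitive p \<in> borel_measurable borel"
  by (intro borel_measurable_continuous_onI continuous_on_primitive)

lemma integrable_bounded_mult:
  fixes p f :: "real \<Rightarrow> real"
  assumes "integrable lborel p" "f \<in> borel_measurable borel" "\<And>v. \<bar>f v\<bar> \<le> B"
  shows "integrable lborel (\<lambda>v. p v * f v)"
proof (rule Bochner_Integration.integrable_bound)
  show "integrable lborel (\<lambda>v. B * \<bar>p v\<bar>)" using assms(1) by simp
  show "(\<lambda>v. p v * f v) \<in> borel_measurable lborel" using assms(1,2) by auto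
  show "AE v in lborel. norm (p v * f v) \<le> norm (B * \<bar>p v\<bar>)"
  proof (rule AE_I2)
    fix v
    have "0 \<le> B" using assms(3)[of v] by linarith
    then show "norm (p v * f v) \<le> norm (B * \<bar>p v\<bar>)"
      using assms(3)[of v] by (simp add: abs_mult mult.commute[of _ "\<bar>p v\<bar>"] mult_left_mono)
  qed
qed

text \<open>Integration by parts for merely integrable \<open>p\<close> and \<open>q\<close>: the
  product is an integral over the square of {..v}, which the diagonal cuts into the part where x is
  the larger variable and the part where y is.\<close>

lemma primitive_mult_primitive:
  assumes p: "integrable lborel p" and q: "integrable lborel q"
  shows "primitive p v * primitive q v = (\<integral>s. indicator {..v} s * (p s * primitive q s + primitive p s * q s) \<partial>lborel)"
proof -
  let ?i = "indicator {..v} :: real \<Rightarrow> real"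
  note [measurable] = borel_measurable_integrable[OF p] borel_measurable_integrable[OF q]
  define k where "k z = (?i (fst z) * p (fst z)) * (?i (snd z) * q (snd z))" for z
  have ip: "integrable lborel (\<lambda>s. ?i s * p s)" and iq: "integrable lborel (\<lambda>s. ?i s * q s)"
    by (auto intro: primitive_integrable p q)
  have k [measurable]: "k \<in> borel_measurable (lborel \<Otimes>\<^sub>M lborel)"
    unfolding k_def by measurable
  have k_int: "integrable (lborel \<Otimes>\<^sub>M lborel) k"
  proof (rule lborel_pair.Fubini_integrable[OF k])
    have "(\<lambda>x. \<integral>y. norm (k (x, y)) \<partial>lborel) = (\<lambda>x. \<bar>?i x * p x\<bar> * (\<integral>y. \<bar>?i y * q y\<bar> \<partial>lborel))"
      by (simp add: k_def abs_mult)
    then show "integrable lborel (\<lambda>x. \<integral>y. norm (k (x, y)) \<partial>lborel)"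
      using ip by (simp add: integrable_abs)
    show "AE x in lborel. integrable lborel (\<lambda>y. k (x, y))"
      using iq by (simp add: k_def)
  qed
  define A where "A = {z :: real \<times> real. snd z \<le> fst z}"
  have A [measurable]: "A \<in> sets (lborel \<Otimes>\<^sub>M lborel)"
  proof -
    have "A = {z \<in> space (lborel \<Otimes>\<^sub>M lborel). snd z \<le> fst z}" by (auto simp: A_def space_pair_measure)
    also have "\<dots> \<in> sets (lborel \<Otimes>\<^sub>M lborel)" by measurable
    finally show ?thesis .
  qed
  have k1: "integrable (lborel \<Otimes>\<^sub>M lborel) (\<lambda>z. indicator A z * k z)"
    using integrable_mult_indicator[OF A k_int] by simp
  have k2: "integrable (lborel \<Otimes>\<^sub>M lborel) (\<lambda>z. indicator (- A) z * k z)"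
  proof -
    have "- A = space (lborel \<Otimes>\<^sub>M lborel) - A" by (auto simp: space_pair_measure)
    then have "- A \<in> sets (lborel \<Otimes>\<^sub>M lborel)" using A by (metis sets.compl_sets)
    from integrable_mult_indicator[OF this k_int] show ?thesis by simp
  qed
  have "primitive p v * primitive q v = (\<integral>x. (\<integral>y. k (x, y) \<partial>lborel) \<partial>lborel)"
    by (simp add: k_def primitive_def)
  also have "\<dots> = (\<integral>z. k z \<partial>(lborel \<Otimes>\<^sub>M lborel))"
    by (rule lborel_pair.integral_fst'[OF k_int])
  also have "\<dots> = (\<integral>z. indicator A z * k z + indicator (- A) z * k z \<partial>(lborel \<Otimes>\<^sub>M lborel))"
    by (intro Bochner_Integration.integral_cong) (auto simp: indicator_def)
  also have "\<dots> = (\<integral>z. indicator A z * k z \<partial>(lborel \<Otimes>\<^sub>M lborel)) + (\<integral>z. indicator (- A) z * k z \<partial>(lborel \<Otimes>\<^sub>M lborel))"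
    by (rule Bochner_Integration.integral_add[OF k1 k2])
  also have "(\<integral>z. indicator A z * k z \<partial>(lborel \<Otimes>\<^sub>M lborel)) = (\<integral>x. (\<integral>y. indicator A (x, y) * k (x, y) \<partial>lborel) \<partial>lborel)"
    by (rule lborel_pair.integral_fst'[OF k1, symmetric])
  also have "\<dots> = (\<integral>x. ?i x * (p x * primitive q x) \<partial>lborel)"
  proof (rule Bochner_Integration.integral_cong[OF refl])
    fix x
    have "(\<integral>y. indicator A (x, y) * k (x, y) \<partial>lborel) = (\<integral>y. (?i x * p x) * (indicator {..x} y * q y) \<partial>lborel)"
      by (intro Bochner_Integration.integral_cong) (auto simp: A_def k_def indicator_def)
    then show "(\<integral>y. indicator A (x, y) * k (x, y) \<partial>lborel) = ?i x * (p x * primitive q x)"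
      by (simp add: primitive_def)
  qed
  also have "(\<integral>z. indicator (- A) z * k z \<partial>(lborel \<Otimes>\<^sub>M lborel)) = (\<integral>y. (\<integral>x. indicator (- A) (x, y) * k (x, y) \<partial>lborel) \<partial>lborel)"
    using lborel_pair.integral_snd[of "\<lambda>x y. indicator (- A) (x, y) * k (x, y)"] k2 by (simp add: split_beta')
  also have "\<dots> = (\<integral>y. ?i y * (primitive p y * q y) \<partial>lborel)"
  proof (rule Bochner_Integration.integral_cong[OF refl])
    fix y
    \<comment> \<open>On the complement of \<open>A\<close> the inequality x < y is strict, while
      \<open>primitive p y\<close> includes the null set x = y.\<close>
    have "(\<integral>x. indicator (- A) (x, y) * k (x, y) \<partial>lborel) = (\<integral>x. (?i y * q y) * (indicator {..y} x * p x) \<partial>lborel)"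
    proof (rule integral_cong_AE)
      show "AE x in lborel. indicator (- A) (x, y) * k (x, y) = (?i y * q y) * (indicator {..y} x * p x)"
        using AE_lborel_singleton[of y]
        by eventually_elim (auto simp: A_def k_def indicator_def)
      have "(\<lambda>x. indicator (- A) (x, y) * k (x, y)) = (\<lambda>x. indicator {..<y} x * k (x, y))"
        by (auto simp: A_def indicator_def)
      then show "(\<lambda>x. indicator (- A) (x, y) * k (x, y)) \<in> borel_measurable lborel"
        by (simp add: k_def)
    qed measurable
    then show "(\<integral>x. indicator (- A) (x, y) * k (x, y) \<partial>lborel) = ?i y * (primitive p y * q y)"
      by (simp add: primitive_def)
  qed
  also have "(\<integral>x. ?i x * (p x * primitive q x) \<partial>lborel) + (\<integral>y. ?i y * (primitive p y * q y) \<partial>lborel) =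
      (\<integral>s. ?i s * (p s * primitive q s) + ?i s * (primitive p s * q s) \<partial>lborel)"
  proof (rule Bochner_Integration.integral_add[symmetric])
    have "integrable lborel (\<lambda>s. p s * primitive q s)" "integrable lborel (\<lambda>s. primitive p s * q s)"
      using integrable_bounded_mult[OF p borel_measurable_primitive[OF q] abs_primitive_le[OF q]]
        integrable_bounded_mult[OF q borel_measurable_primitive[OF p] abs_primitive_le[OF p]]
      by (auto simp: mult.commute)
    then show "integrable lborel (\<lambda>s. ?i s * (p s * primitive q s))" "integrable lborel (\<lambda>s. ?i s * (primitive p s * q s))"
      by (auto intro: primitive_integrable)
  qed
  finally show ?thesis by (simp add: distrib_left)
qed

lemma product_rule:
  assumes p: "integrable lborel p" and q: "integrable lborel q"
    and U: "\<And>v. U v = c + primitive p v" and W: "\<And>v. W v = d + primitive q v"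
  shows "integrable lborel (\<lambda>s. p s * W s + U s * q s)"
    and "U v * W v = c * d + primitive (\<lambda>s. p s * W s + U s * q s) v"
proof -
  have 1: "integrable lborel (\<lambda>s. p s * primitive q s)" "integrable lborel (\<lambda>s. primitive p s * q s)"
    using integrable_bounded_mult[OF p borel_measurable_primitive[OF q] abs_primitive_le[OF q]]
      integrable_bounded_mult[OF q borel_measurable_primitive[OF p] abs_primitive_le[OF p]]
    by (auto simp: mult.commute)
  have eq: "p s * W s + U s * q s = d * p s + (p s * primitive q s + primitive p s * q s) + c * q s" for s
    by (simp add: U W algebra_simps)
  show "integrable lborel (\<lambda>s. p s * W s + U s * q s)"
    unfolding eq using 1 p q by auto
  have "primitive (\<lambda>s. p s * W s + U s * q s) v =
    (\<integral>s. d * (indicator {..v} s * p s) + indicator {..v} s * (p s * primitive q s + primitive p s * q s) + c * (indicator {..v} s * q s) \<partial>lborel)"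
    unfolding eq unfolding primitive_def[of "\<lambda>s. d * p s + _ s + _ s"]
    by (intro Bochner_Integration.integral_cong) (auto simp: algebra_simps)
  also have "\<dots> = d * primitive p v + primitive p v * primitive q v + c * primitive q v"
    unfolding primitive_mult_primitive[OF p q]
    using primitive_integrable[OF p, of v] primitive_integrable[OF q, of v]
      primitive_integrable[OF Bochner_Integration.integrable_add[OF 1], of v]
    by (simp add: primitive_def)
  finally show "U v * W v = c * d + primitive (\<lambda>s. p s * W s + U s * q s) v"
    by (simp add: U W algebra_simps)
qed

text \<open>Induction with \<open>product_rule\<close>. For \<open>n = 0\<close> the truncated
  exponent \<open>n - 1\<close> is harmless because of the factor \<open>real n\<close>.\<close>

lemma power_rule:
  assumes q: "integrable lborel q" and u: "\<And>v. u v = 1 + primitive q v"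
  shows "integrable lborel (\<lambda>s. real n * u s ^ (n - 1) * q s) \<and>
    (\<forall>v. u v ^ n = 1 + primitive (\<lambda>s. real n * u s ^ (n - 1) * q s) v)"
proof (induction n)
  case 0
  then show ?case by (simp add: primitive_def)
next
  case (Suc n)
  have eq: "(\<lambda>s. (real n * u s ^ (n - 1) * q s) * u s + u s ^ n * q s) = (\<lambda>s. real (Suc n) * u s ^ (Suc n - 1) * q s)"
    by (cases n) (auto simp: algebra_simps)
  show ?case
    using product_rule[OF conjunct1[OF Suc] q, of "\<lambda>v. u v ^ n" 1 u 1] Suc u
    unfolding eq by (simp add: mult.commute)
qed

text \<open>The derivative of a nonnegative function vanishes on the zero set of the function:
  \<open>\<integral> (1 - f/B)^n f'\<close> is the increment of a power of \<open>1 - f/B\<close> divided by \<open>n + 1\<close>, hence tends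
  to \<open>0\<close>, while the integrand tends to \<open>f'\<close> where \<open>f = 0\<close> and to \<open>0\<close> elsewhere.\<close>

lemma primitive_zero_set:
  assumes g: "integrable lborel g" and f: "\<And>v. f v = primitive g v"
    and nonneg: "\<And>v. 0 \<le> f v"
  shows "primitive (\<lambda>s. if f s = 0 then g s else 0) v = 0"
proof -
  define B where "B = (\<integral>s. \<bar>g s\<bar> \<partial>lborel) + 1"
  have B: "B > 0" "\<And>v. f v \<le> B"
  proof -
    have "0 \<le> (\<integral>s. \<bar>g s\<bar> \<partial>lborel)" by simp
    then show "B > 0" unfolding B_def by linarith
    show "f v \<le> B" for v using abs_primitive_le[OF g, of v] by (simp add: B_def f)
  qed
  define q where "q s = - (g s / B)" for s
  define u where "u v = 1 - f v / B" for v
  have q: "integrable lborel q" unfolding q_def using g by simp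
  have u: "u v = 1 + primitive q v" for v
    by (simp add: u_def f q_def primitive_def)
  have u01: "0 \<le> u v" "u v \<le> 1" for v
    using B nonneg[of v] by (auto simp: u_def)
  have f_meas [measurable]: "f \<in> borel_measurable borel"
    using borel_measurable_primitive[OF g] by (simp add: f[abs_def])
  have [measurable]: "u \<in> borel_measurable borel" "g \<in> borel_measurable borel" "q \<in> borel_measurable borel"
    unfolding u_def[abs_def] using f_meas borel_measurable_integrable[OF g] borel_measurable_integrable[OF q] by auto
  have eq: "(\<integral>s. indicator {..v} s * (u s ^ n * q s) \<partial>lborel) = (u v ^ Suc n - 1) / real (Suc n)" for n
  proof -
    have "u v ^ Suc n = 1 + primitive (\<lambda>s. real (Suc n) * u s ^ n * q s) v"
      using power_rule[OF q u, of "Suc n"] by simp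
    also have "primitive (\<lambda>s. real (Suc n) * u s ^ n * q s) v = (\<integral>s. real (Suc n) * (indicator {..v} s * (u s ^ n * q s)) \<partial>lborel)"
      unfolding primitive_def by (intro Bochner_Integration.integral_cong) auto
    also have "\<dots> = real (Suc n) * (\<integral>s. indicator {..v} s * (u s ^ n * q s) \<partial>lborel)"
      by (rule integral_mult_right_zero)
    finally show ?thesis by (simp add: field_simps del: of_nat_Suc power_Suc)
  qed
  have "(\<lambda>n. \<integral>s. indicator {..v} s * (u s ^ n * q s) \<partial>lborel) \<longlonglongrightarrow> (\<integral>s. indicator {..v} s * (if f s = 0 then q s else 0) \<partial>lborel)"
  proof (rule integral_dominated_convergence[where w="\<lambda>s. \<bar>q s\<bar>"])
    show "AE s in lborel. (\<lambda>n. indicator {..v} s * (u s ^ n * q s)) \<longlonglongrightarrow> indicator {..v} s * (if f s = 0 then q s else 0)"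
    proof (rule AE_I2)
      fix s
      have "(\<lambda>n. u s ^ n * q s) \<longlonglongrightarrow> (if f s = 0 then q s else 0)"
      proof (cases "f s = 0")
        case True
        then show ?thesis by (simp add: u_def)
      next
        case False
        then have "u s < 1" using B nonneg[of s] by (auto simp: u_def less_le)
        then have "(\<lambda>n. u s ^ n) \<longlonglongrightarrow> 0" using u01 by (intro LIMSEQ_power_zero) auto
        from tendsto_mult_right[OF this, of "q s"] show ?thesis using False by simp
      qed
      then show "(\<lambda>n. indicator {..v} s * (u s ^ n * q s)) \<longlonglongrightarrow> indicator {..v} s * (if f s = 0 then q s else 0)"
        by (rule tendsto_mult_left)
    qed
    show "AE s in lborel. norm (indicator {..v} s * (u s ^ n * q s)) \<le> \<bar>q s\<bar>" for n
    proof (rule AE_I2)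
      fix s
      have "\<bar>u s ^ n\<bar> \<le> 1" using u01[of s] by (simp add: power_le_one)
      then show "norm (indicator {..v} s * (u s ^ n * q s)) \<le> \<bar>q s\<bar>"
        by (auto simp: indicator_def abs_mult mult_left_le_one_le)
    qed
    show "integrable lborel (\<lambda>s. \<bar>q s\<bar>)" using q by simp
  qed measurable
  moreover have "(\<lambda>n. \<integral>s. indicator {..v} s * (u s ^ n * q s) \<partial>lborel) \<longlonglongrightarrow> 0"
    unfolding eq
  proof (rule Lim_null_comparison[where g="\<lambda>n. inverse (real (Suc n))"])
    show "eventually (\<lambda>n. norm ((u v ^ Suc n - 1) / real (Suc n)) \<le> inverse (real (Suc n))) sequentially"
    proof (rule always_eventually, rule allI)
      fix n
      have "0 \<le> u v ^ Suc n" "u v ^ Suc n \<le> 1" using u01[of v] by (simp_all only: zero_le_power power_le_one)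
      then have "\<bar>u v ^ Suc n - 1\<bar> \<le> 1" by linarith
      then have "\<bar>u v ^ Suc n - 1\<bar> * inverse (real (Suc n)) \<le> 1 * inverse (real (Suc n))"
        by (intro mult_right_mono) auto
      then show "norm ((u v ^ Suc n - 1) / real (Suc n)) \<le> inverse (real (Suc n))"
        by (simp add: divide_inverse abs_mult del: of_nat_Suc power_Suc)
    qed
    show "(\<lambda>n. inverse (real (Suc n))) \<longlonglongrightarrow> 0" by (rule LIMSEQ_inverse_real_of_nat)
  qed
  ultimately have "(\<integral>s. indicator {..v} s * (if f s = 0 then q s else 0) \<partial>lborel) = 0"
    by (rule LIMSEQ_unique)
  moreover have "(\<lambda>s. indicator {..v} s * (if f s = 0 then q s else 0)) = (\<lambda>s. - (1 / B) * (indicator {..v} s * (if f s = 0 then g s else 0)))"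
    by (auto simp: q_def)
  ultimately show ?thesis using B unfolding primitive_def by simp
qed

section \<open>Continuous representatives and bounds by the Fisher information\<close>

lemma closed_level_set:
  fixes f :: "real \<Rightarrow> real"
  assumes "continuous_on UNIV f" "closed C"
  shows "closed {v. f v \<in> C}"
  using continuous_closed_preimage[OF assms(1) closed_UNIV assms(2)] by (simp add: vimage_def)

text \<open>A weak derivative is only locally integrable. Since \<open>F\<close> vanishes beyond
  \<open>b\<close>, cutting \<open>g\<close> off outside [-a, a] loses nothing and gives a globally
  integrable \<open>p\<close>. The gap between \<open>b\<close> and \<open>a\<close> provides open
  intervals on which the continuous representative vanishes, which forces its constant of
  integration to be 0.\<close>

lemma weak_derivative_primitive:
  fixes F :: "real \<Rightarrow> real"
  assumes wd: "has_weak_derivative F g" and b: "0 < b" "b < a"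
    and nonneg: "\<And>v. 0 \<le> F v" and supp: "AE v in lborel. b < \<bar>v\<bar> \<longrightarrow> F v = 0"
  obtains f p where "integrable lborel p" "\<And>v. f v = primitive p v" "AE v in lborel. F v = f v"
    "\<And>v. 0 \<le> f v" "\<And>v. b < \<bar>v\<bar> \<Longrightarrow> f v = 0"
    "(\<integral>\<^sup>+v. ennreal ((p v / f v)\<^sup>2 * f v) \<partial>lborel) \<le> (\<integral>\<^sup>+v. ennreal ((g v / F v)\<^sup>2 * F v) \<partial>lborel)"
proof -
  from wd obtain c where g: "\<And>a b. set_integrable lborel {a..b} g"
    and c: "AE v in lborel. F v = c + (LBINT t=0..ereal v. g t)"
    unfolding has_weak_derivative_def by auto
  define p where "p s = indicator {-a..a} s * g s" for s
  have p: "integrable lborel p"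
    using g[of "-a" a] unfolding set_integrable_def p_def by simp
  define c' where "c' = c + (LBINT t=0..ereal (-a). g t)"
  define f where "f v = c' + primitive p v" for v
  \<comment> \<open>Moves the base point from 0 to -a; inside (-a, a) the cut-off is
    invisible.\<close>
  have rep: "c + (LBINT t=0..ereal v. g t) = f v" if v: "-a < v" "v < a" for v
  proof -
    have "interval_lebesgue_integrable lborel (min 0 (min (ereal (- a)) (ereal v))) (max 0 (max (ereal (- a)) (ereal v))) g"
    proof -
      define A B where "A = min 0 (min (-a) v)" and "B = max 0 (max (-a) v)"
      have "A \<le> B" by (simp add: A_def B_def)
      have "(min 0 (min (ereal (- a)) (ereal v))) = ereal A"
        "(max 0 (max (ereal (- a)) (ereal v))) = ereal B"
        by (simp_all add: A_def B_def min_def max_def)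
      moreover have "set_integrable lborel (einterval (ereal A) (ereal B)) g"
        by (rule set_integrable_subset[OF g[of A B]]) (auto simp: einterval_def)
      ultimately show ?thesis
        unfolding interval_lebesgue_integrable_def using \<open>A \<le> B\<close> by simp
    qed
    from interval_integral_sum[OF this]
    have "(LBINT t=0..ereal v. g t) = (LBINT t=0..ereal (-a). g t) + (LBINT t=ereal (-a)..ereal v. g t)" by simp
    also have "(LBINT t=ereal (-a)..ereal v. g t) = (LBINT t:{-a..v}. g t)"
      using v by (intro interval_integral_Icc) auto
    also have "\<dots> = primitive p v"
      unfolding set_lebesgue_integral_def primitive_def p_def
      using v by (intro Bochner_Integration.integral_cong) (auto simp: indicator_def)
    finally show ?thesis by (simp add: f_def c'_def)
  qed
  have cont: "continuous_on UNIV f"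
    unfolding f_def by (intro continuous_intros continuous_on_primitive p)
  have ae: "AE v in lebesgue. v \<in> {-a<..<a} \<longrightarrow> F v = f v"
    using AE_completion[OF c] by eventually_elim (use rep in auto)
  \<comment> \<open>A continuous function that satisfies a closed condition almost everywhere on an
    open set satisfies it everywhere there. This makes the support condition, and later the sign,
    pointwise.\<close>
  have ae0: "AE v in lebesgue. v \<in> {v. b < \<bar>v\<bar>} \<inter> {-a<..<a} \<longrightarrow> v \<in> {v. f v \<in> {0}}"
    using ae AE_completion[OF supp] by eventually_elim auto
  have open0: "open ({v. b < \<bar>v\<bar>} \<inter> {-a<..<a})"
    by (intro open_Int open_Collect_less continuous_intros open_greaterThanLessThan)
  have closed0: "closed {v. f v \<in> {0}}" by (rule closed_level_set[OF cont]) simp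
  have zero: "f v = 0" if "b < \<bar>v\<bar>" "-a < v" "v < a" for v
    using mem_closed_if_AE_lebesgue_open[OF open0 closed0 ae0, of v] that by auto
  have const: "f v = f (- a)" if "v \<le> - a" for v
  proof -
    have "primitive p v = primitive p (- a)"
      unfolding primitive_def
    proof (rule integral_cong_AE)
      show "AE s in lborel. indicator {..v} s * p s = indicator {..- a} s * p s"
        using AE_lborel_singleton[of "- a"] by eventually_elim (use that in \<open>auto simp: p_def indicator_def\<close>)
    qed (use borel_measurable_integrable[OF p] in auto)
    then show ?thesis by (simp add: f_def)
  qed
  have const': "f v = f a" if "a \<le> v" for v
  proof -
    have "primitive p v = primitive p a"
      unfolding primitive_def using that b
      by (intro Bochner_Integration.integral_cong) (auto simp: p_def indicator_def)
    then show ?thesis by (simp add: f_def)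
  qed
  have "closure {b<..<a} \<subseteq> {v. f v \<in> {0}}"
    by (rule closure_minimal[OF _ closed0]) (use zero b in auto)
  then have fa: "f a = 0" using b by (auto simp: closure_greaterThanLessThan subset_iff)
  have "closure {-a<..<-b} \<subseteq> {v. f v \<in> {0}}"
    by (rule closure_minimal[OF _ closed0]) (use zero b in auto)
  then have fma: "f (- a) = 0" using b by (auto simp: closure_greaterThanLessThan subset_iff)
  have f0: "f v = 0" if "b < \<bar>v\<bar>" for v
    using zero[of v] const[of v] const'[of v] fa fma that by linarith
  \<comment> \<open>Left of \<open>- a\<close> the function \<open>f\<close> is constant with value
    \<open>f (- a) = 0\<close>, and \<open>primitive p\<close> vanishes there.\<close>
  have "c' = 0"
  proof -
    have "primitive p (- a - 1) = 0"
      unfolding primitive_def using b by (intro integral_eq_zero_AE AE_I2) (auto simp: p_def indicator_def)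
    then show ?thesis using const[of "- a - 1"] fma by (simp add: f_def)
  qed
  then have f_prim: "f v = primitive p v" for v by (simp add: f_def)
  have "AE v in lebesgue. v \<in> {-a<..<a} \<longrightarrow> v \<in> {v. f v \<in> {0..}}"
    using ae by eventually_elim (metis (mono_tags) nonneg atLeast_iff mem_Collect_eq)
  then have "f v \<ge> 0" if "-a < v" "v < a" for v
    using mem_closed_if_AE_lebesgue_open[OF open_greaterThanLessThan closed_level_set[OF cont closed_atLeast], of "-a" a 0 v] that by auto
  then have f_nonneg: "0 \<le> f v" for v
    using const[of v] const'[of v] fa fma by (cases "- a < v \<and> v < a") auto
  have ae_F: "AE v in lborel. F v = f v"
    using c supp
  proof eventually_elim
    case (elim v)
    show ?case
    proof (cases "- a < v \<and> v < a")
      case True then show ?thesis using elim rep[of v] by simp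
    next
      case False
      then have "b < \<bar>v\<bar>" using b by auto
      then show ?thesis using elim f0 by simp
    qed
  qed
  have "(\<integral>\<^sup>+v. ennreal ((p v / f v)\<^sup>2 * f v) \<partial>lborel) \<le> (\<integral>\<^sup>+v. ennreal ((g v / F v)\<^sup>2 * F v) \<partial>lborel)"
  proof (rule nn_integral_mono_AE)
    show "AE v in lborel. ennreal ((p v / f v)\<^sup>2 * f v) \<le> ennreal ((g v / F v)\<^sup>2 * F v)"
      using ae_F
    proof eventually_elim
      case (elim v)
      show ?case
      proof (cases "\<bar>v\<bar> \<le> a")
        case True
        then have "p v = g v" by (simp add: p_def indicator_def abs_le_iff)
        then show ?thesis using elim by simp
      qed (use f0[of v] b in simp)
    qed
  qed
  with p f_prim ae_F f_nonneg f0 that show thesis by blast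
qed

text \<open>With e = f'^2 / f one has f'^2 = e f, and Cauchy-Schwarz bounds the total variation of
  \<open>f\<close>, hence its supremum. The second bound compares with the density proportional to
  cos^2 on [- pi/2, pi/2], whose Fisher information is 4: its negative logarithmic derivative is 2
  tan, which is bounded on the support because 3/2 < pi/2.\<close>

lemma fisher_info_bounds:
  assumes p: "integrable lborel p" and f: "\<And>v. f v = primitive p v" and nonneg: "\<And>v. 0 \<le> f v"
    and mass: "(\<integral>\<^sup>+v. ennreal (f v) \<partial>lborel) = 1"
    and K: "(\<integral>\<^sup>+v. ennreal ((p v / f v)\<^sup>2 * f v) \<partial>lborel) \<le> ennreal K" and K0: "0 \<le> K"
  shows "f v \<le> sqrt (K + 1)"
    and "(\<And>v. 3 / 2 < \<bar>v\<bar> \<Longrightarrow> f v = 0) \<Longrightarrow> 4 \<le> K"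
proof -
  \<comment> \<open>Discarding \<open>p\<close> on the zero set of \<open>f\<close> does not change
    the primitive, by \<open>primitive_zero_set\<close>, and makes q^2 = e f true at every
    point.\<close>
  define q where "q s = (if f s = 0 then 0 else p s)" for s
  have f_meas [measurable]: "f \<in> borel_measurable borel"
    using borel_measurable_primitive[OF p] by (simp add: f[abs_def])
  note p_meas [measurable] = borel_measurable_integrable[OF p]
  have q: "integrable lborel q"
  proof (rule Bochner_Integration.integrable_bound[OF p])
    show "q \<in> borel_measurable lborel" unfolding q_def by measurable
  qed (auto simp: q_def)
  have int0: "integrable lborel (\<lambda>s. if f s = 0 then p s else 0)"
    by (rule Bochner_Integration.integrable_bound[OF p]) auto
  have f': "f v = primitive q v" for v
  proof -
    have "primitive p v = (\<integral>s. indicator {..v} s * q s + indicator {..v} s * (if f s = 0 then p s else 0) \<partial>lborel)"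
      unfolding primitive_def by (intro Bochner_Integration.integral_cong) (auto simp: q_def)
    also have "\<dots> = primitive q v + primitive (\<lambda>s. if f s = 0 then p s else 0) v"
      using primitive_integrable[OF q, of v] primitive_integrable[OF int0, of v] by (simp add: primitive_def)
    finally show ?thesis using primitive_zero_set[OF p f nonneg] f by simp
  qed
  define e where "e v = (p v / f v)\<^sup>2 * f v" for v
  have [measurable]: "e \<in> borel_measurable borel" unfolding e_def by measurable
  have e0: "0 \<le> e v" for v using nonneg[of v] by (simp add: e_def)
  have e: "integrable lborel e"
    using K e0 by (intro integrableI_nonneg) (auto simp: e_def intro: le_less_trans)
  have eK: "(\<integral>v. e v \<partial>lborel) \<le> K"
  proof -
    have "ennreal (\<integral>v. e v \<partial>lborel) = (\<integral>\<^sup>+v. ennreal (e v) \<partial>lborel)"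
      using nn_integral_eq_integral[OF e] e0 by simp
    also have "\<dots> \<le> ennreal K" unfolding e_def by (rule K)
    finally show ?thesis using K0 by simp
  qed
  have f_int: "integrable lborel f" "(\<integral>v. f v \<partial>lborel) = 1"
    using mass nonneg by (auto intro!: integrableI_nonneg simp: integral_eq_nn_integral)
  have eq: "q v ^ 2 = e v * f v" for v
    by (simp add: e_def q_def power2_eq_square)
  show "f v \<le> sqrt (K + 1)"
  proof -
    define l where "l = sqrt (K + 1)"
    have l: "l > 0" "l * l = K + 1" using K0 by (auto simp: l_def)
    \<comment> \<open>Arithmetic-geometric mean with weight \<open>l\<close>; integration gives K /
      (2 l) + l / 2 <= l. The 1 inside \<open>l\<close> keeps it positive when K = 0.\<close>
    have "\<bar>q v\<bar> \<le> e v / (2 * l) + l / 2 * f v" for v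
    proof (rule power2_le_imp_le)
      have "0 \<le> (e v / (2 * l) - l / 2 * f v)\<^sup>2" by simp
      also have "\<dots> = (e v / (2 * l) + l / 2 * f v)\<^sup>2 - 4 * (e v / (2 * l)) * (l / 2 * f v)"
        by (simp only: power2_eq_square) (simp add: algebra_simps)
      also have "4 * (e v / (2 * l)) * (l / 2 * f v) = (q v)\<^sup>2" using l by (simp add: eq)
      finally show "\<bar>q v\<bar>\<^sup>2 \<le> (e v / (2 * l) + l / 2 * f v)\<^sup>2" by simp
      show "0 \<le> e v / (2 * l) + l / 2 * f v" using l e0[of v] nonneg[of v] by simp
    qed
    then have "(\<integral>v. \<bar>q v\<bar> \<partial>lborel) \<le> (\<integral>v. e v / (2 * l) + l / 2 * f v \<partial>lborel)"
      using q e f_int by (intro integral_mono) auto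
    also have "\<dots> = (\<integral>v. e v \<partial>lborel) / (2 * l) + l / 2"
      using e f_int by simp
    also have "\<dots> \<le> K / (2 * l) + l / 2"
      using eK l by (simp add: divide_right_mono)
    also have "\<dots> \<le> l"
    proof -
      have "K / (2 * l) \<le> (l * l) / (2 * l)" using l by (intro divide_right_mono) auto
      also have "\<dots> = l / 2" using l(1) by simp
      finally show ?thesis by linarith
    qed
    finally show ?thesis
      using abs_primitive_le[OF q, of v] f'[of v] by (simp add: l_def)
  qed
  show "4 \<le> K" if supp: "\<And>v. 3 / 2 < \<bar>v\<bar> \<Longrightarrow> f v = 0"
  proof -
    have pi2: "(3 / 2 :: real) < pi / 2" using pi_gt3 by simp
    have cos_nz: "cos x \<noteq> 0" if "\<bar>x\<bar> \<le> 3 / 2" for x :: real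
    proof -
      have "- (pi / 2) < x" "x < pi / 2" using that pi2 unfolding abs_le_iff by linarith+
      then show ?thesis using cos_gt_zero_pi[of x] by simp
    qed
    \<comment> \<open>\<open>\<phi>\<close> will be 2 tan on [-3/2, 3/2], continued by constants. In
      this form it is a constant plus a primitive, so that \<open>product_rule\<close> applies to
      \<open>\<phi>\<close> and \<open>f\<close>.\<close>
    define r where "r s = 2 * (1 + (tan s)\<^sup>2) * indicator {-3/2..3/2} s" for s :: real
    define \<phi> where "\<phi> v = 2 * tan (-3/2) + primitive r v" for v
    have deriv: "DERIV (\<lambda>x. 2 * tan x) x :> 2 * (1 + (tan x)\<^sup>2)" if "\<bar>x\<bar> \<le> 3 / 2" for x :: real
      using cos_nz[OF that] by (auto intro!: derivative_eq_intros simp: tan_sec power_inverse)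
    have cont: "isCont (\<lambda>x. 2 * (1 + (tan x)\<^sup>2)) x" if "\<bar>x\<bar> \<le> 3 / 2" for x :: real
      using cos_nz[OF that] by (intro continuous_intros) auto
    have ftc: "has_bochner_integral lborel (\<lambda>s. 2 * (1 + (tan s)\<^sup>2) * indicator {-3/2..v} s) (2 * tan v - 2 * tan (-3/2))"
      if "-3/2 \<le> v" "v \<le> 3/2" for v :: real
    proof (rule has_bochner_integral_FTC_Icc_real)
      fix x assume "-3/2 \<le> x" "x \<le> v"
      then have "\<bar>x\<bar> \<le> 3/2" using that by (auto simp: abs_le_iff)
      then show "DERIV (\<lambda>x. 2 * tan x) x :> 2 * (1 + (tan x)\<^sup>2)" "isCont (\<lambda>x. 2 * (1 + (tan x)\<^sup>2)) x"
        using deriv cont by auto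
    qed (use that in auto)
    have r: "integrable lborel r"
      using ftc[of "3/2"] unfolding r_def by (auto simp: has_bochner_integral_iff)
    have \<phi>: "\<phi> v = 2 * tan v" if "-3/2 \<le> v" "v \<le> 3/2" for v
    proof -
      have "primitive r v = (\<integral>s. 2 * (1 + (tan s)\<^sup>2) * indicator {-3/2..v} s \<partial>lborel)"
        unfolding primitive_def r_def using that by (intro Bochner_Integration.integral_cong) (auto simp: indicator_def)
      also have "\<dots> = 2 * tan v - 2 * tan (-3/2)"
        using ftc[OF that] by (simp add: has_bochner_integral_iff)
      finally show ?thesis by (simp add: \<phi>_def)
    qed
    have \<phi>_meas [measurable]: "\<phi> \<in> borel_measurable borel"
      unfolding \<phi>_def[abs_def] using borel_measurable_primitive[OF r] by simp
    have q0: "q s = 0" if "3 / 2 < \<bar>s\<bar>" for s using supp[OF that] by (simp add: q_def)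
    have pr: "integrable lborel (\<lambda>s. r s * f s + \<phi> s * q s)"
      "primitive (\<lambda>s. r s * f s + \<phi> s * q s) 2 = 0"
    proof -
      have f0: "f v = 0 + primitive q v" for v using f' by simp
      note prod = product_rule[OF r q \<phi>_def f0]
      show "integrable lborel (\<lambda>s. r s * f s + \<phi> s * q s)" by (rule prod(1))
      show "primitive (\<lambda>s. r s * f s + \<phi> s * q s) 2 = 0"
        using prod(2)[of 2] supp[of 2] by simp
    qed
    \<comment> \<open>The point 2 lies beyond the support: the primitive at 2 is the full integral,
      and it equals the boundary term \<open>\<phi> 2 * f 2\<close>, which is 0.\<close>
    have "primitive (\<lambda>s. r s * f s + \<phi> s * q s) 2 = (\<integral>s. r s * f s + \<phi> s * q s \<partial>lborel)"
      unfolding primitive_def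
      by (intro Bochner_Integration.integral_cong) (auto simp: indicator_def q0 supp)
    then have zero: "(\<integral>s. r s * f s + \<phi> s * q s \<partial>lborel) = 0" using pr by simp
    \<comment> \<open>Expand the nonnegative (p + \<phi> f)^2 / f and use the Riccati equation 2
      \<phi>' - \<phi>^2 = 4 satisfied by 2 tan.\<close>
    have ineq: "4 * f s \<le> e s + 2 * (r s * f s + \<phi> s * q s)" for s
    proof (cases "\<bar>s\<bar> \<le> 3/2 \<and> f s > 0")
      case True
      then have s: "-3/2 \<le> s" "s \<le> 3/2" and fs: "f s > 0" by (auto simp: abs_le_iff)
      have "0 \<le> (p s + \<phi> s * f s)\<^sup>2 / f s" using fs by simp
      also have "\<dots> = e s + 2 * \<phi> s * q s + (\<phi> s)\<^sup>2 * f s"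
        using fs by (simp add: e_def q_def power2_eq_square field_simps)
      finally have "- ((\<phi> s)\<^sup>2 * f s) \<le> e s + 2 * \<phi> s * q s" by simp
      moreover have "2 * (r s * f s) - (\<phi> s)\<^sup>2 * f s = 4 * f s"
        using s by (simp add: \<phi> r_def power2_eq_square algebra_simps)
      ultimately show ?thesis by (simp add: algebra_simps)
    next
      case False
      then have "f s = 0" using supp[of s] nonneg[of s] by (auto simp: not_le less_le)
      then show ?thesis using e0[of s] by (simp add: q_def)
    qed
    have "4 = (\<integral>s. 4 * f s \<partial>lborel)" using f_int by simp
    also have "\<dots> \<le> (\<integral>s. e s + 2 * (r s * f s + \<phi> s * q s) \<partial>lborel)"
      by (intro integral_mono ineq Bochner_Integration.integrable_add integrable_mult_right f_int(1) e pr(1))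
    also have "\<dots> = (\<integral>s. e s \<partial>lborel) + 2 * (\<integral>s. r s * f s + \<phi> s * q s \<partial>lborel)"
      by (simp only: Bochner_Integration.integral_add[OF e integrable_mult_right[OF pr(1)]] integral_mult_right_zero)
    also have "\<dots> = (\<integral>s. e s \<partial>lborel)" by (simp only: zero mult_zero_right add_0_right)
    finally show "4 \<le> K" using eK by simp
  qed
qed

text \<open>Instead of showing that the infimum over weak derivatives is attained, a
  \<open>g\<close> within 1 of it is taken. This slack and the 1 in
  \<open>fisher_info_bounds\<close> make up the 2.\<close>

lemma fisher_information_bounds:
  fixes F :: "real \<Rightarrow> real"
  assumes F: "F \<in> borel_measurable borel" "\<And>v. 0 \<le> F v" "(\<integral>\<^sup>+v. ennreal (F v) \<partial>lborel) = 1"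
    and b: "0 < b" "AE v in lborel. b < \<bar>v\<bar> \<longrightarrow> F v = 0"
    and fin: "fisher_information F < \<infinity>"
  obtains f where "f \<in> borel_measurable borel" "AE v in lborel. F v = f v" "\<And>v. 0 \<le> f v"
    "\<And>v. f v \<le> sqrt (enn2real (fisher_information F) + 2)" "\<And>v. b < \<bar>v\<bar> \<Longrightarrow> f v = 0"
proof -
  have "fisher_information F < fisher_information F + 1"
    using fin by (cases "fisher_information F" rule: ennreal_cases) (auto simp: ennreal_less_iff simp flip: ennreal_1 ennreal_plus)
  then obtain g where g: "has_weak_derivative F g"
      "(\<integral>\<^sup>+v. ennreal ((g v / F v)\<^sup>2 * F v) \<partial>lborel) < fisher_information F + 1"
    unfolding fisher_information_def by (subst (asm) Inf_less_iff) auto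
  obtain f p where fp: "integrable lborel p" "\<And>v. f v = primitive p v" "AE v in lborel. F v = f v"
    "\<And>v. 0 \<le> f v" "\<And>v. b < \<bar>v\<bar> \<Longrightarrow> f v = 0"
    "(\<integral>\<^sup>+v. ennreal ((p v / f v)\<^sup>2 * f v) \<partial>lborel) \<le> (\<integral>\<^sup>+v. ennreal ((g v / F v)\<^sup>2 * F v) \<partial>lborel)"
    by (rule weak_derivative_primitive[OF g(1) b(1) less_add_one F(2) b(2)], rule that)
  have mass: "(\<integral>\<^sup>+v. ennreal (f v) \<partial>lborel) = 1"
    using F(3) fp(3) by (subst nn_integral_cong_AE[where v="\<lambda>v. ennreal (F v)"]) auto
  have "(\<integral>\<^sup>+v. ennreal ((p v / f v)\<^sup>2 * f v) \<partial>lborel) \<le> fisher_information F + 1"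
    using fp(6) g(2) by order
  also have "\<dots> = ennreal (enn2real (fisher_information F) + 1)"
    using fin by (simp add: less_top)
  finally have "f v \<le> sqrt (enn2real (fisher_information F) + 1 + 1)" for v
    by (intro fisher_info_bounds(1)[OF fp(1,2,4) mass]) auto
  moreover have "f \<in> borel_measurable borel"
    using borel_measurable_primitive[OF fp(1)] by (simp add: fp(2)[abs_def])
  ultimately show thesis using that fp by (simp add: add.assoc)
qed

lemma fisher_information_ge_4:
  fixes F :: "real \<Rightarrow> real"
  assumes F: "F \<in> borel_measurable borel" "\<And>v. 0 \<le> F v" "(\<integral>\<^sup>+v. ennreal (F v) \<partial>lborel) = 1"
    and b: "AE v in lborel. 3 / 2 < \<bar>v\<bar> \<longrightarrow> F v = 0"
  shows "4 \<le> fisher_information F"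
  unfolding fisher_information_def
proof (rule INF_greatest)
  fix g assume "g \<in> {g. has_weak_derivative F g}"
  then have g: "has_weak_derivative F g" by simp
  let ?K = "\<integral>\<^sup>+v. ennreal ((g v / F v)\<^sup>2 * F v) \<partial>lborel"
  show "4 \<le> ?K"
  proof (cases "?K = \<infinity>")
    case False
    then obtain K where K: "?K = ennreal K" "0 \<le> K" by (cases "?K" rule: ennreal_cases) auto
    obtain f p where fp: "integrable lborel p" "\<And>v. f v = primitive p v" "AE v in lborel. F v = f v"
      "\<And>v. 0 \<le> f v" "\<And>v. 3 / 2 < \<bar>v\<bar> \<Longrightarrow> f v = 0"
      "(\<integral>\<^sup>+v. ennreal ((p v / f v)\<^sup>2 * f v) \<partial>lborel) \<le> ?K"
      by (rule weak_derivative_primitive[OF g _ less_add_one F(2) b], simp, rule that)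
    have mass: "(\<integral>\<^sup>+v. ennreal (f v) \<partial>lborel) = 1"
      using F(3) fp(3) by (subst nn_integral_cong_AE[where v="\<lambda>v. ennreal (F v)"]) auto
    have "4 \<le> K"
      using fp(6) K by (intro fisher_info_bounds(2)[OF fp(1,2,4) mass _ K(2) fp(5)]) auto
    then have "ennreal 4 \<le> ennreal K" by (rule ennreal_leI)
    then show ?thesis by (simp add: K(1))
  qed simp
qed

section \<open>Integration over spheres\<close>

text \<open>Squared norms add when the index set is split. Radii are therefore parametrised by their
  squares, and splitting off a block of coordinates becomes a translation.\<close>

definition sqn :: "nat set \<Rightarrow> (nat \<Rightarrow> real) \<Rightarrow> real" where
  "sqn I x = (\<Sum>i\<in>I. (x i)\<^sup>2)"

definition udir :: "nat set \<Rightarrow> (nat \<Rightarrow> real) \<Rightarrow> nat \<Rightarrow> real" where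
  "udir I x = (\<lambda>i\<in>I. x i / sqrt (sqn I x))"

abbreviation leb :: "nat set \<Rightarrow> (nat \<Rightarrow> real) measure" where
  "leb I \<equiv> Pi\<^sub>M I (\<lambda>_. lborel)"

interpretation lebesgue_product: product_sigma_finite "\<lambda>_::nat. lborel :: real measure"
  by standard

lemma sqn_nonneg [simp]: "0 \<le> sqn I x"
  by (simp add: sqn_def sum_nonneg)

lemma L2_set_eq_sqrt_sqn: "L2_set x I = sqrt (sqn I x)"
  by (simp add: sqn_def L2_set_def)

lemma measurable_sqn [measurable]: "sqn I \<in> borel_measurable (leb I)"
  unfolding sqn_def by measurable

lemma measurable_udir [measurable]: "udir I \<in> measurable (leb I) (leb I)"
  unfolding udir_def by measurable

lemma sqn_scale: "sqn I (\<lambda>i\<in>I. c * x i) = c\<^sup>2 * sqn I x"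
  by (simp add: sqn_def sum_distrib_left power_mult_distrib)

lemma udir_scale: "c > 0 \<Longrightarrow> udir I (\<lambda>i\<in>I. c * x i) = udir I x"
  unfolding udir_def sqn_scale by (auto simp: real_sqrt_mult)

lemma sigma_finite_leb: "finite I \<Longrightarrow> sigma_finite_measure (leb I)"
  by (rule lebesgue_product.sigma_finite)

text \<open>One affine substitution per coordinate, by induction on \<open>I\<close>.\<close>

lemma nn_integral_leb_scale:
  assumes "finite I" "c > 0" "h \<in> borel_measurable (leb I)"
  shows "(\<integral>\<^sup>+x. h x \<partial>leb I) = ennreal (c ^ card I) * (\<integral>\<^sup>+x. h (\<lambda>i\<in>I. c * x i) \<partial>leb I)"
  using assms(1,3)
proof (induction I arbitrary: h rule: finite_induct)
  case empty
  then show ?case by (simp add: PiM_empty nn_integral_count_space_finite)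
next
  case (insert i I)
  note [measurable] = insert.prems
  interpret sigma_finite_measure "leb I" using insert(1) by (rule sigma_finite_leb)
  have meas1 [measurable]: "(\<lambda>x. (fst x)(i := snd x)) \<in> measurable (leb I \<Otimes>\<^sub>M lborel) (leb (insert i I))"
    by (rule measurable_fun_upd) auto
  have upd: "(\<lambda>j\<in>insert i I. c * (x(i := y)) j) = (\<lambda>j\<in>I. c * x j)(i := c * y)" for x y
    using insert(2) by auto
  have mk [measurable]: "(\<lambda>x. \<lambda>i\<in>J. c * x i) \<in> measurable (leb J) (leb J)" for J
    by measurable
  have "(\<lambda>z. h ((fst z)(i := snd z))) \<in> borel_measurable (leb I \<Otimes>\<^sub>M lborel)"
    by measurable
  have G [measurable]: "(\<lambda>x. \<integral>\<^sup>+y. h (x(i := c * y)) \<partial>lborel) \<in> borel_measurable (leb I)"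
  proof -
    have m: "(\<lambda>z. (fst z)(i := c * snd z)) \<in> measurable (leb I \<Otimes>\<^sub>M lborel) (leb (insert i I))"
      by (rule measurable_fun_upd) auto
    have "(\<lambda>z. h ((fst z)(i := c * snd z))) \<in> borel_measurable (leb I \<Otimes>\<^sub>M lborel)"
      by (rule measurable_compose[OF m insert.prems])
    then show ?thesis
      by (auto intro!: lborel.borel_measurable_nn_integral simp: split_beta')
  qed
  have "(\<integral>\<^sup>+x. h x \<partial>leb (insert i I)) = (\<integral>\<^sup>+x. (\<integral>\<^sup>+y. h (x(i := y)) \<partial>lborel) \<partial>leb I)"
    using insert by (intro lebesgue_product.product_nn_integral_insert) auto
  also have "\<dots> = (\<integral>\<^sup>+x. ennreal c * (\<integral>\<^sup>+y. h (x(i := c * y)) \<partial>lborel) \<partial>leb I)"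
  proof (intro nn_integral_cong)
    fix x assume x: "x \<in> space (leb I)"
    have "(\<lambda>y. h (x(i := y))) \<in> borel_measurable lborel"
      using measurable_comp[OF measurable_component_update[OF x insert(2)] insert.prems] by (simp add: comp_def)
    then show "(\<integral>\<^sup>+y. h (x(i := y)) \<partial>lborel) = ennreal c * (\<integral>\<^sup>+y. h (x(i := c * y)) \<partial>lborel)"
      using nn_integral_real_affine[of "\<lambda>y. h (x(i := y))" c 0] assms(2) by simp
  qed
  also have "\<dots> = ennreal c * (\<integral>\<^sup>+x. (\<integral>\<^sup>+y. h (x(i := c * y)) \<partial>lborel) \<partial>leb I)"
    by (intro nn_integral_cmult) measurable
  also have "\<dots> = ennreal c * (ennreal (c ^ card I) *
     (\<integral>\<^sup>+x. (\<integral>\<^sup>+y. h ((\<lambda>j\<in>I. c * x j)(i := c * y)) \<partial>lborel) \<partial>leb I))"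
    by (subst insert.IH[OF G]) simp
  also have "(\<integral>\<^sup>+x. (\<integral>\<^sup>+y. h ((\<lambda>j\<in>I. c * x j)(i := c * y)) \<partial>lborel) \<partial>leb I) =
     (\<integral>\<^sup>+x. h (\<lambda>j\<in>insert i I. c * x j) \<partial>leb (insert i I))"
    unfolding upd[symmetric]
    by (rule lebesgue_product.product_nn_integral_insert[symmetric]) (use insert in auto)
  finally show ?case
    using insert(1,2) assms(2) by (simp add: ennreal_mult mult.assoc del: restrict_apply)
qed

lemma AE_leb_sqn_pos:
  assumes "finite I" "I \<noteq> {}"
  shows "AE x in leb I. 0 < sqn I x"
proof -
  interpret finite_product_sigma_finite "\<lambda>_. lborel :: real measure" I by standard (rule assms)
  have "emeasure (leb I) (Pi\<^sub>E I (\<lambda>_. {0})) = 0"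
    using assms by (subst measure_times) (auto simp: prod_zero_iff)
  then have "Pi\<^sub>E I (\<lambda>_. {0}) \<in> null_sets (leb I)"
    using sets_PiM_I_finite[of I "\<lambda>_. {0}" "\<lambda>_. lborel"] assms(1) by (simp add: null_sets_def del: PiE_singleton)
  then show ?thesis
  proof (rule AE_I')
    show "{x \<in> space (leb I). \<not> 0 < sqn I x} \<subseteq> Pi\<^sub>E I (\<lambda>_. {0})"
    proof
      fix x assume "x \<in> {x \<in> space (leb I). \<not> 0 < sqn I x}"
      then have x: "x \<in> space (leb I)" "\<not> 0 < sqn I x" by auto
      then have "sqn I x = 0" using sqn_nonneg[of I x] by linarith
      then have "\<forall>i\<in>I. x i = 0"
        using assms by (simp add: sqn_def sum_nonneg_eq_0_iff)
      then show "x \<in> Pi\<^sub>E I (\<lambda>_. {0})" using x by (auto simp: space_PiM PiE_iff fun_eq_iff extensional_def)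
    qed
  qed
qed

lemma nn_integral_powr_atLeast_1:
  assumes "a > (0::real)"
  shows "(\<integral>\<^sup>+s. ennreal (a * s powr (- 1 - a)) * indicator {1..} s \<partial>lborel) = 1"
proof -
  have "(\<integral>\<^sup>+s. ennreal (a * s powr (- 1 - a)) * indicator {1..} s \<partial>lborel) = ennreal (0 - (- (1 powr (- a))))"
  proof (rule nn_integral_FTC_atLeast)
    show "((\<lambda>s. - (s powr (- a))) \<longlongrightarrow> 0) at_top"
      using tendsto_minus[OF tendsto_neg_powr[of "- a" "\<lambda>x::real. x" at_top]] assms
      by (simp add: filterlim_ident)
    show "DERIV (\<lambda>s. - (s powr (- a))) s :> a * s powr (- 1 - a)" if "1 \<le> s" for s
      using that assms by (auto intro!: derivative_eq_intros simp: powr_diff powr_minus field_simps)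
  qed (use assms in auto)
  then show ?thesis by simp
qed

lemma nn_integral_powr_unit:
  assumes "a > (0::real)"
  shows "(\<integral>\<^sup>+t. ennreal (t powr (a - 1)) * indicator {0<..1} t \<partial>lborel) = ennreal (1 / a)"
proof -
  have "((\<lambda>t. t powr (a - 1)) has_integral (1 powr (a - 1 + 1) / (a - 1 + 1))) {0..1}"
    using assms by (intro has_integral_powr_from_0) auto
  then have "(\<integral>\<^sup>+t. ennreal (indicator {0..1} t * t powr (a - 1)) \<partial>lborel) = ennreal (1 / a)"
    by (intro nn_integral_has_integral_lebesgue nn_integral_has_integral_lborel) (auto simp: indicator_def if_distrib cong: if_cong dest: has_integral_restrict_UNIV[THEN iffD2])
  then show ?thesis
    by (auto simp: indicator_def intro!: nn_integral_cong elim!: trans[rotated])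
qed

text \<open>Polar coordinates with T = |x|^2 and without a surface measure: averaging over
  directions is integrating a function of the direction over the unit ball. Fubini and scaling turn
  the right side into the left side times the integral of (m/2) s^(- 1 - m/2) over s >= 1, which is
  1.\<close>

lemma nn_integral_leb_polar:
  assumes J: "finite J" "J \<noteq> {}"
    and k [measurable]: "case_prod k \<in> borel_measurable (borel \<Otimes>\<^sub>M leb J)"
  defines "m \<equiv> real (card J)"
  shows "(\<integral>\<^sup>+x. k (sqn J x) (udir J x) \<partial>leb J) =
    (\<integral>\<^sup>+T. ennreal (m / 2 * T powr (m / 2 - 1)) * indicator {0<..} T *
       (\<integral>\<^sup>+y. indicator {y. sqn J y \<le> 1} y * k T (udir J y) \<partial>leb J) \<partial>lborel)"
proof -
  let ?B = "\<lambda>T. \<integral>\<^sup>+y. indicator {y. sqn J y \<le> 1} y * k T (udir J y) \<partial>leb J"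
  let ?L = "\<integral>\<^sup>+x. k (sqn J x) (udir J x) \<partial>leb J"
  let ?e = "\<lambda>T x. ennreal (m / 2 / T) * indicator {0<..} T * indicator {y. sqn J y \<le> T} x * k T (udir J x)"
  let ?f = "\<lambda>s x. ennreal (m / 2 / s) * indicator {1..} s * k (s * sqn J x) (udir J x)"
  interpret sigma_finite_measure "leb J" using J(1) by (rule sigma_finite_leb)
  interpret P: pair_sigma_finite "leb J" lborel by standard
  have m: "m > 0" using J by (simp add: m_def card_gt_0_iff)
  have sqrt_pow: "sqrt t ^ card J = t powr (m / 2)" if "t > 0" for t
    using that by (simp add: m_def powr_half_sqrt[symmetric] powr_powr flip: powr_realpow)
  have k1: "k t \<in> borel_measurable (leb J)" for t
    by measurable
  have k2 [measurable]: "(\<lambda>x. k (f x) (g x)) \<in> borel_measurable N"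
    if "f \<in> borel_measurable N" "g \<in> measurable N (leb J)" for f g and N :: "'z measure"
  proof -
    have "(\<lambda>x. (f x, g x)) \<in> measurable N (borel \<Otimes>\<^sub>M leb J)" using that by measurable
    from measurable_compose[OF this k] show ?thesis by simp
  qed
  \<comment> \<open>Blowing the unit ball up to squared radius T costs T^(- m/2), which leaves the
    scale-invariant weight 1/T.\<close>
  have "(\<integral>\<^sup>+T. ennreal (m / 2 * T powr (m / 2 - 1)) * indicator {0<..} T *
       ?B T \<partial>lborel) =
    (\<integral>\<^sup>+T. (\<integral>\<^sup>+x. ?e T x \<partial>leb J) \<partial>lborel)"
  proof (rule nn_integral_cong)
    fix T :: real
    show "ennreal (m / 2 * T powr (m / 2 - 1)) * indicator {0<..} T *
       ?B T =
       (\<integral>\<^sup>+x. ?e T x \<partial>leb J)"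
    proof (cases "T > 0")
      case True
      have "(\<integral>\<^sup>+x. indicator {y. sqn J y \<le> T} x * k T (udir J x) \<partial>leb J) =
        ennreal (sqrt T ^ card J) * (\<integral>\<^sup>+y. indicator {y. sqn J y \<le> T} (\<lambda>i\<in>J. sqrt T * y i) * k T (udir J (\<lambda>i\<in>J. sqrt T * y i)) \<partial>leb J)"
        using True J by (intro nn_integral_leb_scale) auto
      also have "\<dots> = ennreal (sqrt T ^ card J) * ?B T"
        using True by (intro arg_cong[where f="\<lambda>x. _ * x"] nn_integral_cong) (auto simp: sqn_scale udir_scale indicator_def)
      finally have *: "(\<integral>\<^sup>+x. indicator {y. sqn J y \<le> T} x * k T (udir J x) \<partial>leb J) =
        ennreal (T powr (m / 2)) * ?B T"
        using True by (simp add: sqrt_pow)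
      have "(\<integral>\<^sup>+x. ?e T x \<partial>leb J) =
        ennreal (m / 2 / T) * (\<integral>\<^sup>+x. indicator {y. sqn J y \<le> T} x * k T (udir J x) \<partial>leb J)"
        using True by (subst nn_integral_cmult[symmetric]) (auto simp: mult.assoc)
      also have "\<dots> = ennreal (m / 2 / T * T powr (m / 2)) * ?B T"
        unfolding * using True m by (subst ennreal_mult) (auto simp: mult.assoc)
      also have "m / 2 / T * T powr (m / 2) = m / 2 * T powr (m / 2 - 1)"
        using True by (simp add: powr_diff)
      finally show ?thesis using True by simp
    qed auto
  qed
  also have "\<dots> = (\<integral>\<^sup>+x. (\<integral>\<^sup>+T. ?e T x \<partial>lborel) \<partial>leb J)"
    by (rule P.Fubini') (auto simp: indicator_def cong: measurable_cong)
  \<comment> \<open>With T = s |x|^2 the constraint |x|^2 <= T becomes s >= 1, and dT / T = ds /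
    s.\<close>
  also have "\<dots> = (\<integral>\<^sup>+x. (\<integral>\<^sup>+s. ?f s x \<partial>lborel) \<partial>leb J)"
    using AE_leb_sqn_pos[OF J] AE_space[of "leb J"]
  proof (intro nn_integral_cong_AE, eventually_elim)
    case (elim x)
    then have "udir J x \<in> space (leb J)" by (intro measurable_space[OF measurable_udir])
    then have kx: "(\<lambda>T. k (f T) (udir J x)) \<in> borel_measurable borel" if "f \<in> borel_measurable borel" for f
      using that by (intro k2) auto
    have "(\<integral>\<^sup>+T. ?e T x \<partial>lborel)
      = \<bar>sqn J x\<bar> * (\<integral>\<^sup>+s. ?e (0 + sqn J x * s) x \<partial>lborel)"
    proof (intro nn_integral_real_affine borel_measurable_times_ennreal kx)
      show "(\<lambda>T. indicator {y. sqn J y \<le> T} x :: ennreal) \<in> borel_measurable borel"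
        unfolding indicator_def by measurable
    qed (use elim in auto)
    also have "\<dots> = (\<integral>\<^sup>+s. ennreal (sqn J x) * (?e (0 + sqn J x * s) x) \<partial>lborel)"
    proof (subst nn_integral_cmult)
      have "(\<lambda>s. indicator {y. sqn J y \<le> 0 + sqn J x * s} x :: ennreal) \<in> borel_measurable borel"
        "(\<lambda>s. indicator {0<..} (0 + sqn J x * s) :: ennreal) \<in> borel_measurable borel"
        unfolding indicator_def by measurable
      then have "(\<lambda>s. ?e (0 + sqn J x * s) x) \<in> borel_measurable borel"
        by (intro borel_measurable_times_ennreal kx) auto
      then show "(\<lambda>s. ?e (0 + sqn J x * s) x) \<in> borel_measurable lborel"
        by (simp only: measurable_lborel2)
    qed (use elim in auto)
    also have "\<dots> = (\<integral>\<^sup>+s. ?f s x \<partial>lborel)"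
    proof (rule nn_integral_cong)
      fix s
      show "ennreal (sqn J x) * (?e (0 + sqn J x * s) x) =
        ?f s x"
      proof (cases "s \<ge> 1")
        case True
        then have "0 < sqn J x * s" "sqn J x \<le> sqn J x * s" using elim by auto
        moreover have "ennreal (sqn J x) * ennreal (m / 2 / (sqn J x * s)) = ennreal (m / 2 / s)"
          using True elim m by (subst ennreal_mult[symmetric]) auto
        ultimately show ?thesis using True
          by (simp add: mult.assoc[symmetric] mult.commute[of s])
      next
        case False
        then have "\<not> sqn J x \<le> sqn J x * s" using elim by simp
        then show ?thesis using False by simp
      qed
    qed
    finally show ?case .
  qed
  also have "\<dots> = (\<integral>\<^sup>+s. (\<integral>\<^sup>+x. ?f s x \<partial>leb J) \<partial>lborel)"
    by (rule P.Fubini'[symmetric]) (auto simp: indicator_def cong: measurable_cong)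
  \<comment> \<open>Rescaling \<open>x\<close> by sqrt s moves the dependence on \<open>s\<close>
    into a power and leaves the original integral \<open>?L\<close>.\<close>
  also have "\<dots> = (\<integral>\<^sup>+s. ennreal (m / 2 * s powr (- 1 - m / 2)) * indicator {1..} s * ?L \<partial>lborel)"
  proof (rule nn_integral_cong)
    fix s :: real
    show "(\<integral>\<^sup>+x. ?f s x \<partial>leb J) =
      ennreal (m / 2 * s powr (- 1 - m / 2)) * indicator {1..} s * ?L"
    proof (cases "s \<ge> 1")
      case True
      have "?L =
        ennreal (sqrt s ^ card J) * (\<integral>\<^sup>+x. k (sqn J (\<lambda>i\<in>J. sqrt s * x i)) (udir J (\<lambda>i\<in>J. sqrt s * x i)) \<partial>leb J)"
        using True J by (intro nn_integral_leb_scale) auto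
      also have "\<dots> = ennreal (s powr (m / 2)) * (\<integral>\<^sup>+x. k (s * sqn J x) (udir J x) \<partial>leb J)"
        using True by (simp add: sqn_scale udir_scale sqrt_pow)
      finally have *: "?L = ennreal (s powr (m / 2)) * (\<integral>\<^sup>+x. k (s * sqn J x) (udir J x) \<partial>leb J)" .
      have "m / 2 / s = m / 2 * s powr (- 1 - m / 2) * s powr (m / 2)"
        using True by (simp add: mult.assoc powr_minus_divide flip: powr_add)
      then have "ennreal (m / 2 / s) = ennreal (m / 2 * s powr (- 1 - m / 2)) * ennreal (s powr (m / 2))"
        using m by (simp only: ennreal_mult mult_nonneg_nonneg powr_ge_zero divide_nonneg_nonneg less_imp_le zero_le_numeral)
      then show ?thesis using True unfolding *
        by (simp add: nn_integral_cmult mult.assoc)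
    qed auto
  qed
  also have "\<dots> = (\<integral>\<^sup>+s. ennreal (m / 2 * s powr (- 1 - m / 2)) * indicator {1..} s \<partial>lborel) * ?L"
    by (intro nn_integral_multc) auto
  also have "\<dots> = ?L"
    using nn_integral_powr_atLeast_1[of "m / 2"] m by simp
  finally show ?thesis by simp
qed

text \<open>Only the \<open>J\<close>-block is scaled: \<open>w\<close> holds actual coordinates,
  while \<open>y\<close> is either a direction or, with \<open>s = 1\<close>, a point of the fibre
  over \<open>w\<close>.\<close>

definition glue :: "nat set \<Rightarrow> nat set \<Rightarrow> real \<Rightarrow> (nat \<Rightarrow> real) \<Rightarrow> (nat \<Rightarrow> real) \<Rightarrow> nat \<Rightarrow> real" where
  "glue K J s w y = (\<lambda>i\<in>K \<union> J. if i \<in> K then w i else s * y i)"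

lemma measurable_glue:
  assumes "\<And>i. i \<in> K \<Longrightarrow> (\<lambda>z. f z i) \<in> borel_measurable N" "g \<in> borel_measurable N" "e \<in> measurable N (leb J)"
  shows "(\<lambda>z. glue K J (g z) (f z) (e z)) \<in> measurable N (leb (K \<union> J))"
  unfolding glue_def
proof (rule measurable_restrict)
  fix i assume "i \<in> K \<union> J"
  show "(\<lambda>z. if i \<in> K then f z i else g z * e z i) \<in> measurable N lborel"
  proof (cases "i \<in> K")
    case False
    then have "i \<in> J" using \<open>i \<in> K \<union> J\<close> by simp
    then have "(\<lambda>z. e z i) \<in> measurable N lborel"
      using measurable_compose[OF assms(3) measurable_component_singleton[of i J]] by simp
    then show ?thesis using False assms(2) by simp
  qed (simp add: assms)
qed

text \<open>The \<open>K\<close>-block of the direction of (w, z) is w / sqrt T with T = |w|^2 +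
  |z|^2. Polar coordinates in z, a shift to the total squared radius T and the scaling of w by sqrt
  T separate the variables. The T-integral over (0, 1] is 2/n, and with the factor m/2 of the polar
  formula it gives m/n.\<close>

lemma nn_integral_sphere_split_unit:
  assumes fin: "finite K" "finite J" "J \<noteq> {}" "K \<inter> J = {}"
    and h: "h \<in> borel_measurable (leb (K \<union> J))"
  defines "m \<equiv> real (card J)" and "n \<equiv> real (card (K \<union> J))"
  shows "(\<integral>\<^sup>+x. indicator {x. sqn (K \<union> J) x \<le> 1} x * h (udir (K \<union> J) x) \<partial>leb (K \<union> J)) =
    ennreal (m / n) * (\<integral>\<^sup>+w. ennreal ((1 - sqn K w) powr (m / 2 - 1)) * indicator {w. sqn K w < 1} w *
      (\<integral>\<^sup>+y. indicator {y. sqn J y \<le> 1} y * h (glue K J (sqrt (1 - sqn K w)) w (udir J y)) \<partial>leb J) \<partial>leb K)"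
proof -
  let ?c = "\<lambda>w. ennreal ((1 - sqn K w) powr (m / 2 - 1)) * indicator {w. sqn K w < 1} w"
  let ?d = "\<lambda>w T. ennreal (m / 2 * (T - sqn K w) powr (m / 2 - 1)) * indicator {sqn K w<..} T"
  interpret J: sigma_finite_measure "leb J" using fin(2) by (rule sigma_finite_leb)
  interpret K: sigma_finite_measure "leb K" using fin(1) by (rule sigma_finite_leb)
  interpret P: pair_sigma_finite "leb K" lborel by standard
  have m: "m > 0" using fin by (simp add: m_def card_gt_0_iff)
  have n: "n = real (card K) + m" using fin by (simp add: m_def n_def card_Un_disjoint)
  have hm: "(\<lambda>z. h (glue K J (g z) (f z) (e z))) \<in> borel_measurable N"
    if "\<And>i. i \<in> K \<Longrightarrow> (\<lambda>z. f z i) \<in> borel_measurable N" "g \<in> borel_measurable N" "e \<in> measurable N (leb J)"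
    for f g e and N :: "'z measure"
    using measurable_compose[OF measurable_glue[OF that] h] .
  \<comment> \<open>The integrand in terms of \<open>w\<close>, T = |z|^2 and the direction of
    z.\<close>
  define k where "k w T \<theta> = indicator {T. sqn K w + T \<le> 1} T *
     h (glue K J (sqrt T / sqrt (sqn K w + T)) (\<lambda>i. w i / sqrt (sqn K w + T)) \<theta>)" for w T \<theta>
  let ?L = "\<lambda>w T. \<integral>\<^sup>+y. indicator {y. sqn J y \<le> 1} y * k w T (udir J y) \<partial>leb J"
  have k_meas: "(\<lambda>z. k (f z) (g z) (e z)) \<in> borel_measurable N"
    if [measurable]: "f \<in> measurable N (leb K)" "g \<in> borel_measurable N" "e \<in> measurable N (leb J)"
    for f g e and N :: "'z measure"
  proof -
    have [measurable]: "(\<lambda>z. f z i) \<in> borel_measurable N" if "i \<in> K" for i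
      using measurable_compose[OF \<open>f \<in> _\<close> measurable_component_singleton[OF that]] by simp
    have [measurable]: "(\<lambda>z. h (glue K J (sqrt (g z) / sqrt (sqn K (f z) + g z)) (\<lambda>i. f z i / sqrt (sqn K (f z) + g z)) (e z))) \<in> borel_measurable N"
      by (rule hm) measurable
    show ?thesis unfolding k_def indicator_def by measurable
  qed
  have inner: "(\<lambda>z. \<integral>\<^sup>+y. indicator {y. sqn J y \<le> 1} y * k (f z) (g z) (udir J y) \<partial>leb J) \<in> borel_measurable N"
    if [measurable]: "f \<in> measurable N (leb K)" "g \<in> borel_measurable N" for f g and N :: "'z measure"
  proof -
    have [measurable]: "(\<lambda>p. k (f (fst p)) (g (fst p)) (udir J (snd p))) \<in> borel_measurable (N \<Otimes>\<^sub>M leb J)"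
      by (rule k_meas) measurable
    have "(\<lambda>p. indicator {y. sqn J y \<le> 1} (snd p) * k (f (fst p)) (g (fst p)) (udir J (snd p))) \<in> borel_measurable (N \<Otimes>\<^sub>M leb J)"
      unfolding indicator_def by measurable
    then show ?thesis by (intro J.borel_measurable_nn_integral) (simp add: split_beta')
  qed
  define R where "R w = (\<integral>\<^sup>+y. indicator {y. sqn J y \<le> 1} y * h (glue K J (sqrt (1 - sqn K w)) w (udir J y)) \<partial>leb J)" for w
  have R [measurable]: "R \<in> borel_measurable (leb K)"
  proof -
    have [measurable]: "(\<lambda>p. h (glue K J (sqrt (1 - sqn K (fst p))) (fst p) (udir J (snd p)))) \<in> borel_measurable (leb K \<Otimes>\<^sub>M leb J)"
      by (rule hm) measurable
    have "(\<lambda>p. indicator {y. sqn J y \<le> 1} (snd p) * h (glue K J (sqrt (1 - sqn K (fst p))) (fst p) (udir J (snd p)))) \<in> borel_measurable (leb K \<Otimes>\<^sub>M leb J)"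
      unfolding indicator_def by measurable
    then show ?thesis unfolding R_def by (intro J.borel_measurable_nn_integral) (simp add: split_beta')
  qed
  have "(\<integral>\<^sup>+x. indicator {x. sqn (K \<union> J) x \<le> 1} x * h (udir (K \<union> J) x) \<partial>leb (K \<union> J)) =
    (\<integral>\<^sup>+w. (\<integral>\<^sup>+z. indicator {x. sqn (K \<union> J) x \<le> 1} (merge K J (w, z)) * h (udir (K \<union> J) (merge K J (w, z))) \<partial>leb J) \<partial>leb K)"
  proof (rule lebesgue_product.product_nn_integral_fold)
    have [measurable]: "(\<lambda>x. h (udir (K \<union> J) x)) \<in> borel_measurable (leb (K \<union> J))"
      by (rule measurable_compose[OF measurable_udir h])
    show "(\<lambda>x. indicator {x. sqn (K \<union> J) x \<le> 1} x * h (udir (K \<union> J) x)) \<in> borel_measurable (leb (K \<union> J))"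
      unfolding indicator_def by measurable
  qed (use fin in auto)
  also have "\<dots> = (\<integral>\<^sup>+w. (\<integral>\<^sup>+z. k w (sqn J z) (udir J z) \<partial>leb J) \<partial>leb K)"
  proof (intro nn_integral_cong)
    fix w z
    have sq: "sqn (K \<union> J) (merge K J (w, z)) = sqn K w + sqn J z"
    proof -
      have "sqn (K \<union> J) (merge K J (w, z)) = (\<Sum>i\<in>K. (merge K J (w, z) i)\<^sup>2) + (\<Sum>i\<in>J. (merge K J (w, z) i)\<^sup>2)"
        unfolding sqn_def using fin by (intro sum.union_disjoint) auto
      also have "(\<Sum>i\<in>K. (merge K J (w, z) i)\<^sup>2) = sqn K w"
        unfolding sqn_def by (intro sum.cong) (auto simp: merge_def)
      also have "(\<Sum>i\<in>J. (merge K J (w, z) i)\<^sup>2) = sqn J z"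
        unfolding sqn_def using fin by (intro sum.cong) (auto simp: merge_def)
      finally show ?thesis .
    qed
    have z0: "z i = sqrt (sqn J z) * udir J z i" if "i \<in> J" for i
    proof (cases "sqn J z = 0")
      case True
      then have "z i = 0" using that fin by (simp add: sqn_def sum_nonneg_eq_0_iff)
      then show ?thesis using True by simp
    qed (use that in \<open>simp add: udir_def\<close>)
    have "udir (K \<union> J) (merge K J (w, z)) =
      glue K J (sqrt (sqn J z) / sqrt (sqn K w + sqn J z)) (\<lambda>i. w i / sqrt (sqn K w + sqn J z)) (udir J z)"
      unfolding udir_def[of "K \<union> J"] sq glue_def using fin z0 by (auto simp: fun_eq_iff merge_def)
    then show "indicator {x. sqn (K \<union> J) x \<le> 1} (merge K J (w, z)) * h (udir (K \<union> J) (merge K J (w, z))) = k w (sqn J z) (udir J z)"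
      by (simp add: k_def sq indicator_def)
  qed
  also have "\<dots> = (\<integral>\<^sup>+w. (\<integral>\<^sup>+T. ennreal (m / 2 * T powr (m / 2 - 1)) * indicator {0<..} T *
       ?L w T \<partial>lborel) \<partial>leb K)"
  proof (intro nn_integral_cong)
    fix w assume w: "w \<in> space (leb K)"
    show "(\<integral>\<^sup>+z. k w (sqn J z) (udir J z) \<partial>leb J) = (\<integral>\<^sup>+T. ennreal (m / 2 * T powr (m / 2 - 1)) * indicator {0<..} T *
       ?L w T \<partial>lborel)"
      unfolding m_def
    proof (rule nn_integral_leb_polar[OF fin(2,3)])
      have "(\<lambda>p. k w (fst p) (snd p)) \<in> borel_measurable (borel \<Otimes>\<^sub>M leb J)"
        by (rule k_meas) (use w in auto)
      then show "case_prod (k w) \<in> borel_measurable (borel \<Otimes>\<^sub>M leb J)" by (simp add: split_beta')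
    qed
  qed
  \<comment> \<open>From here on T is the total squared radius |w|^2 + |z|^2.\<close>
  also have "\<dots> = (\<integral>\<^sup>+w. (\<integral>\<^sup>+T. ?d w T *
       ?L w (T - sqn K w) \<partial>lborel) \<partial>leb K)"
  proof (rule nn_integral_cong)
    fix w assume w: "w \<in> space (leb K)"
    have im: "(\<lambda>T. \<integral>\<^sup>+y. indicator {y. sqn J y \<le> 1} y * k w T (udir J y) \<partial>leb J) \<in> borel_measurable borel"
      by (rule inner) (use w in auto)
    show "(\<integral>\<^sup>+T. ennreal (m / 2 * T powr (m / 2 - 1)) * indicator {0<..} T *
       ?L w T \<partial>lborel) =
       (\<integral>\<^sup>+T. ?d w T *
       ?L w (T - sqn K w) \<partial>lborel)"
    proof (subst nn_integral_real_affine[where c=1 and t="- sqn K w"])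
      show "(\<lambda>T. ennreal (m / 2 * T powr (m / 2 - 1)) * indicator {0<..} T *
          ?L w T) \<in> borel_measurable borel"
        by (intro borel_measurable_times_ennreal im) auto
    qed (auto intro!: nn_integral_cong simp: indicator_def)
  qed
  also have "\<dots> = (\<integral>\<^sup>+T. (\<integral>\<^sup>+w. ?d w T *
       ?L w (T - sqn K w) \<partial>leb K) \<partial>lborel)"
  proof (rule P.Fubini'[symmetric])
    have [measurable]: "(\<lambda>p. \<integral>\<^sup>+y. indicator {y. sqn J y \<le> 1} y * k (fst p) (snd p - sqn K (fst p)) (udir J y) \<partial>leb J) \<in> borel_measurable (leb K \<Otimes>\<^sub>M lborel)"
      by (rule inner) auto
    show "(\<lambda>(w, T). ?d w T *
       ?L w (T - sqn K w)) \<in> borel_measurable (leb K \<Otimes>\<^sub>M lborel)"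
      unfolding split_beta' indicator_def[of "greaterThan _"] greaterThan_iff by measurable
  qed
  also have "\<dots> = (\<integral>\<^sup>+T. ennreal (m / 2) * (ennreal (T powr (n / 2 - 1)) * indicator {0<..1} T) *
       (\<integral>\<^sup>+w. ?c w * R w \<partial>leb K) \<partial>lborel)"
  proof (intro nn_integral_cong)
    fix T :: real
    consider "T \<le> 0" | "T > 1" | "0 < T" "T \<le> 1" by linarith
    then show "(\<integral>\<^sup>+w. ?d w T *
       ?L w (T - sqn K w) \<partial>leb K) =
       ennreal (m / 2) * (ennreal (T powr (n / 2 - 1)) * indicator {0<..1} T) *
       (\<integral>\<^sup>+w. ?c w * R w \<partial>leb K)"
    proof cases
      case 1
      then have "indicator {sqn K w<..} T = (0::ennreal)" for w
        by (auto simp: indicator_def dest: order.strict_trans1[OF sqn_nonneg])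
      then show ?thesis using 1 by simp
    next
      case 2
      then have "k w (T - sqn K w) \<theta> = 0" for w \<theta> by (simp add: k_def)
      then show ?thesis using 2 by simp
    next
      case 3
      have [measurable]: "(\<lambda>w. \<integral>\<^sup>+y. indicator {y. sqn J y \<le> 1} y * k w (T - sqn K w) (udir J y) \<partial>leb J) \<in> borel_measurable (leb K)"
        by (rule inner) auto
      have meas: "(\<lambda>w. ?d w T *
       ?L w (T - sqn K w)) \<in> borel_measurable (leb K)"
        unfolding indicator_def[of "greaterThan _"] greaterThan_iff by measurable
      have pw: "sqrt T ^ card K = T powr (real (card K) / 2)"
        using 3 by (simp add: powr_half_sqrt[symmetric] powr_powr flip: powr_realpow)
      \<comment> \<open>Once w is replaced by sqrt T w, the direction no longer depends on
        T.\<close>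
      have eq: "ennreal (m / 2 * (T - sqn K (\<lambda>i\<in>K. sqrt T * w i)) powr (m / 2 - 1)) * indicator {sqn K (\<lambda>i\<in>K. sqrt T * w i)<..} T *
         (\<integral>\<^sup>+y. indicator {y. sqn J y \<le> 1} y * k (\<lambda>i\<in>K. sqrt T * w i) (T - sqn K (\<lambda>i\<in>K. sqrt T * w i)) (udir J y) \<partial>leb J) =
         ennreal (m / 2 * T powr (m / 2 - 1)) * (?c w * R w)" for w
      proof -
        have s: "sqn K (\<lambda>i\<in>K. sqrt T * w i) = T * sqn K w" using 3 by (simp add: sqn_scale)
        have T1: "T - T * sqn K w = T * (1 - sqn K w)" by (simp add: algebra_simps)
        have gl: "glue K J (sqrt (T * (1 - sqn K w)) / sqrt T) (\<lambda>i. (\<lambda>i\<in>K. sqrt T * w i) i / sqrt T) = glue K J (sqrt (1 - sqn K w)) w"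
          using 3 by (auto simp: glue_def fun_eq_iff real_sqrt_mult)
        have kk: "k (\<lambda>i\<in>K. sqrt T * w i) (T - T * sqn K w) \<theta> = h (glue K J (sqrt (1 - sqn K w)) w \<theta>)" for \<theta>
          using 3 gl by (simp add: k_def s T1) (simp add: algebra_simps)
        show ?thesis
        proof (cases "sqn K w < 1")
          case True
          then have "T * sqn K w < T" using 3 by simp
          moreover have "ennreal (m / 2 * (T - T * sqn K w) powr (m / 2 - 1)) =
              ennreal (m / 2 * T powr (m / 2 - 1)) * ennreal ((1 - sqn K w) powr (m / 2 - 1))"
            unfolding T1 using True 3 m by (simp add: powr_mult ennreal_mult[symmetric])
          ultimately show ?thesis unfolding s kk R_def[symmetric] using True by (simp add: mult.assoc)
        next
          case False
          then have "\<not> T * sqn K w < T" using 3 by simp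
          then show ?thesis unfolding s using False by simp
        qed
      qed
      have "(\<integral>\<^sup>+w. ?d w T *
         ?L w (T - sqn K w) \<partial>leb K) =
         ennreal (sqrt T ^ card K) * (\<integral>\<^sup>+w. ennreal (m / 2 * T powr (m / 2 - 1)) * (?c w * R w) \<partial>leb K)"
        using 3 by (subst nn_integral_leb_scale[OF fin(1) _ meas, of "sqrt T"]) (simp_all only: eq real_sqrt_gt_0_iff)
      also have "\<dots> = ennreal (T powr (real (card K) / 2)) * (ennreal (m / 2 * T powr (m / 2 - 1)) * (\<integral>\<^sup>+w. (?c w * R w) \<partial>leb K))"
        unfolding pw by (subst nn_integral_cmult) (auto simp: indicator_def)
      \<comment> \<open>The exponents card K / 2, from the scaling of w, and m/2 - 1 add up to n/2 -
        1.\<close>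
      also have "ennreal (T powr (real (card K) / 2)) * (ennreal (m / 2 * T powr (m / 2 - 1)) * Z) = ennreal (m / 2) * ennreal (T powr (n / 2 - 1)) * Z" for Z
      proof -
        have "T powr (real (card K) / 2) * (m / 2 * T powr (m / 2 - 1)) = m / 2 * T powr (n / 2 - 1)"
          unfolding n by (simp add: add_divide_distrib powr_add[symmetric] mult.left_commute add_diff_eq)
        then have "ennreal (T powr (real (card K) / 2)) * ennreal (m / 2 * T powr (m / 2 - 1)) = ennreal (m / 2) * ennreal (T powr (n / 2 - 1))"
          using m by (subst (1 2) ennreal_mult[symmetric]) auto
        then show ?thesis by (simp only: mult.assoc[symmetric])
      qed
      finally show ?thesis using 3 by simp
    qed
  qed
  also have "\<dots> = ennreal (m / 2) * (\<integral>\<^sup>+T. (ennreal (T powr (n / 2 - 1)) * indicator {0<..1} T) \<partial>lborel) *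
       (\<integral>\<^sup>+w. ?c w * R w \<partial>leb K)"
    by (simp add: nn_integral_multc nn_integral_cmult)
  also have "(\<integral>\<^sup>+T. (ennreal (T powr (n / 2 - 1)) * indicator {0<..1} T) \<partial>lborel) = ennreal (1 / (n / 2))"
    using n m by (intro nn_integral_powr_unit) simp
  also have "ennreal (m / 2) * ennreal (1 / (n / 2)) = ennreal (m / n)"
    using n m by (simp flip: ennreal_mult)
  finally show ?thesis unfolding R_def .
qed

section \<open>Integrals against the sphere measure\<close>

lemma sets_leb_eq: "sets (leb I) = sets (Pi\<^sub>M I (\<lambda>_. borel))"
  by (intro sets_PiM_cong) auto

lemma measurable_leb_eq:
  "measurable (leb I) M = measurable (Pi\<^sub>M I (\<lambda>_. borel)) M"
  "measurable M (leb I) = measurable M (Pi\<^sub>M I (\<lambda>_. borel))"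
  by (auto intro!: measurable_cong_sets sets_leb_eq)

lemma euclidean_sphere_sets: "euclidean_sphere I r \<in> sets (Pi\<^sub>M I (\<lambda>_. borel))"
proof -
  have "sqn I \<in> borel_measurable (Pi\<^sub>M I (\<lambda>_. borel))"
    using measurable_sqn[of I] by (simp only: measurable_leb_eq)
  then show ?thesis unfolding euclidean_sphere_def L2_set_eq_sqrt_sqn by measurable
qed

lemma space_sphere_measure: "space (sphere_measure I r) = euclidean_sphere I r"
  unfolding sphere_measure_def euclidean_sphere_def by (auto simp: space_restrict_space)

lemma sets_sphere_measure:
  "sets (sphere_measure I r) = sets (restrict_space (Pi\<^sub>M I (\<lambda>_. borel)) (euclidean_sphere I r))"
  unfolding sphere_measure_def by (intro sets_restrict_space_cong) simp

lemma measurable_sphere_measureI: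
  "h \<in> measurable (leb I) M \<Longrightarrow> h \<in> measurable (sphere_measure I r) M"
  unfolding measurable_cong_sets[OF sets_sphere_measure refl] measurable_leb_eq
  by (rule measurable_restrict_space1)

lemma emeasure_leb_ball:
  assumes "finite I"
  shows "emeasure (leb I) {x \<in> space (leb I). sqn I x \<le> 1} = ennreal (unit_ball_vol (real (card I)))"
proof -
  have "{x \<in> space (leb I). sqn I x \<le> 1} = {f. sqrt (\<Sum>i\<in>I. (f i)\<^sup>2) \<le> 1} \<inter> space (leb I)"
    by (auto simp: sqn_def)
  then show ?thesis using emeasure_cball_aux[OF assms, of 1] by simp
qed

lemma nn_integral_sphere_measure_restricted:
  assumes I: "finite I" and h: "h \<in> borel_measurable (sphere_measure I r)"
  shows "(\<integral>\<^sup>+x. h x \<partial>sphere_measure I r) = ennreal (1 / unit_ball_vol (real (card I))) *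
    (\<integral>\<^sup>+x. indicator {x. sqn I x \<le> 1} x *
      (h (\<lambda>i\<in>I. r * udir I x i) * indicator (euclidean_sphere I r) (\<lambda>i\<in>I. r * udir I x i)) \<partial>leb I)"
proof -
  let ?B = "{x \<in> space (leb I). sqn I x \<le> 1}"
  let ?u = "\<lambda>x. \<lambda>i\<in>I. r * x i / L2_set x I"
  let ?h = "\<lambda>x. h x * indicator (euclidean_sphere I r) x"
  have u_eq: "?u x = (\<lambda>i\<in>I. r * udir I x i)" for x
    by (auto simp: udir_def L2_set_eq_sqrt_sqn)
  have L2_le: "L2_set x I \<le> 1 \<longleftrightarrow> sqn I x \<le> 1" for x
    by (simp add: L2_set_eq_sqrt_sqn)
  have B [measurable]: "?B \<in> sets (leb I)" by measurable
  have u [measurable]: "?u \<in> measurable (leb I) (Pi\<^sub>M I (\<lambda>_. borel))"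
    unfolding u_eq by (auto simp: udir_def)
  have h': "?h \<in> borel_measurable (Pi\<^sub>M I (\<lambda>_. borel))"
    using h euclidean_sphere_sets[of I r]
    by (subst borel_measurable_restrict_space_iff_ennreal[symmetric])
       (auto simp: measurable_cong_sets[OF sets_sphere_measure refl])
  have hu: "(\<lambda>x. ?h (?u x)) \<in> borel_measurable (leb I)"
    by (rule measurable_compose[OF u h'])
  let ?U = "uniform_measure (leb I) ?B"
  let ?D = "distr ?U (Pi\<^sub>M I (\<lambda>_. borel)) ?u"
  have "(\<integral>\<^sup>+x. h x \<partial>sphere_measure I r) = (\<integral>\<^sup>+x. h x \<partial>restrict_space ?D (euclidean_sphere I r))"
    unfolding sphere_measure_def L2_le ..
  also have "\<dots> = (\<integral>\<^sup>+x. ?h x \<partial>?D)"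
    using sets.Int[OF euclidean_sphere_sets[of I r] sets.top]
    by (subst nn_integral_restrict_space) simp_all
  also have "\<dots> = (\<integral>\<^sup>+x. ?h (?u x) \<partial>?U)"
    using h' u by (intro nn_integral_distr) auto
  also have "\<dots> = (\<integral>\<^sup>+x. ?h (?u x) * indicator ?B x \<partial>leb I) / emeasure (leb I) ?B"
    by (intro nn_integral_uniform_measure hu B)
  also have "\<dots> = ennreal (1 / unit_ball_vol (real (card I))) * (\<integral>\<^sup>+x. ?h (?u x) * indicator ?B x \<partial>leb I)"
    unfolding emeasure_leb_ball[OF I]
    by (simp add: divide_ennreal_def inverse_ennreal mult.commute inverse_eq_divide)
  also have "(\<integral>\<^sup>+x. ?h (?u x) * indicator ?B x \<partial>leb I) = (\<integral>\<^sup>+x. indicator {x. sqn I x \<le> 1} x * ?h (?u x) \<partial>leb I)"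
    by (intro nn_integral_cong) (auto simp: indicator_def)
  finally show ?thesis unfolding u_eq .
qed

text \<open>Only the origin, a null set, can be projected off the sphere; so the restriction in
  \<open>sphere_measure\<close> removes no mass.\<close>

lemma AE_leb_in_sphere:
  assumes "finite I" "I \<noteq> {}" "r \<ge> 0"
  shows "AE x in leb I. (\<lambda>i\<in>I. r * udir I x i) \<in> euclidean_sphere I r"
  using AE_leb_sqn_pos[OF assms(1,2)]
proof eventually_elim
  case (elim x)
  have "sqn I (udir I x) = (\<Sum>i\<in>I. (x i)\<^sup>2) / sqn I x"
    using elim unfolding sqn_def[of I "udir I x"] by (simp add: udir_def power_divide sum_divide_distrib)
  then have "sqn I (udir I x) = 1" using elim by (simp add: sqn_def)
  then show ?case
    using assms(3) by (simp add: euclidean_sphere_def L2_set_eq_sqrt_sqn sqn_scale space_PiM)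
qed

lemma nn_integral_sphere_measure:
  assumes "finite I" "I \<noteq> {}" "r \<ge> 0" "h \<in> borel_measurable (leb I)"
  shows "(\<integral>\<^sup>+x. h x \<partial>sphere_measure I r) = ennreal (1 / unit_ball_vol (real (card I))) *
    (\<integral>\<^sup>+x. indicator {x. sqn I x \<le> 1} x * h (\<lambda>i\<in>I. r * udir I x i) \<partial>leb I)"
  unfolding nn_integral_sphere_measure_restricted[OF assms(1) measurable_sphere_measureI[OF assms(4)]]
  using AE_leb_in_sphere[OF assms(1-3)]
  by (intro arg_cong[where f="\<lambda>z. _ * z"] nn_integral_cong_AE) auto

lemma emeasure_space_sphere_measure:
  assumes "finite I" "I \<noteq> {}" "r \<ge> 0"
  shows "emeasure (sphere_measure I r) (space (sphere_measure I r)) = 1"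
proof -
  have "emeasure (sphere_measure I r) (space (sphere_measure I r)) = (\<integral>\<^sup>+x. 1 \<partial>sphere_measure I r)"
    by simp
  also have "\<dots> = ennreal (1 / unit_ball_vol (real (card I))) * (\<integral>\<^sup>+x. indicator {x. sqn I x \<le> 1} x \<partial>leb I)"
    using nn_integral_sphere_measure[OF assms, of "\<lambda>_. 1"] by simp
  also have "(\<integral>\<^sup>+x. indicator {x. sqn I x \<le> 1} x \<partial>leb I) = (\<integral>\<^sup>+x. indicator {x \<in> space (leb I). sqn I x \<le> 1} x \<partial>leb I)"
    by (intro nn_integral_cong) (auto simp: indicator_def)
  also have "\<dots> = ennreal (unit_ball_vol (real (card I)))"
    using emeasure_leb_ball[OF assms(1)] by simp
  finally show ?thesis
    using unit_ball_vol_pos[of "real (card I)", OF of_nat_0_le_iff] by (subst (asm) ennreal_mult[symmetric]) (auto simp: less_imp_neq[symmetric])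
qed

text \<open>The unit case rescaled, with the inner integral written over the fibre sphere. Two
  instances matter: card K = 1 gives the law of one coordinate, and card J = 2 makes the exponent
  m/2 - 1 vanish, which is Archimedes' theorem.\<close>

lemma nn_integral_sphere_measure_split:
  assumes fin: "finite K" "finite J" "J \<noteq> {}" "K \<inter> J = {}" and r: "r > 0"
    and h: "h \<in> borel_measurable (leb (K \<union> J))"
  defines "m \<equiv> real (card J)" and "n \<equiv> real (card (K \<union> J))"
  shows "(\<integral>\<^sup>+x. h x \<partial>sphere_measure (K \<union> J) r) =
    ennreal (m * unit_ball_vol m / (n * unit_ball_vol n * r ^ card K)) *
    (\<integral>\<^sup>+w. ennreal ((1 - sqn K w / r\<^sup>2) powr (m / 2 - 1)) * indicator {w. sqn K w < r\<^sup>2} w *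
      (\<integral>\<^sup>+y. h (glue K J 1 w y) \<partial>sphere_measure J (sqrt (r\<^sup>2 - sqn K w))) \<partial>leb K)"
proof -
  let ?c = "\<lambda>w. ennreal ((1 - sqn K w / r\<^sup>2) powr (m / 2 - 1)) * indicator {w. sqn K w < r\<^sup>2} w"
  let ?S = "\<lambda>w. \<integral>\<^sup>+y. h (glue K J 1 w y) \<partial>sphere_measure J (sqrt (r\<^sup>2 - sqn K w))"
  let ?B = "\<lambda>w. \<integral>\<^sup>+y. indicator {y. sqn J y \<le> 1} y * h (glue K J (sqrt (r\<^sup>2 - sqn K w)) w (udir J y)) \<partial>leb J"
  interpret J: sigma_finite_measure "leb J" using fin(2) by (rule sigma_finite_leb)
  have m: "m > 0" "n > 0" using fin by (auto simp: m_def n_def card_gt_0_iff)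
  have vol: "unit_ball_vol m > 0" "unit_ball_vol n > 0" using m by auto
  have vol_inv: "ennreal (unit_ball_vol m) * ennreal (1 / unit_ball_vol m) = 1"
    using vol by (subst ennreal_mult[symmetric]) auto
  define Q where "Q w = ?c w *
      ?B w" for w
  have hm: "(\<lambda>z. h (glue K J (g z) (f z) (e z))) \<in> borel_measurable N"
    if "\<And>i. i \<in> K \<Longrightarrow> (\<lambda>z. f z i) \<in> borel_measurable N" "g \<in> borel_measurable N" "e \<in> measurable N (leb J)"
    for f g e and N :: "'z measure"
    using measurable_compose[OF measurable_glue[OF that] h] .
  have Q: "Q \<in> borel_measurable (leb K)"
  proof -
    have [measurable]: "(\<lambda>p. h (glue K J (sqrt (r\<^sup>2 - sqn K (fst p))) (fst p) (udir J (snd p)))) \<in> borel_measurable (leb K \<Otimes>\<^sub>M leb J)"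
      by (rule hm) measurable
    have "(\<lambda>p. indicator {y. sqn J y \<le> 1} (snd p) * h (glue K J (sqrt (r\<^sup>2 - sqn K (fst p))) (fst p) (udir J (snd p)))) \<in> borel_measurable (leb K \<Otimes>\<^sub>M leb J)"
      unfolding indicator_def by measurable
    then have "(\<lambda>w. \<integral>\<^sup>+y. indicator {y. sqn J y \<le> 1} y * h (glue K J (sqrt (r\<^sup>2 - sqn K w)) w (udir J y)) \<partial>leb J) \<in> borel_measurable (leb K)"
      by (intro J.borel_measurable_nn_integral) (simp add: split_beta')
    moreover have "(\<lambda>w. ?c w) \<in> borel_measurable (leb K)"
      unfolding indicator_def by measurable
    ultimately show ?thesis unfolding Q_def by (rule borel_measurable_times_ennreal[rotated])
  qed
  define h' where "h' x = h (\<lambda>i\<in>K \<union> J. r * x i)" for x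
  have h': "h' \<in> borel_measurable (leb (K \<union> J))"
    unfolding h'_def by (rule measurable_compose[OF _ h]) measurable
  have "(\<integral>\<^sup>+x. h x \<partial>sphere_measure (K \<union> J) r) = ennreal (1 / unit_ball_vol n) *
      (\<integral>\<^sup>+x. indicator {x. sqn (K \<union> J) x \<le> 1} x * h' (udir (K \<union> J) x) \<partial>leb (K \<union> J))"
    unfolding n_def h'_def using fin r h by (intro nn_integral_sphere_measure) auto
  also have "\<dots> = ennreal (1 / unit_ball_vol n) * (ennreal (m / n) *
      (\<integral>\<^sup>+w. ennreal ((1 - sqn K w) powr (m / 2 - 1)) * indicator {w. sqn K w < 1} w *
      (\<integral>\<^sup>+y. indicator {y. sqn J y \<le> 1} y * h' (glue K J (sqrt (1 - sqn K w)) w (udir J y)) \<partial>leb J) \<partial>leb K))"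
    unfolding m_def n_def by (subst nn_integral_sphere_split_unit[OF fin h']) simp
  also have "(\<integral>\<^sup>+w. ennreal ((1 - sqn K w) powr (m / 2 - 1)) * indicator {w. sqn K w < 1} w *
      (\<integral>\<^sup>+y. indicator {y. sqn J y \<le> 1} y * h' (glue K J (sqrt (1 - sqn K w)) w (udir J y)) \<partial>leb J) \<partial>leb K) =
      (\<integral>\<^sup>+w. Q (\<lambda>i\<in>K. r * w i) \<partial>leb K)"
  proof (rule nn_integral_cong)
    fix w
    have s: "sqn K (\<lambda>i\<in>K. r * w i) = r\<^sup>2 * sqn K w" by (rule sqn_scale)
    have "r\<^sup>2 - r\<^sup>2 * sqn K w = r\<^sup>2 * (1 - sqn K w)" by (simp add: algebra_simps)
    then have sq: "sqrt (r\<^sup>2 - r\<^sup>2 * sqn K w) = r * sqrt (1 - sqn K w)"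
      using r by (simp add: real_sqrt_mult)
    have gl: "(\<lambda>i\<in>K \<union> J. r * glue K J t w \<theta> i) = glue K J (r * t) (\<lambda>i\<in>K. r * w i) \<theta>" for t \<theta>
      by (auto simp: glue_def fun_eq_iff)
    have ind: "indicator {w. sqn K w < r\<^sup>2} (\<lambda>i\<in>K. r * w i) = (indicator {w. sqn K w < 1} w :: ennreal)"
      using r s by (simp add: indicator_def del: restrict_apply)
    show "ennreal ((1 - sqn K w) powr (m / 2 - 1)) * indicator {w. sqn K w < 1} w *
      (\<integral>\<^sup>+y. indicator {y. sqn J y \<le> 1} y * h' (glue K J (sqrt (1 - sqn K w)) w (udir J y)) \<partial>leb J) = Q (\<lambda>i\<in>K. r * w i)"
      unfolding Q_def ind unfolding s sq h'_def gl using r by simp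
  qed
  also have "(\<integral>\<^sup>+w. Q (\<lambda>i\<in>K. r * w i) \<partial>leb K) = ennreal (1 / r ^ card K) * (\<integral>\<^sup>+w. Q w \<partial>leb K)"
  proof -
    have "ennreal (1 / r ^ card K) * ennreal (r ^ card K) = 1"
      using r by (subst ennreal_mult[symmetric]) auto
    then show ?thesis
      by (subst nn_integral_leb_scale[OF fin(1) r Q]) (simp add: mult.assoc[symmetric] del: restrict_apply)
  qed
  also have "(\<integral>\<^sup>+w. Q w \<partial>leb K) = (\<integral>\<^sup>+w. ennreal (unit_ball_vol m) * (?c w *
      ?S w) \<partial>leb K)"
  proof (rule nn_integral_cong)
    fix w assume w: "w \<in> space (leb K)"
    show "Q w = ennreal (unit_ball_vol m) * (?c w *
      ?S w)"
    proof (cases "sqn K w < r\<^sup>2")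
      case True
      have gl: "glue K J 1 w (\<lambda>i\<in>J. t * \<theta> i) = glue K J t w \<theta>" for t \<theta>
        by (auto simp: glue_def fun_eq_iff)
      have "(\<lambda>y. h (glue K J 1 w y)) \<in> borel_measurable (leb J)"
        by (rule hm) (use w in auto)
      from nn_integral_sphere_measure[OF fin(2,3) _ this, of "sqrt (r\<^sup>2 - sqn K w)"] True
      have "?S w = ennreal (1 / unit_ball_vol m) *
        ?B w"
        by (simp add: gl m_def)
      then have "ennreal (unit_ball_vol m) * ?S w =
        ?B w"
        using vol_inv by (simp add: mult.assoc[symmetric])
      then show ?thesis unfolding Q_def by (simp only: mult.left_commute[of "ennreal (unit_ball_vol m)"])
    qed (simp add: Q_def)
  qed
  also have "\<dots> = ennreal (unit_ball_vol m) * (\<integral>\<^sup>+w. (?c w *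
      ?S w) \<partial>leb K)" (is "_ = _ * (\<integral>\<^sup>+w. ?G w \<partial>leb K)")
  proof (rule nn_integral_cmult)
    have "?G w = ennreal (1 / unit_ball_vol m) * Q w" if w: "w \<in> space (leb K)" for w
    proof (cases "sqn K w < r\<^sup>2")
      case True
      have gl: "glue K J 1 w (\<lambda>i\<in>J. t * \<theta> i) = glue K J t w \<theta>" for t \<theta>
        by (auto simp: glue_def fun_eq_iff)
      have "(\<lambda>y. h (glue K J 1 w y)) \<in> borel_measurable (leb J)"
        by (rule hm) (use w in auto)
      from nn_integral_sphere_measure[OF fin(2,3) _ this, of "sqrt (r\<^sup>2 - sqn K w)"] True
      show ?thesis by (simp add: gl m_def Q_def mult.left_commute)
    qed (simp add: Q_def)
    then show "?G \<in> borel_measurable (leb K)"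
      using Q by (subst measurable_cong[where g="\<lambda>w. ennreal (1 / unit_ball_vol m) * Q w"]) auto
  qed
  also have "ennreal (1 / unit_ball_vol n) * (ennreal (m / n) * (ennreal (1 / r ^ card K) * (ennreal (unit_ball_vol m) * Z))) =
      ennreal (m * unit_ball_vol m / (n * unit_ball_vol n * r ^ card K)) * Z" for Z
  proof -
    have "ennreal (1 / unit_ball_vol n) * (ennreal (m / n) * (ennreal (1 / r ^ card K) * ennreal (unit_ball_vol m))) =
      ennreal (m * unit_ball_vol m / (n * unit_ball_vol n * r ^ card K))"
    proof -
      have "m * unit_ball_vol m / (n * unit_ball_vol n * r ^ card K) =
          1 / unit_ball_vol n * (m / n * (1 / r ^ card K * unit_ball_vol m))" by simp
      then show ?thesis using m vol r by (simp only: ennreal_mult mult_nonneg_nonneg divide_nonneg_nonneg less_imp_le zero_le_power zero_le_one)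
    qed
    then show ?thesis by (simp only: mult.assoc[symmetric])
  qed
  finally show ?thesis .
qed

section \<open>Slicing the sphere by one coordinate\<close>

declare One_nat_def [simp del]

text \<open>n times the volume of the unit n-ball is the area of the unit sphere in R^n, so this is
  a quotient of two areas, divided by the radius sqrt N.\<close>

definition slice_const :: "nat \<Rightarrow> real" where
  "slice_const N = real (N - 1) * unit_ball_vol (real (N - 1)) / (real N * unit_ball_vol (real N) * sqrt (real N))"

text \<open>The g_N of the overview. For N = 2 the exponent is -1/2 and the density is unbounded at
  the end points (arcsine law).\<close>

definition slice_density :: "nat \<Rightarrow> real \<Rightarrow> real" where
  "slice_density N v =
     slice_const N * (1 - v\<^sup>2 / real N) powr ((real N - 3) / 2) * indicator {v. v\<^sup>2 < real N} v"

lemma slice_const_pos: "N \<ge> 2 \<Longrightarrow> slice_const N > 0"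
  by (auto simp: slice_const_def intro!: mult_pos_pos divide_pos_pos)

lemma slice_density_nonneg: "N \<ge> 2 \<Longrightarrow> 0 \<le> slice_density N v"
  using slice_const_pos[of N] by (simp add: slice_density_def)

lemma measurable_slice_density [measurable]: "slice_density N \<in> borel_measurable borel"
  unfolding slice_density_def[abs_def] indicator_def by measurable

text \<open>The average over the slice \<open>x j = v\<close> of the sphere, as an integral over a ball that does not
  depend on \<open>v\<close>, so that measurability in \<open>v\<close> is visible.\<close>

definition slice_avg :: "nat \<Rightarrow> nat \<Rightarrow> ((nat \<Rightarrow> real) \<Rightarrow> ennreal) \<Rightarrow> real \<Rightarrow> ennreal" where
  "slice_avg N j h v = ennreal (1 / unit_ball_vol (real (N - 1))) *
    (\<integral>\<^sup>+y. indicator {y. sqn ({1..N} - {j}) y \<le> 1} y *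
       h (glue {j} ({1..N} - {j}) (sqrt (real N - v\<^sup>2)) (\<lambda>_. v) (udir ({1..N} - {j}) y)) \<partial>leb ({1..N} - {j}))"

context
  fixes N j :: nat
  assumes N: "N \<ge> 2" and j: "j \<in> {1..N}"
begin

private abbreviation "J \<equiv> {1..N} - {j}"

private lemma J: "finite J" "J \<noteq> {}" "card J = N - 1" "{j} \<union> J = {1..N}" "{j} \<inter> J = {}"
proof -
  show "card J = N - 1" using j by simp
  then have "card J > 0" using N by simp
  then show "J \<noteq> {}" by (metis card.empty less_irrefl)
qed (use j in auto)

private lemma measurable_compose_glue:
  assumes h: "h \<in> borel_measurable (leb {1..N})"
    and "f \<in> borel_measurable M" "g \<in> borel_measurable M" "e \<in> measurable M (leb J)"
  shows "(\<lambda>z. h (glue {j} J (g z) (\<lambda>_. f z) (e z))) \<in> borel_measurable M"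
  using measurable_compose[OF measurable_glue[of "{j}" "\<lambda>z _. f z" M g e J], of h] assms J(4) by simp

lemma measurable_slice_avg:
  assumes h: "h \<in> borel_measurable (leb {1..N})"
  shows "slice_avg N j h \<in> borel_measurable borel"
proof -
  interpret J: sigma_finite_measure "leb J" using J(1) by (rule sigma_finite_leb)
  have [measurable]: "(\<lambda>p. h (glue {j} J (sqrt (real N - (fst p)\<^sup>2)) (\<lambda>_. fst p) (udir J (snd p)))) \<in> borel_measurable (borel \<Otimes>\<^sub>M leb J)"
    by (rule measurable_compose_glue[OF h]) measurable
  have "(\<lambda>p. indicator {y. sqn J y \<le> 1} (snd p) * h (glue {j} J (sqrt (real N - (fst p)\<^sup>2)) (\<lambda>_. fst p) (udir J (snd p)))) \<in> borel_measurable (borel \<Otimes>\<^sub>M leb J)"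
    unfolding indicator_def by measurable
  then have "(\<lambda>v. \<integral>\<^sup>+y. indicator {y. sqn J y \<le> 1} y * h (glue {j} J (sqrt (real N - v\<^sup>2)) (\<lambda>_. v) (udir J y)) \<partial>leb J) \<in> borel_measurable borel"
    by (intro J.borel_measurable_nn_integral) (simp add: split_beta')
  then show ?thesis unfolding slice_avg_def[abs_def] by measurable
qed

text \<open>The end points v^2 = N are included: the fibre is then the sphere of radius 0, which
  still carries mass 1. Marginals on the sphere are evaluated at the poles as well.\<close>

lemma nn_integral_sphere_slice:
  assumes h: "h \<in> borel_measurable (leb {1..N})" and v: "v\<^sup>2 \<le> real N"
  shows "(\<integral>\<^sup>+y. h (glue {j} J 1 (\<lambda>_. v) y) \<partial>sphere_measure J (sqrt (real N - v\<^sup>2))) = slice_avg N j h v"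
proof -
  have gl: "glue {j} J 1 w (\<lambda>i\<in>J. t * \<theta> i) = glue {j} J t w \<theta>" for t \<theta> w
    by (auto simp: glue_def fun_eq_iff)
  have "(\<lambda>y. h (glue {j} J 1 (\<lambda>_. v) y)) \<in> borel_measurable (leb J)"
    by (rule measurable_compose_glue[OF h]) auto
  from nn_integral_sphere_measure[OF J(1,2) _ this, of "sqrt (real N - v\<^sup>2)"] v
  show ?thesis by (simp only: gl slice_avg_def J(3) real_sqrt_ge_0_iff diff_ge_0_iff_ge)
qed

lemma nn_integral_kac_slice:
  assumes h: "h \<in> borel_measurable (leb {1..N})"
  shows "(\<integral>\<^sup>+x. h x \<partial>kac_sphere N) = (\<integral>\<^sup>+v. ennreal (slice_density N v) * slice_avg N j h v \<partial>lborel)"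
proof -
  let ?G = "\<lambda>w. ennreal ((1 - sqn {j} w / (sqrt (real N))\<^sup>2) powr (real (card J) / 2 - 1)) * indicator {w. sqn {j} w < (sqrt (real N))\<^sup>2} w * (\<integral>\<^sup>+y. h (glue {j} J 1 w y) \<partial>sphere_measure J (sqrt ((sqrt (real N))\<^sup>2 - sqn {j} w)))"
  define \<phi> where "\<phi> v = ennreal ((1 - v\<^sup>2 / real N) powr ((real N - 3) / 2)) * indicator {v. v\<^sup>2 < real N} v * slice_avg N j h v" for v
  have \<phi>: "\<phi> \<in> borel_measurable borel"
  proof -
    have "(\<lambda>v. ennreal ((1 - v\<^sup>2 / real N) powr ((real N - 3) / 2)) * indicator {v. v\<^sup>2 < real N} v) \<in> borel_measurable borel"
      unfolding indicator_def by measurable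
    then show ?thesis unfolding \<phi>_def[abs_def]
      by (rule borel_measurable_times_ennreal[OF _ measurable_slice_avg[OF h]])
  qed
  have "(\<integral>\<^sup>+x. h x \<partial>kac_sphere N) = (\<integral>\<^sup>+x. h x \<partial>sphere_measure ({j} \<union> J) (sqrt (real N)))"
    by (simp only: J kac_sphere_def)
  also have "\<dots> = ennreal (real (card J) * unit_ball_vol (real (card J)) /
        (real (card ({j} \<union> J)) * unit_ball_vol (real (card ({j} \<union> J))) * sqrt (real N) ^ card {j})) *
      (\<integral>\<^sup>+w. ?G w \<partial>leb {j})"
    using N h J by (intro nn_integral_sphere_measure_split) auto
  also have "real (card J) * unit_ball_vol (real (card J)) /
        (real (card ({j} \<union> J)) * unit_ball_vol (real (card ({j} \<union> J))) * sqrt (real N) ^ card {j}) = slice_const N"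
    unfolding J(3,4) slice_const_def by simp
  also have "(\<integral>\<^sup>+w. ?G w \<partial>leb {j}) =
      (\<integral>\<^sup>+w. \<phi> (w j) \<partial>leb {j})"
  proof (rule nn_integral_cong)
    fix w
    have e: "real (card J) / 2 - 1 = (real N - 3) / 2"
      unfolding J(3) using N by (simp add: of_nat_diff field_simps)
    have gl: "glue {j} J 1 w = glue {j} J 1 (\<lambda>_. w j)"
      by (auto simp: glue_def fun_eq_iff)
    have s: "sqn {j} w = (w j)\<^sup>2" by (simp add: sqn_def)
    show "?G w = \<phi> (w j)"
    proof (cases "(w j)\<^sup>2 < real N")
      case True
      then have "(\<integral>\<^sup>+y. h (glue {j} J 1 w y) \<partial>sphere_measure J (sqrt (real N - (w j)\<^sup>2))) = slice_avg N j h (w j)"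
        unfolding gl by (intro nn_integral_sphere_slice h) auto
      then show ?thesis using True unfolding \<phi>_def e s by (simp add: s)
    qed (simp add: s \<phi>_def)
  qed
  also have "\<dots> = (\<integral>\<^sup>+v. \<phi> v \<partial>lborel)"
    using \<phi> by (intro lebesgue_product.product_nn_integral_singleton) auto
  also have "ennreal (slice_const N) * \<dots> = (\<integral>\<^sup>+v. ennreal (slice_const N) * \<phi> v \<partial>lborel)"
    using \<phi> by (intro nn_integral_cmult[symmetric]) auto
  also have "\<dots> = (\<integral>\<^sup>+v. ennreal (slice_density N v) * slice_avg N j h v \<partial>lborel)"
    using slice_const_pos[OF N]
    by (intro nn_integral_cong) (auto simp: slice_density_def \<phi>_def indicator_def ennreal_mult mult.assoc)
  finally show ?thesis .
qed

text \<open>Throughout the slice the glued point has j-th coordinate \<open>v\<close>, so the factor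
  \<open>c\<close> is constant there.\<close>

lemma slice_avg_mult:
  assumes h: "h \<in> borel_measurable (leb {1..N})"
  shows "slice_avg N j (\<lambda>x. h x * c (x j)) v = slice_avg N j h v * c v"
proof -
  have m: "(\<lambda>y. h (glue {j} J (sqrt (real N - v\<^sup>2)) (\<lambda>_. v) (udir J y))) \<in> borel_measurable (leb J)"
    by (rule measurable_compose_glue[OF h]) auto
  have m: "(\<lambda>y. indicator {y. sqn J y \<le> 1} y * h (glue {j} J (sqrt (real N - v\<^sup>2)) (\<lambda>_. v) (udir J y))) \<in> borel_measurable (leb J)"
  proof (rule borel_measurable_times_ennreal[OF _ m])
    show "(indicator {y. sqn J y \<le> 1} :: _ \<Rightarrow> ennreal) \<in> borel_measurable (leb J)"
      unfolding indicator_def by measurable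
  qed
  let ?g = "\<lambda>y. glue {j} J (sqrt (real N - v\<^sup>2)) (\<lambda>_. v) (udir J y)"
  have "(\<integral>\<^sup>+y. indicator {y. sqn J y \<le> 1} y * (h (?g y) * c (?g y j)) \<partial>leb J) =
      (\<integral>\<^sup>+y. indicator {y. sqn J y \<le> 1} y * h (?g y) * c v \<partial>leb J)"
    by (rule nn_integral_cong) (simp add: glue_def mult.assoc)
  also have "\<dots> = (\<integral>\<^sup>+y. indicator {y. sqn J y \<le> 1} y * h (?g y) \<partial>leb J) * c v"
    by (rule nn_integral_multc[OF m])
  finally have "(\<integral>\<^sup>+y. indicator {y. sqn J y \<le> 1} y * (h (?g y) * c (?g y j)) \<partial>leb J) =
      (\<integral>\<^sup>+y. indicator {y. sqn J y \<le> 1} y * h (?g y) \<partial>leb J) * c v" .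
  then show ?thesis unfolding slice_avg_def by (simp only: mult.assoc)
qed

lemma slice_avg_one: "v\<^sup>2 \<le> real N \<Longrightarrow> slice_avg N j (\<lambda>_. 1) v = 1"
  using nn_integral_sphere_slice[of "\<lambda>_. 1" v, OF borel_measurable_const]
    emeasure_space_sphere_measure[OF J(1,2), of "sqrt (real N - v\<^sup>2)"] by simp

lemma measurable_coordinate_leb: "(\<lambda>x. x j) \<in> borel_measurable (leb {1..N})"
  by (rule measurable_component_singleton[OF j, of "\<lambda>_. lborel", unfolded measurable_lborel1])

lemma measurable_kac_coordinate: "(\<lambda>x. x j) \<in> borel_measurable (kac_sphere N)"
  unfolding kac_sphere_def by (rule measurable_sphere_measureI[OF measurable_coordinate_leb])

lemma nn_integral_kac_coordinate:
  assumes c: "c \<in> borel_measurable borel"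
  shows "(\<integral>\<^sup>+x. c (x j) \<partial>kac_sphere N) = (\<integral>\<^sup>+v. ennreal (slice_density N v) * c v \<partial>lborel)"
proof -
  have "(\<integral>\<^sup>+x. c (x j) \<partial>kac_sphere N) = (\<integral>\<^sup>+x. 1 * c (x j) \<partial>kac_sphere N)"
    by (simp only: mult_1)
  also have "\<dots> = (\<integral>\<^sup>+v. ennreal (slice_density N v) * slice_avg N j (\<lambda>x. 1 * c (x j)) v \<partial>lborel)"
    by (rule nn_integral_kac_slice)
       (simp only: mult_1, rule measurable_compose[OF measurable_coordinate_leb c])
  also have "\<dots> = (\<integral>\<^sup>+v. ennreal (slice_density N v) * (slice_avg N j (\<lambda>_. 1) v * c v) \<partial>lborel)"
    by (simp only: slice_avg_mult[of "\<lambda>_. 1" c, OF borel_measurable_const])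
  also have "\<dots> = (\<integral>\<^sup>+v. ennreal (slice_density N v) * c v \<partial>lborel)"
  proof (rule nn_integral_cong)
    fix v
    show "ennreal (slice_density N v) * (slice_avg N j (\<lambda>_. 1) v * c v) = ennreal (slice_density N v) * c v"
    proof (cases "v\<^sup>2 < real N")
      case True
      then show ?thesis by (simp add: slice_avg_one)
    qed (simp add: slice_density_def)
  qed
  finally show ?thesis .
qed

context
  fixes F :: "(nat \<Rightarrow> real) \<Rightarrow> real"
  assumes F: "prob_density_on (kac_sphere N) F"
begin

text \<open>\<open>F\<close> is measurable on the sphere only. Its extension by 0 is measurable on
  the whole product space, as the slicing formula requires.\<close>

private definition "Fh x = ennreal (F x) * indicator (euclidean_sphere {1..N} (sqrt (real N))) x"

private lemma Fh: "Fh \<in> borel_measurable (leb {1..N})"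
proof -
  have "F \<in> borel_measurable (restrict_space (Pi\<^sub>M {1..N} (\<lambda>_. borel)) (euclidean_sphere {1..N} (sqrt (real N))))"
    using F unfolding prob_density_on_def kac_sphere_def by (simp add: measurable_cong_sets[OF sets_sphere_measure refl])
  then have "(\<lambda>x. ennreal (F x)) \<in> borel_measurable (restrict_space (Pi\<^sub>M {1..N} (\<lambda>_. borel)) (euclidean_sphere {1..N} (sqrt (real N))))"
    by simp
  then have "Fh \<in> borel_measurable (Pi\<^sub>M {1..N} (\<lambda>_. borel))"
    using euclidean_sphere_sets[of "{1..N}" "sqrt (real N)"]
    by (subst (asm) borel_measurable_restrict_space_iff_ennreal) (auto simp: Fh_def[abs_def])
  then show ?thesis unfolding measurable_leb_eq .
qed

private lemma nn_integral_F:
  assumes c: "c \<in> borel_measurable borel"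
  shows "(\<integral>\<^sup>+x. ennreal (F x) * c (x j) \<partial>kac_sphere N) =
    (\<integral>\<^sup>+v. ennreal (slice_density N v) * slice_avg N j Fh v * c v \<partial>lborel)"
proof -
  note [measurable] = measurable_coordinate_leb
  have m: "(\<lambda>x. Fh x * c (x j)) \<in> borel_measurable (leb {1..N})"
    using c Fh by measurable
  have "(\<integral>\<^sup>+x. ennreal (F x) * c (x j) \<partial>kac_sphere N) = (\<integral>\<^sup>+x. Fh x * c (x j) \<partial>kac_sphere N)"
    unfolding kac_sphere_def by (intro nn_integral_cong) (auto simp: Fh_def space_sphere_measure)
  then show ?thesis
    unfolding nn_integral_kac_slice[OF m] by (simp add: slice_avg_mult[OF Fh] mult.assoc)
qed

text \<open>The right side is a density of the law of v_j, so uniqueness of the Radon-Nikodym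
  derivative applies. Its total mass 1 makes it finite almost everywhere, hence the
  \<open>enn2real\<close> inside \<open>line_marginal\<close> loses nothing.\<close>

private lemma AE_line_marginal:
  "AE v in lborel. ennreal (line_marginal N j F v) = ennreal (slice_density N v) * slice_avg N j Fh v"
proof -
  let ?g = "\<lambda>v. ennreal (slice_density N v) * slice_avg N j Fh v"
  have g [measurable]: "?g \<in> borel_measurable borel"
    using measurable_slice_avg[OF Fh] by measurable
  have [measurable]: "F \<in> borel_measurable (kac_sphere N)" using F by (simp add: prob_density_on_def)
  note [measurable] = measurable_kac_coordinate
  let ?L = "distr (density (kac_sphere N) (\<lambda>x. ennreal (F x))) borel (\<lambda>x. x j)"
  have "density lborel ?g = ?L"
  proof (rule measure_eqI)
    fix A assume "A \<in> sets (density lborel ?g)"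
    then have A [measurable]: "A \<in> sets borel" by simp
    have "emeasure ?L A = (\<integral>\<^sup>+x. indicator A x \<partial>?L)" by simp
    also have "\<dots> = (\<integral>\<^sup>+x. indicator A (x j) \<partial>density (kac_sphere N) (\<lambda>x. ennreal (F x)))"
      by (rule nn_integral_distr) auto
    also have "\<dots> = (\<integral>\<^sup>+x. ennreal (F x) * indicator A (x j) \<partial>kac_sphere N)"
      by (rule nn_integral_density) auto
    also have "\<dots> = (\<integral>\<^sup>+v. ?g v * indicator A v \<partial>lborel)"
      by (rule nn_integral_F) auto
    also have "\<dots> = emeasure (density lborel ?g) A"
      by (rule emeasure_density[symmetric]) auto
    finally show "emeasure (density lborel ?g) A = emeasure ?L A" by simp
  qed simp
  then have eq: "AE v in lborel. ?g v = RN_deriv lborel ?L v"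
    by (intro sigma_finite_measure.RN_deriv_unique lborel.sigma_finite_measure_axioms) auto
  have "(\<integral>\<^sup>+v. ?g v \<partial>lborel) = 1"
    using nn_integral_F[of "\<lambda>_. 1"] F by (simp add: prob_density_on_def)
  then have "AE v in lborel. ?g v \<noteq> \<infinity>"
    by (intro nn_integral_PInf_AE) auto
  with eq show ?thesis
    by eventually_elim (auto simp: line_marginal_def less_top)
qed

lemma nn_integral_line_marginal:
  assumes c: "c \<in> borel_measurable borel"
  shows "(\<integral>\<^sup>+x. ennreal (F x) * c (x j) \<partial>kac_sphere N) = (\<integral>\<^sup>+v. ennreal (line_marginal N j F v) * c v \<partial>lborel)"
  unfolding nn_integral_F[OF c] using AE_line_marginal by (intro nn_integral_cong_AE) auto

text \<open>The relation f_j = F_j g_N. \<open>Fm\<close> is a version of the slice average that is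
  measurable on the whole line. Where the average is infinite, \<open>enn2real\<close> and the
  Bochner integral both return 0, so the agreement with \<open>sphere_marginal\<close> is
  pointwise.\<close>

lemma sphere_marginal_eq_line_marginal:
  obtains Fm where "Fm \<in> borel_measurable borel" "\<And>v. 0 \<le> Fm v"
    "\<And>v. v\<^sup>2 \<le> real N \<Longrightarrow> sphere_marginal N j F v = Fm v"
    "AE v in lborel. line_marginal N j F v = Fm v * slice_density N v"
proof
  let ?Fm = "\<lambda>v. enn2real (slice_avg N j Fh v)"
  show "?Fm \<in> borel_measurable borel" using measurable_slice_avg[OF Fh] by measurable
  show "AE v in lborel. line_marginal N j F v = ?Fm v * slice_density N v"
    using AE_line_marginal
  proof eventually_elim
    case (elim v)
    then have "enn2real (ennreal (line_marginal N j F v)) = enn2real (ennreal (slice_density N v) * slice_avg N j Fh v)"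
      by simp
    then show ?case
      using slice_density_nonneg[OF N, of v] by (simp add: enn2real_mult mult.commute line_marginal_def)
  qed
  show "sphere_marginal N j F v = ?Fm v" if v: "v\<^sup>2 \<le> real N" for v
  proof -
    let ?S = "sphere_measure J (sqrt (real N - v\<^sup>2))"
    have gl: "w(j := v) = glue {j} J 1 (\<lambda>_. v) w" if "w \<in> space ?S" for w
      using that J(4) unfolding space_sphere_measure euclidean_sphere_def
      by (auto simp: glue_def space_PiM PiE_iff extensional_def fun_eq_iff)
    have in_sphere: "w(j := v) \<in> euclidean_sphere {1..N} (sqrt (real N))" if "w \<in> space ?S" for w
    proof -
      have "sqn J w = real N - v\<^sup>2"
        using that v unfolding space_sphere_measure euclidean_sphere_def L2_set_eq_sqrt_sqn by simp
      moreover have "sqn {1..N} (w(j := v)) = v\<^sup>2 + sqn J w"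
        unfolding sqn_def sum.remove[OF finite_atLeastAtMost j] by (auto intro!: sum.cong)
      moreover have "w(j := v) \<in> space (Pi\<^sub>M {1..N} (\<lambda>_. borel))"
        using that J(4) unfolding space_sphere_measure euclidean_sphere_def space_PiM
        by (auto simp: PiE_iff extensional_def)
      ultimately show ?thesis by (simp add: euclidean_sphere_def L2_set_eq_sqrt_sqn)
    qed
    have Fh_eq: "Fh (glue {j} J 1 (\<lambda>_. v) w) = ennreal (F (w(j := v)))" if "w \<in> space ?S" for w
      using in_sphere[OF that] gl[OF that] by (simp add: Fh_def)
    have nonneg: "0 \<le> F (w(j := v))" if "w \<in> space ?S" for w
      using F in_sphere[OF that] by (simp add: prob_density_on_def kac_sphere_def space_sphere_measure)
    have "(\<lambda>w. Fh (glue {j} J 1 (\<lambda>_. v) w)) \<in> borel_measurable ?S"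
      by (intro measurable_sphere_measureI measurable_compose_glue[OF Fh]) auto
    then have "(\<lambda>w. enn2real (Fh (glue {j} J 1 (\<lambda>_. v) w))) \<in> borel_measurable ?S"
      by simp
    then have m: "(\<lambda>w. F (w(j := v))) \<in> borel_measurable ?S"
      by (rule measurable_cong[THEN iffD1, rotated]) (simp add: Fh_eq nonneg)
    have "sphere_marginal N j F v = enn2real (\<integral>\<^sup>+w. ennreal (F (w(j := v))) \<partial>?S)"
      unfolding sphere_marginal_def by (rule integral_eq_nn_integral[OF m]) (auto simp: nonneg)
    also have "(\<integral>\<^sup>+w. ennreal (F (w(j := v))) \<partial>?S) = (\<integral>\<^sup>+w. Fh (glue {j} J 1 (\<lambda>_. v) w) \<partial>?S)"
      by (intro nn_integral_cong) (simp add: Fh_eq)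
    also have "\<dots> = slice_avg N j Fh v" by (rule nn_integral_sphere_slice[OF Fh v])
    finally show ?thesis .
  qed
qed simp

end

end

text \<open>The constant is the inverse volume of the ball of radius sqrt N in R^(N - 2), because
  the area of the unit sphere in R^N is 2 pi times the volume of the unit ball in R^(N - 2).
  Enlarging that ball to the whole space makes the remaining integral a product of one-dimensional
  ones.\<close>

lemma nn_integral_kac_prod_le:
  assumes N: "N \<ge> 2"
    and \<phi>: "\<And>i. i \<in> {1..N} \<Longrightarrow> \<phi> i \<in> borel_measurable borel"
      "\<And>i. i \<in> {1..N} \<Longrightarrow> (\<integral>\<^sup>+v. \<phi> i v \<partial>lborel) \<le> 1"
    and M: "\<And>v. \<phi> 1 v \<le> M1" "\<And>v. \<phi> 2 v \<le> M2"
  shows "(\<integral>\<^sup>+x. (\<Prod>i\<in>{1..N}. \<phi> i (x i)) \<partial>kac_sphere N) \<le>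
    ennreal (2 * unit_ball_vol 2 / (real N * unit_ball_vol (real N) * sqrt (real N) ^ (N - 2))) * (M1 * M2)"
proof -
  define K J where "K = {3..N}" and "J = {1, 2::nat}"
  have KJ: "K \<union> J = {1..N}" "K \<inter> J = {}" and fin: "finite K" "finite J" "J \<noteq> {}"
    unfolding K_def J_def using N by auto
  have KN: "i \<in> {1..N}" if "i \<in> K" for i using that KJ by blast
  have card: "card J = 2" "card K = N - 2" "card (K \<union> J) = N" unfolding KJ by (auto simp: K_def J_def)
  define h where "h x = (\<Prod>i\<in>K. \<phi> i (x i)) * (\<Prod>i\<in>J. \<phi> i (x i))" for x
  have h_eq: "(\<Prod>i\<in>{1..N}. \<phi> i (x i)) = h x" for x
    unfolding KJ(1)[symmetric] h_def by (rule prod.union_disjoint) (use KJ fin in auto)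
  have m1: "(\<lambda>x. \<phi> i (x i)) \<in> borel_measurable (leb I)" if "i \<in> I" "I \<subseteq> {1..N}" for i I
  proof (rule measurable_compose[OF _ \<phi>(1)])
    show "(\<lambda>x. x i) \<in> borel_measurable (leb I)"
      using measurable_component_singleton[OF that(1), of "\<lambda>_. lborel"] by (simp only: measurable_lborel1)
  qed (use that in auto)
  have h: "h \<in> borel_measurable (leb (K \<union> J))"
    unfolding h_def[abs_def]
    by (intro borel_measurable_times_ennreal borel_measurable_prod_ennreal m1) (use KJ in auto)
  have mK: "(\<lambda>x. \<Prod>i\<in>K. \<phi> i (x i)) \<in> borel_measurable (leb K)"
    by (intro borel_measurable_prod_ennreal m1) (use KJ in auto)
  \<comment> \<open>The exponent is 0, so only the indicator of the ball is left of the
    weight.\<close>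
  let ?G = "\<lambda>w. ennreal ((1 - sqn K w / (sqrt (real N))\<^sup>2) powr (real 2 / 2 - 1)) * indicator {w. sqn K w < (sqrt (real N))\<^sup>2} w * (\<integral>\<^sup>+y. h (glue K J 1 w y) \<partial>sphere_measure J (sqrt ((sqrt (real N))\<^sup>2 - sqn K w)))"
  have "(\<integral>\<^sup>+x. (\<Prod>i\<in>{1..N}. \<phi> i (x i)) \<partial>kac_sphere N) = (\<integral>\<^sup>+x. h x \<partial>sphere_measure (K \<union> J) (sqrt (real N)))"
    by (simp only: KJ kac_sphere_def h_eq)
  also have "\<dots> = ennreal (real (card J) * unit_ball_vol (real (card J)) /
        (real (card (K \<union> J)) * unit_ball_vol (real (card (K \<union> J))) * sqrt (real N) ^ card K)) *
      (\<integral>\<^sup>+w. ennreal ((1 - sqn K w / (sqrt (real N))\<^sup>2) powr (real (card J) / 2 - 1)) * indicator {w. sqn K w < (sqrt (real N))\<^sup>2} w *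
      (\<integral>\<^sup>+y. h (glue K J 1 w y) \<partial>sphere_measure J (sqrt ((sqrt (real N))\<^sup>2 - sqn K w))) \<partial>leb K)"
    using N by (intro nn_integral_sphere_measure_split fin KJ(2) h) auto
  also have "\<dots> \<le> ennreal (2 * unit_ball_vol 2 / (real N * unit_ball_vol (real N) * sqrt (real N) ^ (N - 2))) *
      (\<integral>\<^sup>+w. (M1 * M2) * (\<Prod>i\<in>K. \<phi> i (w i)) \<partial>leb K)"
    unfolding card
  proof (rule mult_mono)
    show "(\<integral>\<^sup>+w. ?G w \<partial>leb K) \<le>
      (\<integral>\<^sup>+w. (M1 * M2) * (\<Prod>i\<in>K. \<phi> i (w i)) \<partial>leb K)"
    proof (rule nn_integral_mono)
      fix w
      show "?G w \<le> (M1 * M2) * (\<Prod>i\<in>K. \<phi> i (w i))"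
      proof (cases "sqn K w < real N")
        case True
        let ?S = "sphere_measure J (sqrt (real N - sqn K w))"
        have "h (glue K J 1 w y) \<le> (M1 * M2) * (\<Prod>i\<in>K. \<phi> i (w i))" for y
        proof -
          have "(\<Prod>i\<in>K. \<phi> i (glue K J 1 w y i)) = (\<Prod>i\<in>K. \<phi> i (w i))"
            by (intro prod.cong) (auto simp: glue_def)
          moreover have "(\<Prod>i\<in>J. \<phi> i (glue K J 1 w y i)) = \<phi> 1 (glue K J 1 w y 1) * \<phi> 2 (glue K J 1 w y 2)"
            unfolding J_def by simp
          moreover have "\<phi> 1 (glue K J 1 w y 1) * \<phi> 2 (glue K J 1 w y 2) \<le> M1 * M2"
            by (rule mult_mono) (use M in auto)
          ultimately show ?thesis
            unfolding h_def by (metis mult.commute mult_left_mono zero_le)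
        qed
        then have "(\<integral>\<^sup>+y. h (glue K J 1 w y) \<partial>?S) \<le> (\<integral>\<^sup>+y. (M1 * M2) * (\<Prod>i\<in>K. \<phi> i (w i)) \<partial>?S)"
          by (intro nn_integral_mono) simp
        also have "\<dots> = (M1 * M2) * (\<Prod>i\<in>K. \<phi> i (w i))"
          using emeasure_space_sphere_measure[OF fin(2,3), of "sqrt (real N - sqn K w)"] True by simp
        finally show ?thesis using True by simp
      qed simp
    qed
  qed auto
  also have "(\<integral>\<^sup>+w. (M1 * M2) * (\<Prod>i\<in>K. \<phi> i (w i)) \<partial>leb K) = (M1 * M2) * (\<integral>\<^sup>+w. (\<Prod>i\<in>K. \<phi> i (w i)) \<partial>leb K)"
    by (rule nn_integral_cmult[OF mK])
  also have "(\<integral>\<^sup>+w. (\<Prod>i\<in>K. \<phi> i (w i)) \<partial>leb K) = (\<Prod>i\<in>K. \<integral>\<^sup>+v. \<phi> i v \<partial>lborel)"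
    by (rule lebesgue_product.product_nn_integral_prod[OF fin(1)]) (simp add: \<phi>(1)[OF KN])
  also have "(M1 * M2) * \<dots> \<le> (M1 * M2) * 1"
  proof (rule mult_left_mono)
    show "(\<Prod>i\<in>K. \<integral>\<^sup>+v. \<phi> i v \<partial>lborel) \<le> 1"
      by (rule prod_le_1) (simp add: \<phi>(2)[OF KN])
  qed simp
  finally show ?thesis by (simp add: mult_left_mono)
qed

section \<open>Normalising constants\<close>

lemma ln_quotient_ge:
  fixes x :: real
  assumes "x > 0"
  shows "1 / (x + 1) \<le> ln (x + 1) - ln x"
proof -
  have "ln (x / (x + 1)) \<le> x / (x + 1) - 1" using assms by (intro ln_le_minus_one) simp
  moreover have "ln (x / (x + 1)) = ln x - ln (x + 1)" using assms by (simp add: ln_div)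
  moreover have "x / (x + 1) - 1 = - (1 / (x + 1))" using assms by (simp add: field_simps)
  ultimately show ?thesis by linarith
qed

lemma Gamma_real_nonzero: "x > 0 \<Longrightarrow> Gamma x \<noteq> 0" for x :: real
  using Gamma_real_pos[of x] by linarith

text \<open>A crude Stirling bound: the polynomial factor is too large, but only its logarithm will
  count. The induction follows Gamma(x + 1) = x Gamma(x), that is, it advances n by 2 and starts
  from n = 1 and n = 2; the constant 10 covers both.\<close>

lemma Gamma_half_le:
  assumes "n \<ge> 1"
  shows "Gamma (real n / 2) \<le> 10 * (real n / 2) * exp (real n / 2 * ln (real n / 2) - real n / 2)"
  using assms
proof (induction n rule: less_induct)
  case (less n)
  consider "n = 1" | "n = 2" | "n \<ge> 3" using less.prems by linarith
  then show ?case
  proof cases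
    case 1
    have e: "exp (1 / 2 * ln (1 / 2) - 1 / 2) = sqrt (1 / (2 * exp 1))"
    proof (rule real_sqrt_unique[symmetric])
      have "(exp (1 / 2 * ln (1 / 2) - 1 / 2))\<^sup>2 = exp (ln (1 / 2) - 1 :: real)"
        by (simp add: power2_eq_square exp_add[symmetric])
      also have "\<dots> = 1 / (2 * exp 1)" by (simp add: exp_diff)
      finally show "(exp (1 / 2 * ln (1 / 2) - 1 / 2))\<^sup>2 = 1 / (2 * exp (1::real))" .
    qed simp
    have "pi * (2 * exp 1) \<le> 4 * (2 * (3::real))"
      using pi_less_4 exp_le by (intro mult_mono) auto
    then have "pi \<le> 25 * (1 / (2 * exp 1))" by (simp add: pos_le_divide_eq)
    then have "sqrt pi \<le> sqrt (25 * (1 / (2 * exp 1)))" by (rule real_sqrt_le_mono)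
    also have "\<dots> = 5 * sqrt (1 / (2 * exp 1))" by (subst real_sqrt_mult) simp
    finally show ?thesis using 1 e by (simp add: Gamma_one_half_real)
  next
    case 2
    have "exp 1 \<le> (10::real)" using exp_le by simp
    then have "1 \<le> 10 * exp (- 1 :: real)" by (simp add: exp_minus field_simps)
    then show ?thesis using 2 by simp
  next
    case 3
    define x where "x = real n / 2 - 1"
    have x: "x > 0" "real n / 2 = x + 1" using 3 by (auto simp: x_def)
    have n2: "real (n - 2) / 2 = x" using 3 by (simp add: x_def of_nat_diff field_simps)
    have IH: "Gamma x \<le> 10 * x * exp (x * ln x - x)"
      using less.IH[of "n - 2"] 3 unfolding n2 by simp
    have "Gamma (x + 1) = x * Gamma x" using x by (simp add: Gamma_plus1 nonpos_Ints_def)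
    also have "\<dots> \<le> x * (10 * x * exp (x * ln x - x))"
      using IH x by (intro mult_left_mono) auto
    also have "\<dots> = 10 * exp (2 * ln x + x * ln x - x)"
    proof -
      have "exp (2 * ln x) = x * x" using x by (simp add: exp_double power2_eq_square)
      then show ?thesis by (simp add: exp_add exp_diff)
    qed
    also have "\<dots> \<le> 10 * exp (ln (x + 1) + (x + 1) * ln (x + 1) - (x + 1))"
    proof -
      \<comment> \<open>Comparing exponents, the claim is 1 <= (x + 2) (ln (x + 1) - ln x).\<close>
      have "1 / (x + 1) * (x + 2) \<le> (ln (x + 1) - ln x) * (x + 2)"
        using ln_quotient_ge[OF x(1)] x by (intro mult_right_mono) auto
      moreover have "1 \<le> 1 / (x + 1) * (x + 2)" using x by (simp add: field_simps)
      ultimately have "1 \<le> (ln (x + 1) - ln x) * (x + 2)" by linarith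
      then show ?thesis by (simp add: algebra_simps)
    qed
    also have "\<dots> = 10 * (x + 1) * exp ((x + 1) * ln (x + 1) - (x + 1))"
      using x by (simp add: exp_add exp_diff)
    finally show ?thesis unfolding x(2) .
  qed
qed

text \<open>Log-convexity of Gamma at the midpoint x + 1 of x + 1/2 and x + 3/2.\<close>

lemma Gamma_half_step_ge:
  fixes x :: real
  assumes x: "x > 0"
  shows "x * Gamma x \<le> Gamma (x + 1 / 2) * sqrt (x + 1 / 2)"
proof -
  have "(ln \<circ> Gamma) ((1 - 1 / 2) *\<^sub>R (x + 1 / 2) + (1 / 2) *\<^sub>R (x + 3 / 2)) \<le>
      (1 - 1 / 2) * (ln \<circ> Gamma) (x + 1 / 2) + 1 / 2 * (ln \<circ> Gamma) (x + 3 / 2 :: real)"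
    using x by (intro convex_onD[OF log_convex_Gamma_real]) auto
  then have "ln (Gamma (x + 1)) \<le> (ln (Gamma (x + 1 / 2)) + ln (Gamma (x + 3 / 2))) / 2"
    by (simp add: algebra_simps)
  also have "Gamma (x + 3 / 2) = (x + 1 / 2) * Gamma (x + 1 / 2)"
    using Gamma_plus1[of "x + 1 / 2"] x by (simp add: nonpos_Ints_def add.commute add.assoc[symmetric])
  also have "ln ((x + 1 / 2) * Gamma (x + 1 / 2)) = ln (x + 1 / 2) + ln (Gamma (x + 1 / 2))"
    using x by (simp add: ln_mult Gamma_real_nonzero)
  finally have "ln (Gamma (x + 1)) \<le> ln (Gamma (x + 1 / 2)) + ln (x + 1 / 2) / 2" by simp
  also have "\<dots> = ln (Gamma (x + 1 / 2) * sqrt (x + 1 / 2))"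
    using x by (simp add: ln_mult ln_sqrt Gamma_real_nonzero)
  finally have "Gamma (x + 1) \<le> Gamma (x + 1 / 2) * sqrt (x + 1 / 2)"
    using x by (subst (asm) ln_le_cancel_iff) (auto simp: Gamma_real_pos)
  then show ?thesis using x by (simp add: Gamma_plus1 nonpos_Ints_def)
qed

lemma unit_ball_vol_eq:
  assumes "n > 0"
  shows "real n * unit_ball_vol (real n) = 2 * pi powr (real n / 2) / Gamma (real n / 2)"
proof -
  have "Gamma (real n / 2 + 1) = real n / 2 * Gamma (real n / 2)"
    using assms by (intro Gamma_plus1) (auto simp: nonpos_Ints_def)
  then show ?thesis unfolding unit_ball_vol_def using assms by (simp only:) simp
qed

lemma slice_const_eq:
  assumes "N \<ge> 2"
  shows "slice_const N = Gamma (real N / 2) / (Gamma ((real N - 1) / 2) * sqrt (pi * real N))"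
proof -
  have e: "real (N - 1) = real N - 1" using assms by simp
  have "pi powr (real N / 2) = pi powr ((real N - 1) / 2) * sqrt pi"
    by (simp add: powr_half_sqrt[symmetric] powr_add[symmetric] field_simps)
  then have "slice_const N = (2 * pi powr ((real N - 1) / 2) / Gamma ((real N - 1) / 2)) /
    (2 * (pi powr ((real N - 1) / 2) * sqrt pi) / Gamma (real N / 2) * sqrt (real N))"
    unfolding slice_const_def using unit_ball_vol_eq[of N] unit_ball_vol_eq[of "N - 1"] assms e by simp
  also have "\<dots> = Gamma (real N / 2) / (Gamma ((real N - 1) / 2) * sqrt (pi * real N))"
    by (simp add: real_sqrt_mult)
  finally show ?thesis .
qed

text \<open>The constant occurs once per coordinate, so its logarithm is needed up to O(1/N).
  \<open>Gamma_half_step_ge\<close> gives the lower bound (N - 1) / (N sqrt (2 pi)) for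
  \<open>slice_const N\<close>; here 1 / sqrt (2 pi) is the peak of the Gaussian density.\<close>

lemma minus_ln_slice_const_le:
  assumes N: "N \<ge> 2"
  shows "- real N * ln (slice_const N) \<le> real N / 2 * ln (2 * pi) + 2"
proof -
  define x where "x = (real N - 1) / 2"
  have x: "x > 0" "x + 1 / 2 = real N / 2" "real N = 2 * x + 1" using N by (auto simp: x_def field_simps)
  have "x / sqrt (real N / 2) \<le> Gamma (real N / 2) / Gamma x"
    using Gamma_half_step_ge[OF x(1)] x N by (simp add: field_simps Gamma_real_pos)
  then have "x / sqrt (real N / 2) / sqrt (pi * real N) \<le> Gamma (real N / 2) / Gamma x / sqrt (pi * real N)"
    using N by (intro divide_right_mono) auto
  also have "\<dots> = slice_const N" using N by (simp add: slice_const_eq x_def)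
  also have "x / sqrt (real N / 2) / sqrt (pi * real N) = (real N - 1) / (real N * sqrt (2 * pi))"
  proof -
    have "sqrt (real N / 2) * sqrt (pi * real N) = real N * sqrt (2 * pi) / 2"
    proof -
      have "(sqrt (real N / 2) * sqrt (pi * real N))\<^sup>2 = (real N * sqrt (2 * pi) / 2)\<^sup>2"
        by (simp add: power_mult_distrib power_divide) (simp add: power2_eq_square)
      then show ?thesis by (rule power2_eq_imp_eq) auto
    qed
    then show ?thesis by (simp add: x_def divide_divide_eq_left field_simps)
  qed
  finally have "ln ((real N - 1) / (real N * sqrt (2 * pi))) \<le> ln (slice_const N)"
    using N slice_const_pos[OF N] by (subst ln_le_cancel_iff) auto
  moreover have "ln ((real N - 1) / (real N * sqrt (2 * pi))) = ln (real N - 1) - ln (real N) - ln (2 * pi) / 2"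
    using N by (simp add: ln_div ln_mult ln_sqrt)
  moreover have "ln (real N) - ln (real N - 1) \<le> 1 / (real N - 1)"
  proof -
    have "ln (real N / (real N - 1)) \<le> real N / (real N - 1) - 1" using N by (intro ln_le_minus_one) simp
    then show ?thesis using N by (simp add: ln_div field_simps)
  qed
  ultimately have "- ln (slice_const N) \<le> 1 / (real N - 1) + ln (2 * pi) / 2" by linarith
  then have "real N * (- ln (slice_const N)) \<le> real N * (1 / (real N - 1) + ln (2 * pi) / 2)"
    by (intro mult_left_mono) auto
  moreover have "real N * (1 / (real N - 1)) \<le> 2" using N by (simp add: field_simps)
  ultimately show ?thesis by (simp add: algebra_simps)
qed

lemma ln_le_2_sqrt: "x > 0 \<Longrightarrow> ln x \<le> 2 * sqrt x" for x :: real
  using ln_le_minus_one[of "sqrt x"] by (simp add: ln_sqrt)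

text \<open>All terms of order N and N ln N cancel: those with ln pi, ln 2 and ln N pair off, and
  the - N/2 of Stirling's formula meets the linear terms (N - 3)/2 from the slices. The rest is
  logarithmic in N and fits into 20 sqrt N.\<close>

lemma sphere_constants_le:
  assumes N: "N \<ge> 2"
  shows "ln (2 * unit_ball_vol 2 / (real N * unit_ball_vol (real N) * sqrt (real N) ^ (N - 2)))
    - real N * ln (slice_const N) + (real N - 3) / 2 \<le> 20 * sqrt (real N)"
proof -
  have NN: "real N > 0" using N by simp
  have vol: "unit_ball_vol (real N) \<noteq> 0" by (metis less_irrefl of_nat_0_le_iff unit_ball_vol_pos)
  have u2: "2 * unit_ball_vol 2 = 2 * pi" using unit_ball_vol_eq[of 2] by simp
  have "ln (real N * unit_ball_vol (real N)) = ln 2 + real N / 2 * ln pi - ln (Gamma (real N / 2))"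
    using unit_ball_vol_eq[of N] N by (simp add: ln_mult ln_div ln_powr Gamma_real_nonzero)
  moreover have "ln (sqrt (real N) ^ (N - 2)) = (real N / 2 - 1) * ln (real N)"
    using N by (simp add: ln_realpow ln_sqrt of_nat_diff field_simps)
  ultimately have 1: "ln (2 * unit_ball_vol 2 / (real N * unit_ball_vol (real N) * sqrt (real N) ^ (N - 2))) =
      ln pi - real N / 2 * ln pi + ln (Gamma (real N / 2)) - (real N / 2 - 1) * ln (real N)"
    unfolding u2 using N by (subst ln_div) (auto simp: ln_mult ln_mult[of "real N * unit_ball_vol (real N)"] vol)
  have "ln (Gamma (real N / 2)) \<le> ln (10 * (real N / 2) * exp (real N / 2 * ln (real N / 2) - real N / 2))"
    using Gamma_half_le[of N] N by (subst ln_le_cancel_iff) (auto simp: Gamma_real_pos)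
  also have "\<dots> = ln 5 + ln (real N) + (real N / 2 * (ln (real N) - ln 2) - real N / 2)"
    using N ln_mult[of 5 "real N"] by (simp add: ln_mult ln_div)
  finally have 2: "ln (Gamma (real N / 2)) \<le> ln 5 + ln (real N) + (real N / 2 * (ln (real N) - ln 2) - real N / 2)" .
  have 3: "real N / 2 * ln (2 * pi) = real N / 2 * ln 2 + real N / 2 * ln pi"
    by (simp add: ln_mult algebra_simps)
  have "ln (2 * unit_ball_vol 2 / (real N * unit_ball_vol (real N) * sqrt (real N) ^ (N - 2)))
    - real N * ln (slice_const N) + (real N - 3) / 2 \<le> ln pi + ln 5 + 2 * ln (real N) + 1 / 2"
    unfolding 1 using 2 3 minus_ln_slice_const_le[OF N]
    by (simp add: algebra_simps diff_divide_distrib add_divide_distrib)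
  moreover have "ln pi \<le> 4" "ln 5 \<le> (4::real)"
    using ln_le_minus_one[of pi] ln_le_minus_one[of "5::real"] pi_less_4 by auto
  moreover have "ln (real N) \<le> 2 * sqrt (real N)" using NN by (rule ln_le_2_sqrt)
  moreover have "1 \<le> sqrt (real N)" using N by simp
  ultimately show ?thesis by linarith
qed

text \<open>A supremum of reals is meaningful only for a family bounded above, so nonnegativity
  requires an upper bound on the Gamma quotients. It comes from log-convexity between x and x + m
  for an integer m > k/2.\<close>

lemma gamma_const_nonneg:
  assumes k: "k > 0"
  shows "0 \<le> gamma_const k"
proof -
  define r where "r N = (2 / real N) powr (k / 2) * Gamma ((real N + k) / 2) / Gamma (real N / 2)" for N :: nat
  obtain m :: nat where m: "k / 2 < real m" using reals_Archimedean2 by blast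
  have r_le: "r N \<le> (1 + real m) powr (k / 2)" if N: "N \<ge> 2" for N
  proof -
    define x where "x = real N / 2"
    have x: "x \<ge> 1" using N by (simp add: x_def)
    \<comment> \<open>The weight for which x + k/2 is the convex combination of x and x + m.\<close>
    define t where "t = (k / 2) / real m"
    have t: "0 \<le> t" "t \<le> 1" using m k by (auto simp: t_def)
    have m0: "real m > 0" using m k by linarith
    have "(ln \<circ> Gamma) ((1 - t) *\<^sub>R x + t *\<^sub>R (x + real m)) \<le> (1 - t) * (ln \<circ> Gamma) x + t * (ln \<circ> Gamma) (x + real m)"
      using x t by (intro convex_onD[OF log_convex_Gamma_real]) auto
    moreover have "(1 - t) *\<^sub>R x + t *\<^sub>R (x + real m) = x + k / 2"
      using m0 by (simp add: t_def field_simps)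
    moreover have "ln (Gamma (x + real m)) \<le> ln (Gamma x) + real m * ln (x + real m)"
    proof -
      have "pochhammer x m = Gamma (x + real m) / Gamma x"
        using x by (intro pochhammer_Gamma) (auto simp: nonpos_Ints_def)
      then have "Gamma (x + real m) = Gamma x * pochhammer x m"
        using x Gamma_real_nonzero[of x] by simp
      moreover have "pochhammer x m \<le> (x + real m) ^ m"
      proof -
        have "pochhammer x m = (\<Prod>i<m. x + real i)" by (simp add: pochhammer_prod lessThan_atLeast0)
        also have "\<dots> \<le> (\<Prod>i<m. x + real m)" using x by (intro prod_mono) auto
        finally show ?thesis by simp
      qed
      ultimately have "Gamma (x + real m) \<le> Gamma x * (x + real m) ^ m"
        using x Gamma_real_pos[of x] by simp
      then have "ln (Gamma (x + real m)) \<le> ln (Gamma x * (x + real m) ^ m)"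
        using x Gamma_real_pos[of x] Gamma_real_pos[of "x + real m"] by (subst ln_le_cancel_iff) auto
      also have "\<dots> = ln (Gamma x) + real m * ln (x + real m)"
        using x Gamma_real_nonzero[of x] by (simp add: ln_mult ln_realpow)
      finally show ?thesis .
    qed
    ultimately have "ln (Gamma (x + k / 2)) \<le> (1 - t) * ln (Gamma x) + t * (ln (Gamma x) + real m * ln (x + real m))"
      using t(1) by (simp add: mult_left_mono order_trans)
    also have "\<dots> = ln (Gamma x) + k / 2 * ln (x + real m)"
      using m0 by (simp add: t_def algebra_simps)
    also have "\<dots> = ln (Gamma x * (x + real m) powr (k / 2))"
      using x Gamma_real_nonzero[of x] by (simp add: ln_mult ln_powr)
    finally have "Gamma (x + k / 2) \<le> Gamma x * (x + real m) powr (k / 2)"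
      using x k Gamma_real_pos[of x] Gamma_real_pos[of "x + k / 2"] by (subst (asm) ln_le_cancel_iff) auto
    then have "Gamma (x + k / 2) / Gamma x \<le> (x + real m) powr (k / 2)"
      using x Gamma_real_pos[of x] by (simp add: pos_divide_le_eq mult.commute)
    then have "(1 / x) powr (k / 2) * (Gamma (x + k / 2) / Gamma x) \<le> (1 / x) powr (k / 2) * (x + real m) powr (k / 2)"
      by (intro mult_left_mono) auto
    also have "\<dots> = ((x + real m) / x) powr (k / 2)"
      using x by (simp add: powr_mult[symmetric])
    also have "\<dots> \<le> (1 + real m) powr (k / 2)"
    proof (rule powr_mono2)
      have "real m * 1 \<le> real m * x" using x by (intro mult_left_mono) auto
      then show "(x + real m) / x \<le> 1 + real m" using x by (simp add: pos_divide_le_eq algebra_simps)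
    qed (use x k in auto)
    also have "(1 / x) powr (k / 2) * (Gamma (x + k / 2) / Gamma x) = r N"
      by (simp add: r_def x_def add_divide_distrib)
    finally show ?thesis .
  qed
  have "0 \<le> r 2"
    using k Gamma_real_pos[of "(2 + k) / 2"] by (simp add: r_def)
  also have "r 2 \<le> (SUP N\<in>{2..}. r N)"
    using r_le by (intro cSUP_upper bdd_aboveI2) auto
  finally show ?thesis by (simp add: gamma_const_def r_def)
qed

section \<open>The logarithm near its singularity\<close>

lemma minus_ln_le_powr:
  fixes t \<delta> :: real
  assumes "t > 0" "\<delta> > 0"
  shows "- ln t \<le> t powr (- \<delta>) / \<delta>"
proof -
  have "ln (t powr (- \<delta>)) \<le> t powr (- \<delta>) - 1" using assms by (intro ln_le_minus_one) simp
  then have "\<delta> * (- ln t) \<le> t powr (- \<delta>)" using assms by (simp add: ln_powr)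
  then show ?thesis using assms by (simp add: pos_le_divide_eq mult.commute)
qed

text \<open>The logarithmic singularity at \<open>x = 1\<close> is cut off at distance \<open>N^(-8)\<close>.\<close>

lemma minus_ln_minus_le:
  fixes x \<epsilon> :: real and N :: nat
  assumes N: "N \<ge> 2" and \<epsilon>: "0 < \<epsilon>" "\<epsilon> \<le> 1" and x: "0 \<le> x" "x < 1"
  shows "- ln (1 - x) - x \<le> 32 / \<epsilon> * real N powr \<epsilon> * x\<^sup>2 + 8 / \<epsilon> * real N powr (- 3) * (1 - x) powr (- 1 / 2)"
proof -
  let ?a = "32 / \<epsilon> * real N powr \<epsilon>" and ?b = "8 / \<epsilon> * real N powr (- 3)"
  have N1: "real N \<ge> 1" using N by simp
  have ab: "0 \<le> ?a" "0 \<le> ?b" using \<epsilon> by auto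
  have nonneg: "0 \<le> ?a * x\<^sup>2" "0 \<le> ?b * (1 - x) powr (- 1 / 2)"
    using \<epsilon> by (auto intro!: mult_nonneg_nonneg divide_nonneg_nonneg)
  have log: "- ln (1 - x) - x \<le> (1 - x) powr (- (\<epsilon> / 8)) / (\<epsilon> / 8)"
    using minus_ln_le_powr[of "1 - x" "\<epsilon> / 8"] x \<epsilon> by simp
  \<comment> \<open>At the cut-off the power -\<epsilon>/8 of N^(-8) is exactly N^\<epsilon>. Closer
    to 1 the factor (1 - x)^(1/2 - \<epsilon>/8) is split off; it is at most N^(- 4 + \<epsilon>) <=
    N^(- 3). The 32 is 4 times 8, since x^2 >= 1/4 in the middle range.\<close>
  consider "x \<le> 1 / 2" | "x > 1 / 2" "real N powr (- 8) \<le> 1 - x" | "x > 1 / 2" "1 - x < real N powr (- 8)"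
    by linarith
  then show ?thesis
  proof cases
    case 1
    have "- ln (1 - x) - x \<le> 2 * x\<^sup>2"
      using ln_one_minus_pos_lower_bound[of x] x 1 by auto
    also have "\<dots> \<le> ?a * x\<^sup>2"
    proof (rule mult_right_mono)
      have "2 * 1 \<le> 32 / \<epsilon> * real N powr \<epsilon>"
        using N1 \<epsilon> by (intro mult_mono) (auto simp: field_simps ge_one_powr_ge_zero)
      then show "2 \<le> ?a" by simp
    qed simp
    finally show ?thesis using nonneg by linarith
  next
    case 2
    have "(1 - x) powr (- (\<epsilon> / 8)) \<le> (real N powr (- 8)) powr (- (\<epsilon> / 8))"
      using 2 N \<epsilon> by (intro powr_mono2') auto
    also have "\<dots> = real N powr \<epsilon>" by (simp add: powr_powr)
    finally have "(1 - x) powr (- (\<epsilon> / 8)) / (\<epsilon> / 8) \<le> real N powr \<epsilon> / (\<epsilon> / 8)"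
      using \<epsilon> by (intro divide_right_mono) auto
    also have "\<dots> = ?a * (1 / 2)\<^sup>2" by (simp add: power2_eq_square)
    also have "\<dots> \<le> ?a * x\<^sup>2" using 2 ab by (intro mult_left_mono power_mono) auto
    finally show ?thesis using log nonneg by linarith
  next
    case 3
    have "(1 - x) powr (1 / 2 - \<epsilon> / 8) \<le> (real N powr (- 8)) powr (1 / 2 - \<epsilon> / 8)"
      using 3 x \<epsilon> by (intro powr_mono2) auto
    also have "\<dots> = real N powr (- 4 + \<epsilon>)" by (simp add: powr_powr algebra_simps)
    also have "\<dots> \<le> real N powr (- 3)" using N1 \<epsilon> by (intro powr_mono) auto
    finally have "(1 - x) powr (1 / 2 - \<epsilon> / 8) * (1 - x) powr (- 1 / 2) \<le> real N powr (- 3) * (1 - x) powr (- 1 / 2)"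
      by (rule mult_right_mono) simp
    moreover have "(1 - x) powr (- (\<epsilon> / 8)) = (1 - x) powr (1 / 2 - \<epsilon> / 8) * (1 - x) powr (- 1 / 2)"
      by (simp add: powr_add[symmetric])
    ultimately have "(1 - x) powr (- (\<epsilon> / 8)) / (\<epsilon> / 8) \<le> real N powr (- 3) * (1 - x) powr (- 1 / 2) / (\<epsilon> / 8)"
      using \<epsilon> by (intro divide_right_mono) auto
    also have "\<dots> = ?b * (1 - x) powr (- 1 / 2)" by simp
    finally show ?thesis using log nonneg by linarith
  qed
qed

section \<open>Entropy of the marginals\<close>

lemma neg_mult_ln_le_1: "0 \<le> x \<Longrightarrow> - (x * ln x) \<le> 1" for x :: real
proof (cases "x = 0")
  case False
  assume "0 \<le> x"
  with False have "x > 0" by simp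
  then have "ln (1 / x) \<le> 1 / x - 1" by (intro ln_le_minus_one) simp
  then have "x * ln (1 / x) \<le> x * (1 / x - 1)" using \<open>x > 0\<close> by (intro mult_left_mono) auto
  then show ?thesis using \<open>x > 0\<close> by (simp add: ln_div algebra_simps)
qed simp

lemma abs_mult_ln_le:
  fixes x M :: real
  assumes "0 \<le> x" "x \<le> M"
  shows "\<bar>x * ln x\<bar> \<le> 1 + M\<^sup>2"
proof -
  have "x * ln x \<le> M\<^sup>2"
  proof (cases "x = 0")
    case False
    then have "x * ln x \<le> x * x" using assms ln_le_minus_one[of x] by (intro mult_left_mono) auto
    also have "\<dots> \<le> M * M" using assms by (intro mult_mono) auto
    finally show ?thesis by (simp add: power2_eq_square)
  qed simp
  moreover have "0 \<le> M\<^sup>2" by simp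
  ultimately show ?thesis using neg_mult_ln_le_1[OF assms(1)] unfolding abs_le_iff by linarith
qed

lemma entropy_functional_eq_integral:
  assumes "integrable M (\<lambda>x. f x * ln (f x))"
  shows "entropy_functional M f = ereal (\<integral>x. f x * ln (f x) \<partial>M)"
proof -
  have fin: "(\<integral>\<^sup>+x. ennreal (f x * ln (f x)) \<partial>M) \<noteq> \<infinity>"
    "(\<integral>\<^sup>+x. ennreal (- (f x * ln (f x))) \<partial>M) \<noteq> \<infinity>"
    using assms unfolding real_integrable_def by auto
  have "enn2ereal P - enn2ereal Q = ereal (enn2real P - enn2real Q)" if "P \<noteq> \<infinity>" "Q \<noteq> \<infinity>" for P Q
    using that by (cases P rule: ennreal_cases; cases Q rule: ennreal_cases) (auto simp: enn2ereal_ennreal)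
  then show ?thesis
    using fin unfolding entropy_functional_def real_lebesgue_integral_def[OF assms] by simp
qed

text \<open>The negative part of f ln f is at most 1 pointwise, so on a probability space only the
  positive part can have an infinite integral.\<close>

lemma integrable_of_entropy_finite:
  assumes M: "emeasure M (space M) = 1" and f: "f \<in> borel_measurable M" "\<And>x. x \<in> space M \<Longrightarrow> 0 \<le> f x"
    and fin: "entropy_functional M f \<noteq> \<infinity>"
  shows "integrable M (\<lambda>x. f x * ln (f x))"
proof -
  have "(\<integral>\<^sup>+x. ennreal (- (f x * ln (f x))) \<partial>M) \<le> (\<integral>\<^sup>+x. 1 \<partial>M)"
    using neg_mult_ln_le_1[OF f(2)] by (intro nn_integral_mono) (auto simp: ennreal_le_1)
  then have neg: "(\<integral>\<^sup>+x. ennreal (- (f x * ln (f x))) \<partial>M) \<le> 1" using M by simp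
  then obtain q where q: "(\<integral>\<^sup>+x. ennreal (- (f x * ln (f x))) \<partial>M) = ennreal q" "0 \<le> q"
    by (cases "\<integral>\<^sup>+x. ennreal (- (f x * ln (f x))) \<partial>M" rule: ennreal_cases) (auto simp: top_unique)
  have "(\<integral>\<^sup>+x. ennreal (f x * ln (f x)) \<partial>M) \<noteq> \<infinity>"
  proof
    assume "(\<integral>\<^sup>+x. ennreal (f x * ln (f x)) \<partial>M) = \<infinity>"
    then have "entropy_functional M f = \<infinity>"
      using q by (simp add: entropy_functional_def enn2ereal_ennreal)
    then show False using fin by simp
  qed
  then show ?thesis unfolding real_integrable_def using f(1) q by simp
qed

lemma emeasure_kac_sphere: "N \<ge> 1 \<Longrightarrow> emeasure (kac_sphere N) (space (kac_sphere N)) = 1"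
  unfolding kac_sphere_def by (rule emeasure_space_sphere_measure) auto

lemma kac_sphere_sum_squares:
  assumes "x \<in> space (kac_sphere N)"
  shows "(\<Sum>j=1..N. (x j)\<^sup>2) = real N"
  using assms
  by (simp add: kac_sphere_def space_sphere_measure euclidean_sphere_def L2_set_eq_sqrt_sqn sqn_def sum_nonneg)

lemma kac_sphere_coordinate_le:
  assumes "x \<in> space (kac_sphere N)" "j \<in> {1..N}"
  shows "(x j)\<^sup>2 \<le> real N"
  using member_le_sum[of j "{1..N}" "\<lambda>j. (x j)\<^sup>2"] assms kac_sphere_sum_squares[OF assms(1)] by simp

text \<open>No trigonometric substitution: for N = 2 the integrand is the coordinate density on the
  circle up to the factor \<open>slice_const 2\<close>, and total mass 1 gives the value. Scaling by
  sqrt (N/2) yields every N.\<close>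

lemma nn_integral_inverse_sqrt:
  assumes N: "N \<ge> 1"
  shows "(\<integral>\<^sup>+v. ennreal ((1 - v\<^sup>2 / real N) powr (- 1 / 2) * indicator {v. v\<^sup>2 < real N} v) \<partial>lborel) = ennreal (pi * sqrt (real N))"
proof -
  define h where "h n v = ennreal ((1 - v\<^sup>2 / n) powr (- 1 / 2) * indicator {v. v\<^sup>2 < n} v)" for n v :: real
  have h [measurable]: "h n \<in> borel_measurable borel" for n
    unfolding h_def indicator_def by measurable
  have sc: "slice_const 2 = 1 / (pi * sqrt 2)"
    by (simp add: slice_const_def unit_ball_vol_numeral)
  have "(1::ennreal) = (\<integral>\<^sup>+x. 1 \<partial>kac_sphere 2)" by (simp add: emeasure_kac_sphere)
  also have "\<dots> = (\<integral>\<^sup>+v. ennreal (slice_density 2 v) * 1 \<partial>lborel)"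
    by (rule nn_integral_kac_coordinate[of 2 1]) auto
  also have "\<dots> = (\<integral>\<^sup>+v. ennreal (slice_const 2) * h 2 v \<partial>lborel)"
    using slice_const_pos[of 2]
    by (intro nn_integral_cong) (auto simp: slice_density_def h_def ennreal_mult[symmetric] mult.assoc)
  also have "\<dots> = ennreal (slice_const 2) * (\<integral>\<^sup>+v. h 2 v \<partial>lborel)"
    by (intro nn_integral_cmult) auto
  finally have "ennreal (pi * sqrt 2) * 1 = ennreal (pi * sqrt 2) * (ennreal (1 / (pi * sqrt 2)) * (\<integral>\<^sup>+v. h 2 v \<partial>lborel))"
    unfolding sc by simp
  also have "\<dots> = (\<integral>\<^sup>+v. h 2 v \<partial>lborel)"
  proof -
    have "ennreal (pi * sqrt 2) * ennreal (1 / (pi * sqrt 2)) = 1"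
      by (subst ennreal_mult[symmetric]) auto
    then show ?thesis by (simp add: mult.assoc[symmetric])
  qed
  finally have h2: "(\<integral>\<^sup>+v. h 2 v \<partial>lborel) = ennreal (pi * sqrt 2)" by simp
  define c where "c = sqrt (real N / 2)"
  have c: "c > 0" "c\<^sup>2 = real N / 2" using N by (auto simp: c_def)
  have "(\<integral>\<^sup>+v. h (real N) v \<partial>lborel) = \<bar>c\<bar> * (\<integral>\<^sup>+v. h (real N) (0 + c * v) \<partial>lborel)"
    using c by (intro nn_integral_real_affine) auto
  also have "(\<lambda>v. h (real N) (0 + c * v)) = h 2"
    using N by (auto simp: h_def fun_eq_iff power_mult_distrib c indicator_def)
  also have "ennreal \<bar>c\<bar> * integral\<^sup>N lborel (h 2) = ennreal (c * (pi * sqrt 2))"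
    unfolding h2 using c by (simp add: ennreal_mult)
  also have "c * (pi * sqrt 2) = pi * sqrt (real N)"
    by (simp add: c_def real_sqrt_divide)
  finally show ?thesis unfolding h_def .
qed

lemma integrable_inverse_sqrt:
  assumes N: "N \<ge> 1"
  defines "w \<equiv> \<lambda>v. (1 - v\<^sup>2 / real N) powr (- 1 / 2) * indicator {v. v\<^sup>2 < real N} v"
  shows "integrable lborel w" "(\<integral>v. w v \<partial>lborel) = pi * sqrt (real N)"
proof -
  have [measurable]: "w \<in> borel_measurable borel" unfolding w_def indicator_def by measurable
  have w0: "0 \<le> w v" for v by (simp add: w_def)
  have nn: "(\<integral>\<^sup>+v. ennreal (w v) \<partial>lborel) = ennreal (pi * sqrt (real N))"
    unfolding w_def by (rule nn_integral_inverse_sqrt[OF N])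
  show int: "integrable lborel w" using nn w0 by (intro integrableI_nonneg) auto
  show "(\<integral>v. w v \<partial>lborel) = pi * sqrt (real N)"
    using nn w0 by (subst integral_eq_nn_integral) auto
qed

lemma distr_eq_density:
  assumes X: "X \<in> borel_measurable M" and d: "d \<in> borel_measurable borel"
    and eq: "\<And>c. c \<in> borel_measurable borel \<Longrightarrow> (\<integral>\<^sup>+x. c (X x) \<partial>M) = (\<integral>\<^sup>+v. ennreal (d v) * c v \<partial>lborel)"
  shows "distr M borel X = density lborel (\<lambda>v. ennreal (d v))"
proof (rule measure_eqI)
  fix A assume "A \<in> sets (distr M borel X)"
  then have A [measurable]: "A \<in> sets borel" by simp
  have "emeasure (distr M borel X) A = (\<integral>\<^sup>+v. indicator A v \<partial>distr M borel X)" by simp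
  also have "\<dots> = (\<integral>\<^sup>+x. indicator A (X x) \<partial>M)"
    using X by (intro nn_integral_distr) auto
  also have "\<dots> = (\<integral>\<^sup>+v. ennreal (d v) * indicator A v \<partial>lborel)" by (rule eq) auto
  also have "\<dots> = emeasure (density lborel (\<lambda>v. ennreal (d v))) A"
    using d by (intro emeasure_density[symmetric]) auto
  finally show "emeasure (distr M borel X) A = emeasure (density lborel (\<lambda>v. ennreal (d v))) A" .
qed simp

section \<open>A single marginal: expectations, integrability and entropy\<close>

context
  fixes N j :: nat and F :: "(nat \<Rightarrow> real) \<Rightarrow> real" and f :: "real \<Rightarrow> real" and M :: real
  assumes N: "N \<ge> 2" and j: "j \<in> {1..N}" and F: "prob_density_on (kac_sphere N) F"
    and f_meas: "f \<in> borel_measurable borel" and f_eq: "AE v in lborel. line_marginal N j F v = f v"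
    and f_nonneg: "\<And>v. 0 \<le> f v" and f_le: "\<And>v. f v \<le> M" and f_supp: "\<And>v. real N < v\<^sup>2 \<Longrightarrow> f v = 0"
begin

declare f_meas [measurable]

private lemma F_meas [measurable]: "F \<in> borel_measurable (kac_sphere N)"
  using F by (simp add: prob_density_on_def)

private lemma F_nonneg: "x \<in> space (kac_sphere N) \<Longrightarrow> 0 \<le> F x"
  using F by (simp add: prob_density_on_def)

private lemma X_meas [measurable]: "(\<lambda>x. x j) \<in> borel_measurable (kac_sphere N)"
  by (rule measurable_kac_coordinate[OF N j])

private lemma nn_integral_F_coordinate:
  assumes c: "c \<in> borel_measurable borel"
  shows "(\<integral>\<^sup>+x. ennreal (F x) * c (x j) \<partial>kac_sphere N) = (\<integral>\<^sup>+v. ennreal (f v) * c v \<partial>lborel)"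
  unfolding nn_integral_line_marginal[OF N j F c] using f_eq by (intro nn_integral_cong_AE) auto

lemma marginal_mass: "integrable lborel f" "(\<integral>v. f v \<partial>lborel) = 1" "(\<integral>\<^sup>+v. ennreal (f v) \<partial>lborel) = 1"
proof -
  show 1: "(\<integral>\<^sup>+v. ennreal (f v) \<partial>lborel) = 1"
    using nn_integral_F_coordinate[of "\<lambda>_. 1"] F by (simp add: prob_density_on_def)
  show "integrable lborel f" using 1 f_nonneg by (intro integrableI_nonneg) auto
  show "(\<integral>v. f v \<partial>lborel) = 1" using 1 f_nonneg by (subst integral_eq_nn_integral) auto
qed

private lemma distr_density: "distr (density (kac_sphere N) (\<lambda>x. ennreal (F x))) borel (\<lambda>x. x j) = density lborel (\<lambda>v. ennreal (f v))"
proof (rule distr_eq_density)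
  fix c :: "real \<Rightarrow> ennreal" assume c [measurable]: "c \<in> borel_measurable borel"
  have "(\<integral>\<^sup>+x. c (x j) \<partial>density (kac_sphere N) (\<lambda>x. ennreal (F x))) = (\<integral>\<^sup>+x. ennreal (F x) * c (x j) \<partial>kac_sphere N)"
    by (rule nn_integral_density) auto
  then show "(\<integral>\<^sup>+x. c (x j) \<partial>density (kac_sphere N) (\<lambda>x. ennreal (F x))) = (\<integral>\<^sup>+v. ennreal (f v) * c v \<partial>lborel)"
    using nn_integral_F_coordinate[OF c] by simp
qed auto

private lemma distr_kac: "distr (kac_sphere N) borel (\<lambda>x. x j) = density lborel (\<lambda>v. ennreal (slice_density N v))"
  by (rule distr_eq_density) (auto intro: nn_integral_kac_coordinate[OF N j])

lemma coordinate_expectation: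
  fixes c :: "real \<Rightarrow> real"
  assumes c [measurable]: "c \<in> borel_measurable borel" and int: "integrable lborel (\<lambda>v. f v * c v)"
  shows "integrable (kac_sphere N) (\<lambda>x. F x * c (x j))"
    and "(\<integral>x. F x * c (x j) \<partial>kac_sphere N) = (\<integral>v. f v * c v \<partial>lborel)"
proof -
  let ?D = "density (kac_sphere N) (\<lambda>x. ennreal (F x))"
  have Fae: "AE x in kac_sphere N. 0 \<le> F x" using F_nonneg by (intro AE_I2) auto
  have "integrable (density lborel (\<lambda>v. ennreal (f v))) c"
    using int f_nonneg by (subst integrable_real_density) auto
  then have "integrable ?D (\<lambda>x. c (x j))"
    unfolding distr_density[symmetric] by (subst (asm) integrable_distr_eq) auto
  then show "integrable (kac_sphere N) (\<lambda>x. F x * c (x j))"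
    using Fae by (subst (asm) integrable_real_density) auto
  have "(\<integral>x. F x * c (x j) \<partial>kac_sphere N) = (\<integral>x. c (x j) \<partial>?D)"
    using Fae by (subst integral_real_density) auto
  also have "\<dots> = (\<integral>v. c v \<partial>density lborel (\<lambda>v. ennreal (f v)))"
    unfolding distr_density[symmetric] by (subst integral_distr) auto
  also have "\<dots> = (\<integral>v. f v * c v \<partial>lborel)"
    using f_nonneg by (subst integral_real_density) auto
  finally show "(\<integral>x. F x * c (x j) \<partial>kac_sphere N) = (\<integral>v. f v * c v \<partial>lborel)" .
qed

text \<open>Because \<open>ln 0 = 0\<close>, a vanishing marginal at a point of positive density
  would spoil the Gibbs inequality; such points form a null set.\<close>

lemma AE_marginal_pos: "AE x in kac_sphere N. 0 < F x \<longrightarrow> 0 < f (x j)"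
proof -
  have "AE v in density lborel (\<lambda>v. ennreal (f v)). 0 < f v"
    by (subst AE_density) auto
  then have "AE x in density (kac_sphere N) (\<lambda>x. ennreal (F x)). 0 < f (x j)"
    unfolding distr_density[symmetric] by (subst (asm) AE_distr_iff) auto
  then show ?thesis by (subst (asm) AE_density) auto
qed

lemma integrable_compact_bounded:
  fixes c :: "real \<Rightarrow> real"
  assumes c [measurable]: "c \<in> borel_measurable borel"
    and bound: "\<And>v. v\<^sup>2 \<le> real N \<Longrightarrow> \<bar>c v\<bar> \<le> B" and zero: "\<And>v. real N < v\<^sup>2 \<Longrightarrow> c v = 0"
  shows "integrable lborel c"
proof (rule Bochner_Integration.integrable_bound)
  show "integrable lborel (\<lambda>v. indicator {- real N..real N} v *\<^sub>R B)"
    by (rule integrable_scaleR_left) (simp add: integrable_indicator_iff)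
  show "AE v in lborel. norm (c v) \<le> norm (indicator {- real N..real N} v *\<^sub>R B)"
  proof (rule AE_I2)
    fix v :: real
    show "norm (c v) \<le> norm (indicator {- real N..real N} v *\<^sub>R B)"
    proof (cases "v\<^sup>2 \<le> real N")
      case True
      also have "real N \<le> (real N)\<^sup>2" using N by (simp add: power2_eq_square)
      finally have "\<bar>v\<bar> \<le> real N" by (simp add: power2_le_iff_abs_le)
      then have "v \<in> {- real N..real N}" by (simp add: abs_le_iff)
      then show ?thesis using bound[OF True] by simp
    qed (simp add: zero)
  qed
qed auto

lemma integrable_marginal_ln: "integrable lborel (\<lambda>v. f v * ln (f v))"
  by (rule integrable_compact_bounded) (auto simp: f_supp intro: abs_mult_ln_le f_nonneg f_le)

lemma integrable_marginal_power: "integrable lborel (\<lambda>v. f v * (v\<^sup>2 / real N) ^ m)"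
proof (rule integrable_compact_bounded)
  fix v :: real assume "v\<^sup>2 \<le> real N"
  then have "(v\<^sup>2 / real N) ^ m \<le> 1" using N by (intro power_le_one) auto
  then have "f v * (v\<^sup>2 / real N) ^ m \<le> M * 1"
    using f_nonneg[of v] f_le[of v] by (intro mult_mono) auto
  then show "\<bar>f v * (v\<^sup>2 / real N) ^ m\<bar> \<le> M" using f_nonneg[of v] by simp
qed (auto simp: f_supp)

text \<open>Dominates the logarithm at the poles and is still integrable, so its integral against
  the bounded \<open>f\<close> is finite.\<close>

private definition "w v = (1 - v\<^sup>2 / real N) powr (- 1 / 2) * indicator {v. v\<^sup>2 < real N} v"

private lemma w: "integrable lborel w" "(\<integral>v. w v \<partial>lborel) = pi * sqrt (real N)" "0 \<le> w v"
  using integrable_inverse_sqrt[of N] N by (auto simp: w_def[abs_def])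

private lemma w_meas [measurable]: "w \<in> borel_measurable borel"
  using borel_measurable_integrable[OF w(1)] by simp

private lemma fw: "integrable lborel (\<lambda>v. f v * w v)" "(\<integral>v. f v * w v \<partial>lborel) \<le> M * (pi * sqrt (real N))"
proof -
  have le: "f v * w v \<le> M * w v" for v using w(3)[of v] f_le[of v] by (rule mult_right_mono[rotated])
  show int: "integrable lborel (\<lambda>v. f v * w v)"
  proof (rule Bochner_Integration.integrable_bound)
    show "integrable lborel (\<lambda>v. M * w v)" using w(1) by simp
    show "AE v in lborel. norm (f v * w v) \<le> norm (M * w v)"
      using f_nonneg w(3) by (intro AE_I2) (auto intro: order_trans[OF le abs_ge_self])
  qed auto
  have "(\<integral>v. f v * w v \<partial>lborel) \<le> (\<integral>v. M * w v \<partial>lborel)"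
    using int w(1) le by (intro integral_mono) auto
  then show "(\<integral>v. f v * w v \<partial>lborel) \<le> M * (pi * sqrt (real N))" using w(2) by simp
qed

text \<open>\<open>f_supp\<close> leaves out the two points v^2 = N, where
  \<open>slice_density\<close> is already 0.\<close>

private lemma f_zero_ae: "AE v in lborel. \<not> v\<^sup>2 < real N \<longrightarrow> f v = 0"
proof -
  have "AE v in lborel. v \<noteq> sqrt (real N) \<and> v \<noteq> - sqrt (real N)"
    using AE_lborel_singleton[of "sqrt (real N)"] AE_lborel_singleton[of "- sqrt (real N)"] by eventually_elim auto
  then show ?thesis
  proof eventually_elim
    case (elim v)
    show ?case
    proof
      assume "\<not> v\<^sup>2 < real N"
      moreover have "v\<^sup>2 \<noteq> real N"
      proof
        assume "v\<^sup>2 = real N"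
        then have "\<bar>v\<bar> = sqrt (real N)" by (metis real_sqrt_abs)
        then show False using elim by linarith
      qed
      ultimately show "f v = 0" using f_supp[of v] by linarith
    qed
  qed
qed

text \<open>Since - ln t <= 2 t^(-1/2), multiples of \<open>f\<close> and of \<open>f w\<close>
  dominate the integrand.\<close>

lemma integrable_marginal_ln_slice: "integrable lborel (\<lambda>v. f v * ln (slice_density N v))"
proof (rule Bochner_Integration.integrable_bound)
  let ?B = "\<lambda>v. \<bar>ln (slice_const N)\<bar> * f v + \<bar>real N - 3\<bar> / 2 * (2 * (f v * w v))"
  show "integrable lborel ?B" using fw(1) marginal_mass(1) by simp
  show "AE v in lborel. norm (f v * ln (slice_density N v)) \<le> norm (?B v)"
    using f_zero_ae
  proof eventually_elim
    case (elim v)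
    show ?case
    proof (cases "v\<^sup>2 < real N")
      case True
      define t where "t = 1 - v\<^sup>2 / real N"
      have t: "0 < t" "t \<le> 1" using True N by (auto simp: t_def)
      have wv: "w v = t powr (- 1 / 2)" using True by (simp add: w_def t_def)
      have "- ln t \<le> 2 * w v"
        unfolding wv using ln_le_minus_one[of "t powr (- 1 / 2)"] t by (simp add: ln_powr)
      moreover have "ln t \<le> 0" using t by simp
      ultimately have lt: "\<bar>ln t\<bar> \<le> 2 * w v" by simp
      have "ln (slice_density N v) = ln (slice_const N) + (real N - 3) / 2 * ln t"
        using True t slice_const_pos[OF N] by (simp add: slice_density_def t_def ln_mult ln_powr)
      then have "\<bar>ln (slice_density N v)\<bar> \<le> \<bar>ln (slice_const N)\<bar> + \<bar>(real N - 3) / 2\<bar> * \<bar>ln t\<bar>"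
        by (simp add: abs_triangle_ineq order_trans flip: abs_mult)
      also have "\<dots> \<le> \<bar>ln (slice_const N)\<bar> + \<bar>real N - 3\<bar> / 2 * (2 * w v)"
        using mult_left_mono[OF lt, of "\<bar>real N - 3\<bar> / 2"] by (intro add_left_mono) simp
      finally have "f v * \<bar>ln (slice_density N v)\<bar> \<le> f v * (\<bar>ln (slice_const N)\<bar> + \<bar>real N - 3\<bar> / 2 * (2 * w v))"
        using f_nonneg[of v] by (rule mult_left_mono)
      also have "\<dots> = ?B v" by (simp add: algebra_simps)
      finally show ?thesis using f_nonneg[of v] by (simp add: abs_mult)
    next
      case False
      then show ?thesis using elim by simp
    qed
  qed
qed auto

lemma entropy_sphere_marginal:
  "entropy_functional (kac_sphere N) (\<lambda>x. sphere_marginal N j F (x j)) =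
    ereal ((\<integral>v. f v * ln (f v) \<partial>lborel) - (\<integral>v. f v * ln (slice_density N v) \<partial>lborel))"
proof -
  obtain Fm where Fm [measurable]: "Fm \<in> borel_measurable borel" and Fm0: "\<And>v. 0 \<le> Fm v"
    and Fm_eq: "\<And>v. v\<^sup>2 \<le> real N \<Longrightarrow> sphere_marginal N j F v = Fm v"
    and Fm_ae: "AE v in lborel. line_marginal N j F v = Fm v * slice_density N v"
    by (rule sphere_marginal_eq_line_marginal[OF N j F], rule that)
  define \<eta> where "\<eta> v = Fm v * ln (Fm v)" for v
  have \<eta> [measurable]: "\<eta> \<in> borel_measurable borel" unfolding \<eta>_def by measurable
  \<comment> \<open>The substitution F_j = f_j / g_N in F_j ln F_j times g_N. Where a factor
    vanishes, \<open>ln 0 = 0\<close> makes both sides 0.\<close>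
  have ae: "AE v in lborel. slice_density N v * \<eta> v = f v * ln (f v) - f v * ln (slice_density N v)"
    using Fm_ae f_eq
  proof eventually_elim
    case (elim v)
    then have fv: "f v = Fm v * slice_density N v" by simp
    show ?case
    proof (cases "Fm v = 0 \<or> slice_density N v = 0")
      case False
      then have "Fm v > 0" "slice_density N v > 0"
        using Fm0[of v] slice_density_nonneg[OF N, of v] by auto
      then show ?thesis by (simp add: fv \<eta>_def ln_mult algebra_simps)
    qed (auto simp: fv \<eta>_def)
  qed
  have int': "integrable lborel (\<lambda>v. f v * ln (f v) - f v * ln (slice_density N v))"
    using integrable_marginal_ln integrable_marginal_ln_slice by auto
  then have int: "integrable lborel (\<lambda>v. slice_density N v * \<eta> v)"
    using ae by (subst integrable_cong_AE[OF _ _ ae]) auto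
  have g0: "AE v in lborel. 0 \<le> slice_density N v" using slice_density_nonneg[OF N] by simp
  have "integrable (density lborel (\<lambda>v. ennreal (slice_density N v))) \<eta>"
    using int g0 by (subst integrable_real_density) auto
  then have "integrable (kac_sphere N) (\<lambda>x. \<eta> (x j))"
    unfolding distr_kac[symmetric] by (subst (asm) integrable_distr_eq) auto
  moreover have eq: "sphere_marginal N j F (x j) * ln (sphere_marginal N j F (x j)) = \<eta> (x j)"
    if "x \<in> space (kac_sphere N)" for x
    using Fm_eq[OF kac_sphere_coordinate_le[OF that j]] by (simp add: \<eta>_def)
  ultimately have "integrable (kac_sphere N) (\<lambda>x. sphere_marginal N j F (x j) * ln (sphere_marginal N j F (x j)))"
    by (subst Bochner_Integration.integrable_cong[OF refl eq]) auto
  then have "entropy_functional (kac_sphere N) (\<lambda>x. sphere_marginal N j F (x j)) =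
      ereal (\<integral>x. sphere_marginal N j F (x j) * ln (sphere_marginal N j F (x j)) \<partial>kac_sphere N)"
    by (rule entropy_functional_eq_integral)
  also have "(\<integral>x. sphere_marginal N j F (x j) * ln (sphere_marginal N j F (x j)) \<partial>kac_sphere N) = (\<integral>x. \<eta> (x j) \<partial>kac_sphere N)"
    by (rule Bochner_Integration.integral_cong[OF refl eq])
  also have "\<dots> = (\<integral>v. \<eta> v \<partial>density lborel (\<lambda>v. ennreal (slice_density N v)))"
    unfolding distr_kac[symmetric] by (subst integral_distr) auto
  also have "\<dots> = (\<integral>v. slice_density N v * \<eta> v \<partial>lborel)"
    using g0 by (subst integral_real_density) auto
  also have "\<dots> = (\<integral>v. f v * ln (f v) - f v * ln (slice_density N v) \<partial>lborel)"
    by (rule integral_cong_AE[OF _ _ ae]) auto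
  also have "\<dots> = (\<integral>v. f v * ln (f v) \<partial>lborel) - (\<integral>v. f v * ln (slice_density N v) \<partial>lborel)"
    using integrable_marginal_ln integrable_marginal_ln_slice by simp
  finally show ?thesis .
qed

text \<open>The linear coefficient (N - 3)/2 is kept exact because it takes part in a cancellation
  of order N. In front of the remainder \<psi> >= 0 it is enlarged to N/2, which also covers N = 2,
  where it is negative. The \<open>b\<close>-term is the only one in which the bound
  \<open>M\<close> on \<open>f\<close> is used.\<close>

lemma minus_marginal_ln_slice_le:
  fixes a b :: real
  assumes ab: "0 \<le> a" "0 \<le> b"
    and log: "\<And>x. 0 \<le> x \<Longrightarrow> x < 1 \<Longrightarrow> - ln (1 - x) - x \<le> a * x\<^sup>2 + b * (1 - x) powr (- 1 / 2)"
  shows "- (\<integral>v. f v * ln (slice_density N v) \<partial>lborel) \<le> - ln (slice_const N)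
    + (real N - 3) / 2 * (\<integral>v. f v * (v\<^sup>2 / real N) ^ 1 \<partial>lborel)
    + real N / 2 * (a * (\<integral>v. f v * (v\<^sup>2 / real N) ^ 2 \<partial>lborel) + b * (M * (pi * sqrt (real N))))"
proof -
  let ?R = "\<lambda>v. - ln (slice_const N) * f v + (real N - 3) / 2 * (f v * (v\<^sup>2 / real N) ^ 1)
    + real N / 2 * (a * (f v * (v\<^sup>2 / real N) ^ 2) + b * (f v * w v))"
  have le: "AE v in lborel. - (f v * ln (slice_density N v)) \<le> ?R v"
    using f_zero_ae
  proof eventually_elim
    case (elim v)
    show ?case
    proof (cases "v\<^sup>2 < real N")
      case True
      define x where "x = v\<^sup>2 / real N"
      have x: "0 \<le> x" "x < 1" using True N by (auto simp: x_def)
      have wv: "w v = (1 - x) powr (- 1 / 2)" using True by (simp add: w_def x_def)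
      define \<psi> where "\<psi> = - ln (1 - x) - x"
      have "ln (1 - x) \<le> - x" using ln_le_minus_one[of "1 - x"] x by simp
      then have \<psi>0: "0 \<le> \<psi>" by (simp add: \<psi>_def)
      have \<psi>le: "\<psi> \<le> a * x ^ 2 + b * w v" unfolding \<psi>_def wv by (rule log[OF x])
      have l: "ln (1 - x) = - (x + \<psi>)" by (simp add: \<psi>_def)
      have "ln (slice_density N v) = ln (slice_const N) + (real N - 3) / 2 * ln (1 - x)"
        using True x slice_const_pos[OF N]
        by (simp add: slice_density_def x_def[symmetric] ln_mult ln_powr)
      then have "- ln (slice_density N v) = - ln (slice_const N) + (real N - 3) / 2 * (x + \<psi>)"
        unfolding l mult_minus_right by simp
      also have "\<dots> = - ln (slice_const N) + (real N - 3) / 2 * x + (real N - 3) / 2 * \<psi>"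
        by (simp only: distrib_left add.assoc)
      also have "(real N - 3) / 2 * \<psi> \<le> real N / 2 * \<psi>" using \<psi>0 by (intro mult_right_mono) auto
      also have "real N / 2 * \<psi> \<le> real N / 2 * (a * x ^ 2 + b * w v)" using \<psi>le by (intro mult_left_mono) auto
      finally have "f v * - ln (slice_density N v) \<le> f v * (- ln (slice_const N) + (real N - 3) / 2 * x + real N / 2 * (a * x ^ 2 + b * w v))"
        using f_nonneg[of v] by (intro mult_left_mono) auto
      also have "\<dots> = ?R v" by (simp add: x_def algebra_simps)
      finally show ?thesis by simp
    next
      case False
      then show ?thesis using elim by simp
    qed
  qed
  note ints = marginal_mass(1) integrable_marginal_power[of 1] integrable_marginal_power[of 2] fw(1)
  have "- (\<integral>v. f v * ln (slice_density N v) \<partial>lborel) = (\<integral>v. - (f v * ln (slice_density N v)) \<partial>lborel)" by simp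
  also have "\<dots> \<le> (\<integral>v. ?R v \<partial>lborel)"
    using integrable_marginal_ln_slice le
    by (intro integral_mono_AE Bochner_Integration.integrable_add integrable_mult_right ints) auto
  also have "\<dots> = - ln (slice_const N) * (\<integral>v. f v \<partial>lborel) + (real N - 3) / 2 * (\<integral>v. f v * (v\<^sup>2 / real N) ^ 1 \<partial>lborel)
    + real N / 2 * (a * (\<integral>v. f v * (v\<^sup>2 / real N) ^ 2 \<partial>lborel) + b * (\<integral>v. f v * w v \<partial>lborel))"
    using ints
    by (simp only: Bochner_Integration.integral_add Bochner_Integration.integrable_add integrable_mult_right integral_mult_right_zero)
  also have "\<dots> \<le> - ln (slice_const N) + (real N - 3) / 2 * (\<integral>v. f v * (v\<^sup>2 / real N) ^ 1 \<partial>lborel)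
    + real N / 2 * (a * (\<integral>v. f v * (v\<^sup>2 / real N) ^ 2 \<partial>lborel) + b * (M * (pi * sqrt (real N))))"
  proof -
    have "real N / 2 * (a * (\<integral>v. f v * (v\<^sup>2 / real N) ^ 2 \<partial>lborel) + b * (\<integral>v. f v * w v \<partial>lborel)) \<le>
      real N / 2 * (a * (\<integral>v. f v * (v\<^sup>2 / real N) ^ 2 \<partial>lborel) + b * (M * (pi * sqrt (real N))))"
      using fw(2) ab by (intro mult_left_mono add_left_mono) auto
    then show ?thesis unfolding marginal_mass(2) by simp
  qed
  finally show ?thesis .
qed

end

section \<open>Properties of line marginals\<close>

context
  fixes N j :: nat and F :: "(nat \<Rightarrow> real) \<Rightarrow> real"
  assumes N: "N \<ge> 2" and j: "j \<in> {1..N}" and F: "prob_density_on (kac_sphere N) F"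
begin

lemma line_marginal_props:
  "line_marginal N j F \<in> borel_measurable borel" "0 \<le> line_marginal N j F v"
  "(\<integral>\<^sup>+v. ennreal (line_marginal N j F v) \<partial>lborel) = 1"
  "AE v in lborel. real N < v\<^sup>2 \<longrightarrow> line_marginal N j F v = 0"
proof -
  have "RN_deriv lborel (distr (density (kac_sphere N) (\<lambda>x. ennreal (F x))) borel (\<lambda>x. x j)) \<in> borel_measurable borel"
    using borel_measurable_RN_deriv[of lborel] by simp
  then show "line_marginal N j F \<in> borel_measurable borel"
    unfolding line_marginal_def[abs_def] by measurable
  show "0 \<le> line_marginal N j F v" by (simp add: line_marginal_def)
  show "(\<integral>\<^sup>+v. ennreal (line_marginal N j F v) \<partial>lborel) = 1"
    using nn_integral_line_marginal[OF N j F, of "\<lambda>_. 1"] F by (simp add: prob_density_on_def)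
  obtain Fm where "AE v in lborel. line_marginal N j F v = Fm v * slice_density N v"
    by (rule sphere_marginal_eq_line_marginal[OF N j F], rule that)
  then show "AE v in lborel. real N < v\<^sup>2 \<longrightarrow> line_marginal N j F v = 0"
    by eventually_elim (auto simp: slice_density_def)
qed

text \<open>In existential form, so that versions can be chosen for all coordinates at once.\<close>

lemma line_marginal_bounded_version:
  assumes fin: "fisher_information (line_marginal N j F) < \<infinity>"
  shows "\<exists>f. f \<in> borel_measurable borel \<and> (AE v in lborel. line_marginal N j F v = f v) \<and> (\<forall>v. 0 \<le> f v) \<and>
    (\<forall>v. f v \<le> sqrt (enn2real (fisher_information (line_marginal N j F)) + 2)) \<and> (\<forall>v. real N < v\<^sup>2 \<longrightarrow> f v = 0)"
proof -
  have iff: "sqrt (real N) < \<bar>v\<bar> \<longleftrightarrow> real N < v\<^sup>2" for v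
    by (metis real_sqrt_abs real_sqrt_less_iff)
  have b: "0 < sqrt (real N)" "AE v in lborel. sqrt (real N) < \<bar>v\<bar> \<longrightarrow> line_marginal N j F v = 0"
    using line_marginal_props(4) N by (auto simp: iff)
  obtain f where "f \<in> borel_measurable borel" "AE v in lborel. line_marginal N j F v = f v" "\<And>v. 0 \<le> f v"
    "\<And>v. f v \<le> sqrt (enn2real (fisher_information (line_marginal N j F)) + 2)" "\<And>v. sqrt (real N) < \<bar>v\<bar> \<Longrightarrow> f v = 0"
    by (rule fisher_information_bounds[OF line_marginal_props(1-3) b fin], rule that)
  then show ?thesis unfolding iff by blast
qed

end

lemma fisher_line_marginal_2:
  assumes "j \<in> {1..2}" "prob_density_on (kac_sphere 2) F"
  shows "4 \<le> fisher_information (line_marginal 2 j F)"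
proof (rule fisher_information_ge_4)
  note props = line_marginal_props[OF order_refl assms]
  show "line_marginal 2 j F \<in> borel_measurable borel" "\<And>v. 0 \<le> line_marginal 2 j F v"
    "(\<integral>\<^sup>+v. ennreal (line_marginal 2 j F v) \<partial>lborel) = 1" by (fact props)+
  show "AE v in lborel. 3 / 2 < \<bar>v\<bar> \<longrightarrow> line_marginal 2 j F v = 0"
    using props(4)
  proof eventually_elim
    case (elim v)
    show ?case
    proof
      assume "3 / 2 < \<bar>v\<bar>"
      then have "(3 / 2) * (3 / 2) < \<bar>v\<bar> * \<bar>v\<bar>" by (intro mult_strict_mono) auto
      then have "real 2 < v\<^sup>2" by (simp add: power2_eq_square)
      then show "line_marginal 2 j F v = 0" using elim by simp
    qed
  qed
qed

text \<open>The pointwise form of the variational principle: ln y <= y - 1 at y = b / (Z a).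
  \<open>Z\<close> need only be an upper bound for the integral of b, since the last term then
  integrates to at most 0 when a has mass 1. The fourth assumption guards against
  \<open>ln 0 = 0\<close>.\<close>

lemma gibbs_inequality:
  fixes a b Z :: real
  assumes "0 \<le> a" "0 \<le> b" "0 < Z" "0 < a \<Longrightarrow> 0 < b"
  shows "a * ln b \<le> a * ln a + a * ln Z + (b / Z - a)"
proof (cases "a = 0")
  case False
  then have ab: "a > 0" "b > 0" using assms by auto
  have "ln (b / (Z * a)) \<le> b / (Z * a) - 1" using ab assms by (intro ln_le_minus_one) simp
  then have "a * ln (b / (Z * a)) \<le> a * (b / (Z * a) - 1)" using ab by (intro mult_left_mono) auto
  then show ?thesis using ab assms by (simp add: ln_div ln_mult algebra_simps)
qed (use assms in simp)

text \<open>Write |v|^4 as |v|^(1 + 2/k) times |v|^(3 - 2/k). The bound v^2 <= N makes the first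
  factor at most N^(1/2 + 1/k); the second is B^(1/k) times the geometric mean of v^2 and |v|^k / B
  with weights 1 - 1/k and 1/k. Division by \<open>B\<close> balances the two, as both will sum to
  at most N.\<close>

lemma interpolation_bound:
  fixes k B v :: real and N :: nat
  assumes k: "k > 2" and B: "B \<ge> 1" and N: "N \<ge> 1" and v: "v\<^sup>2 \<le> real N"
  shows "(v\<^sup>2 / real N)\<^sup>2 \<le> real N powr (- 3 / 2 + 1 / k) * B powr (1 / k) * (v\<^sup>2 + \<bar>v\<bar> powr k / B)"
proof (cases "v = 0")
  case False
  define u where "u = \<bar>v\<bar>"
  have u: "u > 0" "v\<^sup>2 = u powr 2" using False by (simp_all add: u_def)
  have N0: "real N > 0" using N by simp
  have "u \<le> real N powr (1 / 2)"
    using v real_sqrt_le_mono[OF v] by (simp add: u_def powr_half_sqrt)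
  then have "u powr (1 + 2 / k) \<le> (real N powr (1 / 2)) powr (1 + 2 / k)"
    using u k by (intro powr_mono2) auto
  also have "\<dots> = real N powr (1 / 2 + 1 / k)" by (simp add: powr_powr algebra_simps)
  finally have 1: "u powr (1 + 2 / k) \<le> real N powr (1 / 2 + 1 / k)" .
  define a b where "a = u powr 2" and "b = u powr k / B"
  have ab: "a > 0" "b > 0" using u B by (auto simp: a_def b_def)
  \<comment> \<open>A weighted geometric mean is at most the maximum, hence at most the sum.\<close>
  have "a powr (1 - 1 / k) * b powr (1 / k) \<le> max a b powr (1 - 1 / k) * max a b powr (1 / k)"
    using ab k by (intro mult_mono powr_mono2) auto
  also have "\<dots> = max a b" using ab by (simp add: powr_add[symmetric])
  also have "\<dots> \<le> a + b" using ab by simp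
  finally have 2: "a powr (1 - 1 / k) * b powr (1 / k) \<le> a + b" .
  have 3: "a powr (1 - 1 / k) * b powr (1 / k) = u powr (3 - 2 / k) / B powr (1 / k)"
  proof -
    have "a powr (1 - 1 / k) = u powr (2 - 2 / k)" by (simp add: a_def powr_powr algebra_simps)
    moreover have "b powr (1 / k) = u / B powr (1 / k)"
      using u B k by (simp add: b_def powr_divide powr_powr)
    moreover have "u powr (2 - 2 / k) * u = u powr (3 - 2 / k)"
      using u powr_add[of u "2 - 2 / k" 1] by simp
    ultimately show ?thesis by simp
  qed
  have "(v\<^sup>2 / real N)\<^sup>2 = u powr 4 / real N powr 2"
    unfolding u(2) using N0 u by (simp add: power_divide powr_power)
  also have "u powr 4 = u powr (3 - 2 / k) * u powr (1 + 2 / k)" by (simp add: powr_add[symmetric])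
  also have "\<dots> / real N powr 2 \<le> u powr (3 - 2 / k) * real N powr (1 / 2 + 1 / k) / real N powr 2"
    using 1 by (intro divide_right_mono mult_left_mono) auto
  also have "\<dots> = real N powr (- 3 / 2 + 1 / k) * u powr (3 - 2 / k)"
  proof -
    have "real N powr (1 / 2 + 1 / k) / real N powr 2 = real N powr (- 3 / 2 + 1 / k)"
      unfolding powr_diff[symmetric] by (rule arg_cong[where f="\<lambda>z. real N powr z"]) simp
    then show ?thesis by (simp only: times_divide_eq_right[symmetric] mult.commute)
  qed
  also have "u powr (3 - 2 / k) = B powr (1 / k) * (a powr (1 - 1 / k) * b powr (1 / k))"
    unfolding 3 using B by simp
  also have "real N powr (- 3 / 2 + 1 / k) * \<dots> \<le> real N powr (- 3 / 2 + 1 / k) * (B powr (1 / k) * (a + b))"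
    using 2 by (intro mult_left_mono) auto
  finally show ?thesis by (simp add: a_def b_def u mult.assoc flip: u_def)
qed simp

section \<open>Sums over all coordinates\<close>

context
  fixes N :: nat and F :: "(nat \<Rightarrow> real) \<Rightarrow> real" and f :: "nat \<Rightarrow> real \<Rightarrow> real" and M :: "nat \<Rightarrow> real"
  assumes N: "N \<ge> 2" and F: "prob_density_on (kac_sphere N) F"
    and f_meas: "\<And>j. j \<in> {1..N} \<Longrightarrow> f j \<in> borel_measurable borel"
    and f_eq: "\<And>j. j \<in> {1..N} \<Longrightarrow> AE v in lborel. line_marginal N j F v = f j v"
    and f_nonneg: "\<And>j v. j \<in> {1..N} \<Longrightarrow> 0 \<le> f j v"
    and f_le: "\<And>j v. j \<in> {1..N} \<Longrightarrow> f j v \<le> M j"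
    and f_supp: "\<And>j v. j \<in> {1..N} \<Longrightarrow> real N < v\<^sup>2 \<Longrightarrow> f j v = 0"
    and M_pos: "\<And>j. j \<in> {1..N} \<Longrightarrow> 0 < M j"
begin

private lemmas marg = N _ F f_meas f_eq f_nonneg f_le f_supp

private lemma F_integral: "integrable (kac_sphere N) F" "(\<integral>x. F x \<partial>kac_sphere N) = 1"
proof -
  have F': "F \<in> borel_measurable (kac_sphere N)" "AE x in kac_sphere N. 0 \<le> F x"
    "(\<integral>\<^sup>+x. ennreal (F x) \<partial>kac_sphere N) = 1"
    using F by (auto simp: prob_density_on_def)
  then show "integrable (kac_sphere N) F" by (intro integrableI_nonneg) auto
  show "(\<integral>x. F x \<partial>kac_sphere N) = 1" using F' by (subst integral_eq_nn_integral) auto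
qed

lemma sum_second_moment: "(\<Sum>j=1..N. \<integral>v. f j v * (v\<^sup>2 / real N) ^ 1 \<partial>lborel) = 1"
proof -
  have int: "integrable lborel (\<lambda>v. f j v * (v\<^sup>2 / real N) ^ 1)" if "j \<in> {1..N}" for j
    by (rule integrable_marginal_power[OF marg]) (use that in auto)
  have c: "(\<lambda>v. (v\<^sup>2 / real N) ^ 1) \<in> borel_measurable (borel :: real measure)" by measurable
  note ce = coordinate_expectation[OF N _ F f_meas f_eq f_nonneg f_le f_supp c int]
  have "(\<Sum>j=1..N. \<integral>v. f j v * (v\<^sup>2 / real N) ^ 1 \<partial>lborel) = (\<Sum>j=1..N. \<integral>x. F x * ((x j)\<^sup>2 / real N) ^ 1 \<partial>kac_sphere N)"
    by (intro sum.cong refl ce(2)[symmetric]) auto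
  also have "\<dots> = (\<integral>x. (\<Sum>j=1..N. F x * ((x j)\<^sup>2 / real N) ^ 1) \<partial>kac_sphere N)"
    by (intro Bochner_Integration.integral_sum[symmetric] ce(1)) auto
  also have "\<dots> = (\<integral>x. F x \<partial>kac_sphere N)"
  proof (rule Bochner_Integration.integral_cong[OF refl])
    fix x assume "x \<in> space (kac_sphere N)"
    from kac_sphere_sum_squares[OF this]
    show "(\<Sum>j=1..N. F x * ((x j)\<^sup>2 / real N) ^ 1) = F x"
      using N by (simp add: sum_distrib_left[symmetric] sum_divide_distrib[symmetric])
  qed
  finally show ?thesis using F_integral by simp
qed

text \<open>Summed over j, the second moments give exactly N and the k-th moments divided by
  \<open>B\<close> at most N; hence the factor 2 and one more power of N than in
  \<open>interpolation_bound\<close>.\<close>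

lemma sum_fourth_moment_le:
  assumes k: "k > 2" and B: "B \<ge> 1"
    and mom: "(\<Sum>j=1..N. enn2real (abs_moment k (line_marginal N j F))) \<le> real N * B"
  shows "(\<Sum>j=1..N. \<integral>v. f j v * (v\<^sup>2 / real N) ^ 2 \<partial>lborel) \<le> 2 * real N powr (- 1 / 2 + 1 / k) * B powr (1 / k)"
proof -
  let ?c = "real N powr (- 3 / 2 + 1 / k) * B powr (1 / k)"
  have int_k: "integrable lborel (\<lambda>v. f j v * \<bar>v\<bar> powr k)" if j: "j \<in> {1..N}" for j
  proof (rule integrable_compact_bounded[OF marg])
    have [measurable]: "f j \<in> borel_measurable borel" by (rule f_meas[OF j])
    show "(\<lambda>v. f j v * \<bar>v\<bar> powr k) \<in> borel_measurable borel" by measurable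
    fix v :: real assume v: "v\<^sup>2 \<le> real N"
    then have "\<bar>v\<bar> \<le> sqrt (real N)" by (metis real_sqrt_abs real_sqrt_le_iff)
    then have "\<bar>v\<bar> powr k \<le> sqrt (real N) powr k" using k by (intro powr_mono2) auto
    then have "f j v * \<bar>v\<bar> powr k \<le> M j * sqrt (real N) powr k"
      using f_nonneg[OF j] f_le[OF j] M_pos[OF j] by (intro mult_mono) (auto simp: less_imp_le)
    then show "\<bar>f j v * \<bar>v\<bar> powr k\<bar> \<le> M j * sqrt (real N) powr k"
      using f_nonneg[OF j, of v] by simp
  qed (use j f_supp in auto)
  have int_2: "integrable lborel (\<lambda>v. f j v * (v\<^sup>2 / real N) ^ m)" if "j \<in> {1..N}" for j m
    by (rule integrable_marginal_power[OF marg]) (use that in auto)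
  have int_sq: "integrable lborel (\<lambda>v. f j v * v\<^sup>2)" "(\<integral>v. f j v * v\<^sup>2 \<partial>lborel) = real N * (\<integral>v. f j v * (v\<^sup>2 / real N) ^ 1 \<partial>lborel)"
    if "j \<in> {1..N}" for j
  proof -
    have "integrable lborel (\<lambda>v. real N * (f j v * (v\<^sup>2 / real N) ^ 1))"
      using int_2[OF that, of 1] by (rule integrable_mult_right)
    then show "integrable lborel (\<lambda>v. f j v * v\<^sup>2)" using N by simp
    have "(\<integral>v. real N * (f j v * (v\<^sup>2 / real N) ^ 1) \<partial>lborel) = real N * (\<integral>v. f j v * (v\<^sup>2 / real N) ^ 1 \<partial>lborel)"
      by (rule integral_mult_right_zero)
    then show "(\<integral>v. f j v * v\<^sup>2 \<partial>lborel) = real N * (\<integral>v. f j v * (v\<^sup>2 / real N) ^ 1 \<partial>lborel)" using N by simp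
  qed
  have moment: "enn2real (abs_moment k (line_marginal N j F)) = (\<integral>v. f j v * \<bar>v\<bar> powr k \<partial>lborel)" if j: "j \<in> {1..N}" for j
  proof -
    have "abs_moment k (line_marginal N j F) = (\<integral>\<^sup>+v. ennreal (f j v * \<bar>v\<bar> powr k) \<partial>lborel)"
      unfolding abs_moment_def using f_eq[OF j] by (intro nn_integral_cong_AE) (auto simp: mult.commute)
    then show ?thesis using int_k[OF j] f_nonneg[OF j] by (subst integral_eq_nn_integral) auto
  qed
  have "(\<integral>v. f j v * (v\<^sup>2 / real N) ^ 2 \<partial>lborel) \<le> ?c * ((\<integral>v. f j v * v\<^sup>2 \<partial>lborel) + (\<integral>v. f j v * \<bar>v\<bar> powr k \<partial>lborel) / B)"
    if j: "j \<in> {1..N}" for j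
  proof -
    have "(\<integral>v. f j v * (v\<^sup>2 / real N) ^ 2 \<partial>lborel) \<le> (\<integral>v. ?c * (f j v * v\<^sup>2 + f j v * \<bar>v\<bar> powr k / B) \<partial>lborel)"
    proof (rule integral_mono)
      show "integrable lborel (\<lambda>v. f j v * (v\<^sup>2 / real N) ^ 2)" by (rule int_2[OF j])
      show "integrable lborel (\<lambda>v. ?c * (f j v * v\<^sup>2 + f j v * \<bar>v\<bar> powr k / B))"
        using int_sq(1)[OF j] int_k[OF j] by auto
      fix v :: real
      show "f j v * (v\<^sup>2 / real N) ^ 2 \<le> ?c * (f j v * v\<^sup>2 + f j v * \<bar>v\<bar> powr k / B)"
      proof (cases "v\<^sup>2 \<le> real N")
        case True
        have "f j v * (v\<^sup>2 / real N) ^ 2 \<le> f j v * (?c * (v\<^sup>2 + \<bar>v\<bar> powr k / B))"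
          using interpolation_bound[OF k B _ True] N f_nonneg[OF j] by (intro mult_left_mono) auto
        then show ?thesis by (simp add: algebra_simps)
      next
        case False
        then show ?thesis using f_supp[OF j, of v] by simp
      qed
    qed
    also have "\<dots> = ?c * (\<integral>v. f j v * v\<^sup>2 + f j v * \<bar>v\<bar> powr k / B \<partial>lborel)"
      by (rule integral_mult_right_zero)
    also have "(\<integral>v. f j v * v\<^sup>2 + f j v * \<bar>v\<bar> powr k / B \<partial>lborel) = (\<integral>v. f j v * v\<^sup>2 \<partial>lborel) + (\<integral>v. f j v * \<bar>v\<bar> powr k / B \<partial>lborel)"
      using int_sq(1)[OF j] int_k[OF j] by (intro Bochner_Integration.integral_add) auto
    also have "(\<integral>v. f j v * \<bar>v\<bar> powr k / B \<partial>lborel) = (\<integral>v. f j v * \<bar>v\<bar> powr k \<partial>lborel) / B"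
      by (rule integral_divide_zero)
    finally show ?thesis .
  qed
  then have "(\<Sum>j=1..N. \<integral>v. f j v * (v\<^sup>2 / real N) ^ 2 \<partial>lborel) \<le>
    (\<Sum>j=1..N. ?c * ((\<integral>v. f j v * v\<^sup>2 \<partial>lborel) + (\<integral>v. f j v * \<bar>v\<bar> powr k \<partial>lborel) / B))"
    by (intro sum_mono) auto
  also have "\<dots> = ?c * ((\<Sum>j=1..N. \<integral>v. f j v * v\<^sup>2 \<partial>lborel) + (\<Sum>j=1..N. \<integral>v. f j v * \<bar>v\<bar> powr k \<partial>lborel) / B)"
    by (simp only: sum_distrib_left[symmetric] sum.distrib sum_divide_distrib)
  also have "(\<Sum>j=1..N. \<integral>v. f j v * v\<^sup>2 \<partial>lborel) = (\<Sum>j=1..N. real N * (\<integral>v. f j v * (v\<^sup>2 / real N) ^ 1 \<partial>lborel))"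
    by (intro sum.cong refl int_sq(2)) auto
  also have "\<dots> = real N" unfolding sum_distrib_left[symmetric] sum_second_moment by simp
  also have "(\<Sum>j=1..N. \<integral>v. f j v * \<bar>v\<bar> powr k \<partial>lborel) = (\<Sum>j=1..N. enn2real (abs_moment k (line_marginal N j F)))"
    by (intro sum.cong refl moment[symmetric]) auto
  also have "?c * (real N + (\<Sum>j=1..N. enn2real (abs_moment k (line_marginal N j F))) / B) \<le> ?c * (real N + real N * B / B)"
    using mom B by (intro mult_left_mono add_left_mono divide_right_mono) auto
  also have "\<dots> = 2 * (real N powr (- 3 / 2 + 1 / k) * real N powr 1) * B powr (1 / k)" using B N by simp
  also have "real N powr (- 3 / 2 + 1 / k) * real N powr 1 = real N powr (- 1 / 2 + 1 / k)"
    by (subst powr_add[symmetric]) simp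
  finally show ?thesis .
qed

lemma sum_marginal_ln_le:
  assumes fin: "entropy_functional (kac_sphere N) F \<noteq> \<infinity>"
  shows "(\<Sum>j=1..N. \<integral>v. f j v * ln (f j v) \<partial>lborel) \<le> (\<integral>x. F x * ln (F x) \<partial>kac_sphere N)
    + ln (2 * unit_ball_vol 2 / (real N * unit_ball_vol (real N) * sqrt (real N) ^ (N - 2)) * (M 1 * M 2))"
proof -
  let ?H = "\<integral>x. F x * ln (F x) \<partial>kac_sphere N"
  \<comment> \<open>An upper bound for the integral of the product of the marginals, which is all
    that \<open>gibbs_inequality\<close> asks for.\<close>
  define Z where "Z = 2 * unit_ball_vol 2 / (real N * unit_ball_vol (real N) * sqrt (real N) ^ (N - 2)) * (M 1 * M 2)"
  have M12: "M 1 > 0" "M 2 > 0" using M_pos N by auto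
  have Z0: "2 * unit_ball_vol 2 / (real N * unit_ball_vol (real N) * sqrt (real N) ^ (N - 2)) > 0"
    using N by (intro divide_pos_pos mult_pos_pos unit_ball_vol_pos zero_less_power) auto
  then have Z: "Z > 0" unfolding Z_def using M12 by (intro mult_pos_pos)
  define b where "b x = (\<Prod>j\<in>{1..N}. f j (x j))" for x :: "nat \<Rightarrow> real"
  have X: "(\<lambda>x. f j (x j)) \<in> borel_measurable (kac_sphere N)" if "j \<in> {1..N}" for j
    by (rule measurable_compose[OF measurable_kac_coordinate[OF N that] f_meas[OF that]])
  have b_meas [measurable]: "b \<in> borel_measurable (kac_sphere N)"
    unfolding b_def[abs_def] by (intro borel_measurable_prod X)
  have b0: "0 \<le> b x" for x unfolding b_def by (intro prod_nonneg f_nonneg)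
  have "(\<integral>\<^sup>+x. ennreal (b x) \<partial>kac_sphere N) = (\<integral>\<^sup>+x. (\<Prod>j\<in>{1..N}. ennreal (f j (x j))) \<partial>kac_sphere N)"
    unfolding b_def by (intro nn_integral_cong prod_ennreal[symmetric] f_nonneg)
  also have "\<dots> \<le> ennreal (2 * unit_ball_vol 2 / (real N * unit_ball_vol (real N) * sqrt (real N) ^ (N - 2))) * (ennreal (M 1) * ennreal (M 2))"
  proof (rule nn_integral_kac_prod_le[OF N])
    fix i assume i: "i \<in> {1..N}"
    show "(\<lambda>v. ennreal (f i v)) \<in> borel_measurable borel" using f_meas[OF i] by measurable
    show "(\<integral>\<^sup>+v. ennreal (f i v) \<partial>lborel) \<le> 1"
      using marginal_mass(3)[OF N i F f_meas[OF i] f_eq[OF i] f_nonneg[OF i] f_le[OF i] f_supp[OF i]] by simp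
  next
    show "ennreal (f 1 v) \<le> ennreal (M 1)" "ennreal (f 2 v) \<le> ennreal (M 2)" for v
      using N f_le by (auto intro!: ennreal_leI)
  qed
  also have "\<dots> = ennreal Z"
    unfolding Z_def using M12 Z0 by (simp only: ennreal_mult less_imp_le mult_nonneg_nonneg)
  finally have bZ: "(\<integral>\<^sup>+x. ennreal (b x) \<partial>kac_sphere N) \<le> ennreal Z" .
  then have b_int: "integrable (kac_sphere N) b"
    using b0 by (intro integrableI_nonneg) (auto intro: le_less_trans)
  have b_le: "(\<integral>x. b x \<partial>kac_sphere N) \<le> Z"
    using bZ b0 Z nn_integral_eq_integral[OF b_int] by simp
  have H_int: "integrable (kac_sphere N) (\<lambda>x. F x * ln (F x))"
    using F fin emeasure_kac_sphere[of N] N by (intro integrable_of_entropy_finite) (auto simp: prob_density_on_def)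
  have c: "(\<lambda>v. ln (f j v)) \<in> borel_measurable borel" if "j \<in> {1..N}" for j
    using f_meas[OF that] by measurable
  have ce: "integrable (kac_sphere N) (\<lambda>x. F x * ln (f j (x j)))"
    "(\<integral>x. F x * ln (f j (x j)) \<partial>kac_sphere N) = (\<integral>v. f j v * ln (f j v) \<partial>lborel)" if j: "j \<in> {1..N}" for j
  proof -
    have "integrable lborel (\<lambda>v. f j v * ln (f j v))"
      by (rule integrable_marginal_ln[OF N j F f_meas[OF j] f_eq[OF j] f_nonneg[OF j] f_le[OF j] f_supp[OF j]])
    note coordinate_expectation[OF N j F f_meas[OF j] f_eq[OF j] f_nonneg[OF j] f_le[OF j] f_supp[OF j] c[OF j] this]
    then show "integrable (kac_sphere N) (\<lambda>x. F x * ln (f j (x j)))"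
      "(\<integral>x. F x * ln (f j (x j)) \<partial>kac_sphere N) = (\<integral>v. f j v * ln (f j v) \<partial>lborel)" by auto
  qed
  \<comment> \<open>Lets the logarithm of the product be expanded wherever \<open>F\<close> is
    positive.\<close>
  have pos: "AE x in kac_sphere N. \<forall>j\<in>{1..N}. 0 < F x \<longrightarrow> 0 < f j (x j)"
  proof (rule AE_finite_allI)
    fix j assume j: "j \<in> {1..N}"
    show "AE x in kac_sphere N. 0 < F x \<longrightarrow> 0 < f j (x j)"
      by (rule AE_marginal_pos[OF N j F f_meas[OF j] f_eq[OF j] f_nonneg[OF j] f_le[OF j] f_supp[OF j]])
  qed simp
  have "(\<Sum>j=1..N. \<integral>v. f j v * ln (f j v) \<partial>lborel) = (\<Sum>j=1..N. \<integral>x. F x * ln (f j (x j)) \<partial>kac_sphere N)"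
    by (intro sum.cong refl ce(2)[symmetric]) auto
  also have "\<dots> = (\<integral>x. (\<Sum>j=1..N. F x * ln (f j (x j))) \<partial>kac_sphere N)"
    by (intro Bochner_Integration.integral_sum[symmetric] ce(1)) auto
  also have "\<dots> \<le> (\<integral>x. F x * ln (F x) + F x * ln Z + (b x / Z - F x) \<partial>kac_sphere N)"
  proof (rule integral_mono_AE)
    show "integrable (kac_sphere N) (\<lambda>x. \<Sum>j=1..N. F x * ln (f j (x j)))"
      by (intro Bochner_Integration.integrable_sum ce(1)) auto
    show "integrable (kac_sphere N) (\<lambda>x. F x * ln (F x) + F x * ln Z + (b x / Z - F x))"
      using H_int F_integral b_int by auto
    show "AE x in kac_sphere N. (\<Sum>j=1..N. F x * ln (f j (x j))) \<le> F x * ln (F x) + F x * ln Z + (b x / Z - F x)"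
      using pos AE_space
    proof eventually_elim
      case (elim x)
      have F0: "0 \<le> F x" using F elim(2) by (simp add: prob_density_on_def)
      show ?case
      proof (cases "F x = 0")
        case True
        then show ?thesis using b0[of x] Z by simp
      next
        case False
        then have fp: "\<And>j. j \<in> {1..N} \<Longrightarrow> 0 < f j (x j)" using elim F0 by auto
        have bp: "0 < b x" unfolding b_def using fp by (intro prod_pos)
        have "ln (b x) = (\<Sum>j=1..N. ln (f j (x j)))"
          unfolding b_def by (rule ln_prod[OF finite_atLeastAtMost]) (metis fp less_irrefl)
        then have "(\<Sum>j=1..N. F x * ln (f j (x j))) = F x * ln (b x)" by (simp add: sum_distrib_left)
        also have "\<dots> \<le> F x * ln (F x) + F x * ln Z + (b x / Z - F x)"
          using F0 Z bp by (intro gibbs_inequality) auto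
        finally show ?thesis .
      qed
    qed
  qed
  also have "\<dots> = ?H + (\<integral>x. F x \<partial>kac_sphere N) * ln Z + ((\<integral>x. b x \<partial>kac_sphere N) / Z - (\<integral>x. F x \<partial>kac_sphere N))"
    using H_int F_integral(1) b_int by simp
  also have "\<dots> \<le> ?H + ln Z"
    using b_le Z F_integral(2) by simp
  finally show ?thesis unfolding Z_def .
qed

end

section \<open>The additive entropy defect\<close>

lemma sum_ennreal_average:
  fixes a :: "nat \<Rightarrow> ennreal"
  assumes N: "N \<ge> 1" and S: "S < \<infinity>" and le: "(\<Sum>j=1..N. a j) / of_nat N \<le> S"
  shows "(\<Sum>j=1..N. enn2real (a j)) \<le> real N * enn2real S" and "j \<in> {1..N} \<Longrightarrow> a j < \<infinity>"
proof -
  have N0: "of_nat N \<noteq> (0::ennreal)" "of_nat N < (top::ennreal)"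
    using N by (auto simp: ennreal_of_nat_eq_real_of_nat)
  have "(\<Sum>j=1..N. a j) = (\<Sum>j=1..N. a j) / of_nat N * of_nat N"
    by (simp only: ennreal_divide_times ennreal_divide_self[OF N0] mult_1_right)
  also have "\<dots> \<le> S * of_nat N" using le by (rule mult_right_mono) simp
  finally have 1: "(\<Sum>j=1..N. a j) \<le> S * of_nat N" .
  also have "\<dots> < \<infinity>" using S N0 by (simp add: ennreal_mult_less_top less_top)
  finally have fin: "(\<Sum>j=1..N. a j) < \<infinity>" .
  then show aj: "a j < \<infinity>" if "j \<in> {1..N}" for j
    using that by (auto simp: less_top)
  have "ennreal (\<Sum>j=1..N. enn2real (a j)) = (\<Sum>j=1..N. ennreal (enn2real (a j)))"
    by (intro sum_ennreal[symmetric]) auto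
  also have "\<dots> = (\<Sum>j=1..N. a j)" using aj by (intro sum.cong refl) (auto simp: less_top)
  also have "\<dots> \<le> S * of_nat N" by (rule 1)
  also have "\<dots> = ennreal (real N * enn2real S)"
    using S by (simp add: ennreal_mult ennreal_of_nat_eq_real_of_nat less_top mult.commute)
  finally show "(\<Sum>j=1..N. enn2real (a j)) \<le> real N * enn2real S" by simp
qed

text \<open>Every error is brought to the form constant times P = N^(1 - \<epsilon>) sqrt A B^(1/k).
  The constants 20, 3, 32/\<epsilon> and 24/\<epsilon> belong to the normalisations, the sup bounds
  in the Gibbs step, the quadratic remainder and the poles.\<close>

lemma entropy_subadditivity_defect:
  fixes k A B :: real and N :: nat
  assumes k: "k > 2" and N: "N \<ge> 2" and F: "prob_density_on (kac_sphere N) F"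
    and fisher_fin: "\<And>j. j \<in> {1..N} \<Longrightarrow> fisher_information (line_marginal N j F) < \<infinity>"
    and fisher: "(\<Sum>j=1..N. enn2real (fisher_information (line_marginal N j F))) \<le> real N * A" and A: "A \<ge> 1"
    and mom: "(\<Sum>j=1..N. enn2real (abs_moment k (line_marginal N j F))) \<le> real N * B" and B: "B \<ge> 1"
    and fin: "entropy_functional (kac_sphere N) F \<noteq> \<infinity>"
  defines "\<epsilon> \<equiv> 1 / 4 - 1 / (2 * k)"
  shows "(\<Sum>j=1..N. entropy_functional (kac_sphere N) (\<lambda>x. sphere_marginal N j F (x j))) \<le>
    ereal ((\<integral>x. F x * ln (F x) \<partial>kac_sphere N) + (23 + 56 / \<epsilon>) * real N powr (1 - \<epsilon>) * sqrt A * B powr (1 / k))"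
proof -
  let ?H = "\<integral>x. F x * ln (F x) \<partial>kac_sphere N"
  have \<epsilon>: "0 < \<epsilon>" "\<epsilon> \<le> 1 / 4" using k by (auto simp: \<epsilon>_def field_simps)
  have N1: "real N \<ge> 1" using N by simp
  define I where "I j = enn2real (fisher_information (line_marginal N j F))" for j
  define M where "M j = sqrt (I j + 2)" for j
  have I0: "0 \<le> I j" for j by (simp add: I_def)
  have "\<forall>j\<in>{1..N}. \<exists>f. f \<in> borel_measurable borel \<and> (AE v in lborel. line_marginal N j F v = f v) \<and> (\<forall>v. 0 \<le> f v) \<and>
    (\<forall>v. f v \<le> M j) \<and> (\<forall>v. real N < v\<^sup>2 \<longrightarrow> f v = 0)"
    unfolding M_def I_def using line_marginal_bounded_version[OF N _ F fisher_fin] by blast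
  then obtain f where f': "\<forall>j\<in>{1..N}. f j \<in> borel_measurable borel \<and> (AE v in lborel. line_marginal N j F v = f j v) \<and> (\<forall>v. 0 \<le> f j v) \<and>
    (\<forall>v. f j v \<le> M j) \<and> (\<forall>v. real N < v\<^sup>2 \<longrightarrow> f j v = 0)"
    by (rule bchoice[THEN exE])
  have f: "f j \<in> borel_measurable borel" "AE v in lborel. line_marginal N j F v = f j v" "\<And>v. 0 \<le> f j v"
    "\<And>v. f j v \<le> M j" "\<And>v. real N < v\<^sup>2 \<Longrightarrow> f j v = 0" if "j \<in> {1..N}" for j
    using f' that by auto
  have M_pos: "0 < M j" for j using I0[of j] by (simp add: M_def)
  \<comment> \<open>One coordinate may carry the whole sum of the Fisher informations, so this bound
    grows with N. It enters only through ln (M_1 M_2) and through a term with the prefactor N^(-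
    3).\<close>
  have M_le: "M j \<le> sqrt (2 * real N * A)" if j: "j \<in> {1..N}" for j
  proof -
    have "I j \<le> (\<Sum>j=1..N. I j)" using j I0 by (intro member_le_sum) auto
    also have "\<dots> \<le> real N * A" using fisher by (simp add: I_def)
    finally have "I j \<le> real N * A" .
    moreover have "2 * 1 \<le> real N * A" using N A by (intro mult_mono) auto
    ultimately show ?thesis unfolding M_def by (intro real_sqrt_le_mono) simp
  qed
  let ?a = "32 / \<epsilon> * real N powr \<epsilon>" and ?b = "8 / \<epsilon> * real N powr (- 3)"
  define S2 where "S2 j = (\<integral>v. f j v * (v\<^sup>2 / real N) ^ 1 \<partial>lborel)" for j
  define S4 where "S4 j = (\<integral>v. f j v * (v\<^sup>2 / real N) ^ 2 \<partial>lborel)" for j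
  define E where "E j = (\<integral>v. f j v * ln (f j v) \<partial>lborel)" for j
  define G where "G j = (\<integral>v. f j v * ln (slice_density N v) \<partial>lborel)" for j
  have ent: "entropy_functional (kac_sphere N) (\<lambda>x. sphere_marginal N j F (x j)) = ereal (E j - G j)" if j: "j \<in> {1..N}" for j
    unfolding E_def G_def by (rule entropy_sphere_marginal[OF N j F f[OF j]])
  have G: "- G j \<le> - ln (slice_const N) + (real N - 3) / 2 * S2 j + real N / 2 * (?a * S4 j + ?b * (M j * (pi * sqrt (real N))))"
    if j: "j \<in> {1..N}" for j
    unfolding G_def S2_def S4_def
    by (rule minus_marginal_ln_slice_le[OF N j F f[OF j]])
       (use \<epsilon> minus_ln_minus_le[OF N, of \<epsilon>] in auto)
  have S2: "(\<Sum>j=1..N. S2 j) = 1"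
    unfolding S2_def by (rule sum_second_moment[OF N F f M_pos])
  have S4: "(\<Sum>j=1..N. S4 j) \<le> 2 * real N powr (- 1 / 2 + 1 / k) * B powr (1 / k)"
    unfolding S4_def by (rule sum_fourth_moment_le[OF N F f M_pos k B mom])
  let ?c = "2 * unit_ball_vol 2 / (real N * unit_ball_vol (real N) * sqrt (real N) ^ (N - 2))"
  have E: "(\<Sum>j=1..N. E j) \<le> ?H + ln (?c * (M 1 * M 2))"
    unfolding E_def by (rule sum_marginal_ln_le[OF N F f M_pos fin])
  have "?c > 0" using N by (intro divide_pos_pos mult_pos_pos unit_ball_vol_pos zero_less_power) auto
  then have ln_c: "ln (?c * (M 1 * M 2)) = ln ?c + ln (M 1 * M 2)"
    using M_pos by (intro ln_mult_pos mult_pos_pos)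
  define P where "P = real N powr (1 - \<epsilon>) * sqrt A * B powr (1 / k)"
  have sA: "1 \<le> sqrt A" and sB: "1 \<le> B powr (1 / k)" using A B k by (auto intro: ge_one_powr_ge_zero)
  have P_half: "sqrt (real N) * sqrt A \<le> P"
  proof -
    have "sqrt (real N) \<le> real N powr (1 - \<epsilon>)"
      unfolding powr_half_sqrt[OF of_nat_0_le_iff, symmetric] using N1 \<epsilon> by (intro powr_mono) auto
    then have "sqrt (real N) * sqrt A * 1 \<le> real N powr (1 - \<epsilon>) * sqrt A * B powr (1 / k)"
      using sA sB by (intro mult_mono) auto
    then show ?thesis by (simp add: P_def)
  qed
  have P1: "sqrt (real N) \<le> P"
  proof -
    have "sqrt (real N) * 1 \<le> sqrt (real N) * sqrt A" using sA by (intro mult_left_mono) auto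
    then show ?thesis using P_half by simp
  qed
  have PA: "sqrt A \<le> P"
  proof -
    have "1 * sqrt A \<le> sqrt (real N) * sqrt A" using N1 sA by (intro mult_right_mono) auto
    then show ?thesis using P_half by simp
  qed
  have t1: "ln ?c - real N * ln (slice_const N) + (real N - 3) / 2 \<le> 20 * P"
    using sphere_constants_le[OF N] P1 by linarith
  have sqrt2: "sqrt 2 \<le> (3 / 2 :: real)" by (rule real_le_lsqrt) (auto simp: power2_eq_square)
  have t2: "ln (M 1 * M 2) \<le> 3 * P"
  proof -
    have "M 1 * M 2 \<le> sqrt (2 * real N * A) * sqrt (2 * real N * A)"
      using M_le[of 1] M_le[of 2] N A M_pos[of 1] M_pos[of 2] by (intro mult_mono) auto
    also have "\<dots> = 2 * real N * A" using A by simp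
    finally have "ln (M 1 * M 2) \<le> ln (2 * real N * A)"
      using M_pos A N by (subst ln_le_cancel_iff) auto
    also have "\<dots> \<le> 2 * sqrt (2 * real N * A)" using A N by (intro ln_le_2_sqrt) auto
    also have "\<dots> = 2 * sqrt 2 * (sqrt (real N) * sqrt A)" by (simp add: real_sqrt_mult)
    also have "\<dots> \<le> 3 * P" using sqrt2 P_half A by (intro mult_mono) auto
    finally show ?thesis .
  qed
  \<comment> \<open>As 1/2 - 1/k = 2 \<epsilon>, the exponent 1 + \<epsilon> - 1/2 + 1/k equals 1 -
    \<epsilon>.\<close>
  have t3: "real N / 2 * (?a * (\<Sum>j=1..N. S4 j)) \<le> 32 / \<epsilon> * P"
  proof -
    have "real N / 2 * (?a * (\<Sum>j=1..N. S4 j)) \<le> real N / 2 * (?a * (2 * real N powr (- 1 / 2 + 1 / k) * B powr (1 / k)))"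
      using S4 \<epsilon> by (intro mult_left_mono) auto
    also have "\<dots> = 32 / \<epsilon> * (real N powr 1 * real N powr \<epsilon> * real N powr (- 1 / 2 + 1 / k)) * B powr (1 / k)"
      using N1 by simp
    also have "real N powr 1 * real N powr \<epsilon> * real N powr (- 1 / 2 + 1 / k) = real N powr (1 - \<epsilon>)"
      unfolding powr_add[symmetric] by (rule arg_cong[where f="\<lambda>z. real N powr z"]) (simp add: \<epsilon>_def field_simps)
    also have "32 / \<epsilon> * real N powr (1 - \<epsilon>) * B powr (1 / k) \<le> 32 / \<epsilon> * P"
    proof -
      have "real N powr (1 - \<epsilon>) * 1 * B powr (1 / k) \<le> P"
        unfolding P_def using sA by (intro mult_right_mono mult_left_mono) auto
      then have "32 / \<epsilon> * (real N powr (1 - \<epsilon>) * B powr (1 / k)) \<le> 32 / \<epsilon> * P"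
        using \<epsilon> by (intro mult_left_mono) auto
      then show ?thesis by (simp add: mult.assoc)
    qed
    finally show ?thesis .
  qed
  \<comment> \<open>The powers of N are 1 from N/2, 3/2 from the sum of the M_j and 1/2 from the
    integral of the weight. N^(- 3) cancels them, which is the reason for the exponent -8 of the
    cut-off in \<open>minus_ln_minus_le\<close>.\<close>
  have t4: "real N / 2 * (?b * ((\<Sum>j=1..N. M j) * (pi * sqrt (real N)))) \<le> 24 / \<epsilon> * P"
  proof -
    have "(\<Sum>j=1..N. M j) \<le> (\<Sum>j=1..N. sqrt (2 * real N * A))" by (intro sum_mono M_le)
    then have "(\<Sum>j=1..N. M j) \<le> real N * (sqrt 2 * sqrt (real N) * sqrt A)" by (simp add: real_sqrt_mult)
    then have "real N / 2 * (?b * ((\<Sum>j=1..N. M j) * (pi * sqrt (real N)))) \<le>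
      real N / 2 * (?b * (real N * (sqrt 2 * sqrt (real N) * sqrt A) * (pi * sqrt (real N))))"
      using \<epsilon> by (intro mult_left_mono mult_right_mono) auto
    also have "\<dots> = 4 / \<epsilon> * (real N ^ 3 * real N powr (- 3)) * (pi * sqrt 2) * sqrt A"
      using N1 by (simp add: power3_eq_cube field_simps)
    also have "real N ^ 3 * real N powr (- 3) = 1"
      using N1 by (simp add: powr_minus powr_numeral)
    also have "4 / \<epsilon> * 1 * (pi * sqrt 2) * sqrt A \<le> 4 / \<epsilon> * 1 * (4 * (3 / 2)) * P"
      using \<epsilon> pi_less_4 sqrt2 PA A by (intro mult_mono) auto
    finally show ?thesis by simp
  qed
  have "(\<Sum>j=1..N. E j - G j) \<le> (\<Sum>j=1..N. E j + (- ln (slice_const N) + (real N - 3) / 2 * S2 j + real N / 2 * (?a * S4 j + ?b * (M j * (pi * sqrt (real N))))))"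
  proof (rule sum_mono)
    fix j assume "j \<in> {1..N}"
    then show "E j - G j \<le> E j + (- ln (slice_const N) + (real N - 3) / 2 * S2 j + real N / 2 * (?a * S4 j + ?b * (M j * (pi * sqrt (real N)))))"
      using G[of j] by linarith
  qed
  also have "\<dots> = (\<Sum>j=1..N. E j) + (real N * (- ln (slice_const N)) + (real N - 3) / 2 * (\<Sum>j=1..N. S2 j)
      + real N / 2 * (?a * (\<Sum>j=1..N. S4 j) + ?b * ((\<Sum>j=1..N. M j) * (pi * sqrt (real N)))))"
    by (simp only: sum.distrib sum_distrib_left[symmetric] sum_distrib_right[symmetric] sum_constant card_atLeastAtMost diff_Suc_1' add_diff_cancel_right' Suc_eq_plus1)
  also have "\<dots> \<le> ?H + (20 * P + 3 * P + 32 / \<epsilon> * P + 24 / \<epsilon> * P)"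
    using E ln_c t1 t2 t3 t4 unfolding S2 by (simp add: distrib_left)
  also have "20 * P + 3 * P + 32 / \<epsilon> * P + 24 / \<epsilon> * P = (23 + 56 / \<epsilon>) * P"
    by (simp add: algebra_simps add_divide_distrib[symmetric])
  finally have "(\<Sum>j=1..N. E j - G j) \<le> ?H + (23 + 56 / \<epsilon>) * P" .
  moreover have "(\<Sum>j=1..N. entropy_functional (kac_sphere N) (\<lambda>x. sphere_marginal N j F (x j))) = ereal (\<Sum>j=1..N. E j - G j)"
    unfolding sum_ereal[symmetric] by (intro sum.cong refl ent) auto
  ultimately show ?thesis by (simp add: P_def mult.assoc)
qed

theorem theorem1p8:
  fixes k :: real
  assumes "k > 2"
  shows "\<exists>C1 C2 :: real. C1 > 0 \<and> C2 > 0 \<and>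
    (\<forall>(F :: nat \<Rightarrow> (nat \<Rightarrow> real) \<Rightarrow> real) (C_H :: real) (A_k :: real) (A_I :: real).
      (\<forall>N\<ge>2. prob_density_on (kac_sphere N) (F N)) \<longrightarrow>
      sup_avg_moment k F < \<infinity> \<longrightarrow> A_k = enn2real (sup_avg_moment k F) \<longrightarrow>
      sup_avg_fisher F < \<infinity> \<longrightarrow> A_I = enn2real (sup_avg_fisher F) \<longrightarrow>
      C_H > 0 \<longrightarrow> (INF N\<in>{2..}. sphere_entropy N (F N) / ereal (real N)) \<ge> ereal C_H \<longrightarrow>
      (\<forall>(\<beta> :: real) (p :: real) (N :: nat).
        0 < \<beta> \<longrightarrow> \<beta> < k / 2 - 1 \<longrightarrow> 1 < p \<longrightarrow> p < min ((k + 1) / 3) (k / 2) \<longrightarrow> N \<ge> 2 \<longrightarrow>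
        (\<Sum>j=1..N. entropy_functional (kac_sphere N) (\<lambda>x. sphere_marginal N j (F N) (x j)))
        \<le> ereal (1 + C1 / (C_H * real N)
            + 4 * C2 * (1 + gamma_const k / 2) powr (1 / k)
                / (C_H * (2 * real N) powr (1 / 4 - 1 / (2 * k)))
                * (A_I - 1) powr (1 / 2) * (1 + A_k) powr (1 / k)
            + A_k / (2 * C_H * real N powr (k / 2 - 1 - \<beta>))
            + log_const p * A_I powr ((p - 1) / (2 * p)) * A_k powr (1 / p)
                / (2 * C_H * (1 - 1 / real N powr \<beta>) powr (k / (2 * p))
                     * real N powr (1 / 2 * ((k + 1) / p - 3))))
          * sphere_entropy N (F N)))"
proof -
  define \<epsilon> where "\<epsilon> = 1 / 4 - 1 / (2 * k)"
  have \<epsilon>: "0 < \<epsilon>" "\<epsilon> \<le> 1" using assms by (auto simp: \<epsilon>_def field_simps)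
  \<comment> \<open>The constant of \<open>entropy_subadditivity_defect\<close>; it depends on k
    alone and will be C2.\<close>
  define K where "K = 23 + 56 / \<epsilon>"
  have K: "K > 0" using \<epsilon> by (simp add: K_def add_pos_pos)
  define g where "g = (1 + gamma_const k / 2) powr (1 / k)"
  have g: "1 \<le> g"
    unfolding g_def using gamma_const_nonneg[of k] assms by (intro ge_one_powr_ge_zero) auto
  have main: "(\<Sum>j=1..N. entropy_functional (kac_sphere N) (\<lambda>x. sphere_marginal N j (F N) (x j)))
        \<le> ereal (1 + 1 / (C_H * real N)
            + 4 * K * g / (C_H * (2 * real N) powr \<epsilon>) * (A_I - 1) powr (1 / 2) * (1 + A_k) powr (1 / k)
            + A_k / (2 * C_H * real N powr (k / 2 - 1 - \<beta>))
            + log_const p * A_I powr ((p - 1) / (2 * p)) * A_k powr (1 / p)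
                / (2 * C_H * (1 - 1 / real N powr \<beta>) powr (k / (2 * p))
                     * real N powr (1 / 2 * ((k + 1) / p - 3))))
          * sphere_entropy N (F N)"
    if F: "\<forall>N\<ge>2. prob_density_on (kac_sphere N) (F N)"
      and Sm: "sup_avg_moment k F < \<infinity>" "A_k = enn2real (sup_avg_moment k F)"
      and Si: "sup_avg_fisher F < \<infinity>" "A_I = enn2real (sup_avg_fisher F)"
      and C_H: "C_H > 0" "(INF N\<in>{2..}. sphere_entropy N (F N) / ereal (real N)) \<ge> ereal C_H"
      and N: "N \<ge> 2"
    for F :: "nat \<Rightarrow> (nat \<Rightarrow> real) \<Rightarrow> real" and C_H A_k A_I \<beta> p :: real and N :: nat
  proof -
    have avg_m: "(\<Sum>j=1..n. abs_moment k (line_marginal n j (F n))) / of_nat n \<le> sup_avg_moment k F" if "n \<ge> 2" for n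
      unfolding sup_avg_moment_def using that by (intro SUP_upper) auto
    have avg_i: "(\<Sum>j=1..n. fisher_information (line_marginal n j (F n))) / of_nat n \<le> sup_avg_fisher F" if "n \<ge> 2" for n
      unfolding sup_avg_fisher_def using that by (intro SUP_upper) auto
    have N1: "N \<ge> 1" and NN: "real N \<ge> 1" using N by auto
    have A_k: "A_k \<ge> 0" by (simp add: Sm(2))
    have mom: "(\<Sum>j=1..N. enn2real (abs_moment k (line_marginal N j (F N)))) \<le> real N * (1 + A_k)"
    proof -
      have "(\<Sum>j=1..N. enn2real (abs_moment k (line_marginal N j (F N)))) \<le> real N * A_k"
        unfolding Sm(2) by (rule sum_ennreal_average(1)[OF N1 Sm(1) avg_m[OF N]])
      also have "\<dots> \<le> real N * (1 + A_k)" by (intro mult_left_mono) auto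
      finally show ?thesis .
    qed
    have fisher: "(\<Sum>j=1..N. enn2real (fisher_information (line_marginal N j (F N)))) \<le> real N * A_I"
      unfolding Si(2) by (rule sum_ennreal_average(1)[OF N1 Si(1) avg_i[OF N]])
    have fisher_fin: "fisher_information (line_marginal N j (F N)) < \<infinity>" if "j \<in> {1..N}" for j
      by (rule sum_ennreal_average(2)[OF N1 Si(1) avg_i[OF N] that])
    \<comment> \<open>The supremum includes the level N = 2, which bounds it from below for the
      whole family.\<close>
    have A_I: "A_I \<ge> 4"
    proof -
      have "4 \<le> enn2real (fisher_information (line_marginal 2 j (F 2)))" if j: "j \<in> {1..2}" for j
      proof -
        have "4 \<le> fisher_information (line_marginal 2 j (F 2))"
          using fisher_line_marginal_2[OF j] F by auto
        moreover have "fisher_information (line_marginal 2 j (F 2)) < \<infinity>"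
          by (rule sum_ennreal_average(2)[OF _ Si(1) avg_i j]) auto
        ultimately have "enn2real 4 \<le> enn2real (fisher_information (line_marginal 2 j (F 2)))"
          by (intro enn2real_mono) (auto simp: less_top)
        then show ?thesis by simp
      qed
      then have "(\<Sum>j=1..2::nat. 4) \<le> (\<Sum>j=1..2. enn2real (fisher_information (line_marginal 2 j (F 2))))"
        by (intro sum_mono)
      also have "\<dots> \<le> real 2 * A_I"
        unfolding Si(2) by (rule sum_ennreal_average(1)[OF _ Si(1) avg_i]) auto
      finally show ?thesis by simp
    qed
    let ?S = "\<Sum>j=1..N. entropy_functional (kac_sphere N) (\<lambda>x. sphere_marginal N j (F N) (x j))"
    define T where "T = K * real N powr (1 - \<epsilon>) * sqrt A_I * (1 + A_k) powr (1 / k)"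
    define T1 where "T1 = 1 / (C_H * real N)"
    define T2 where "T2 = 4 * K * g / (C_H * (2 * real N) powr \<epsilon>) * (A_I - 1) powr (1 / 2) * (1 + A_k) powr (1 / k)"
    define T3 where "T3 = A_k / (2 * C_H * real N powr (k / 2 - 1 - \<beta>))"
    define T4 where "T4 = log_const p * A_I powr ((p - 1) / (2 * p)) * A_k powr (1 / p)
                / (2 * C_H * (1 - 1 / real N powr \<beta>) powr (k / (2 * p))
                     * real N powr (1 / 2 * ((k + 1) / p - 3)))"
    have T1: "T1 \<ge> 0" using C_H by (simp add: T1_def)
    have T2: "T2 \<ge> 0" using C_H K g by (simp add: T2_def)
    have T3: "T3 \<ge> 0" using C_H A_k by (simp add: T3_def)
    have T4: "T4 \<ge> 0" using C_H by (simp add: T4_def log_const_def)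
    have "?S
      \<le> ereal (1 + T1 + T2 + T3 + T4) * sphere_entropy N (F N)"
    \<comment> \<open>Infinite entropy makes the right side infinite, as the coefficient is at least
      1.\<close>
    proof (cases "sphere_entropy N (F N) = \<infinity>")
      case True
      then show ?thesis using T1 T2 T3 T4 by simp
    next
      case False
      then have fin: "entropy_functional (kac_sphere N) (F N) \<noteq> \<infinity>" by (simp add: sphere_entropy_def)
      have FN: "prob_density_on (kac_sphere N) (F N)" using F N by simp
      define h where "h = (\<integral>x. F N x * ln (F N x) \<partial>kac_sphere N)"
      have "integrable (kac_sphere N) (\<lambda>x. F N x * ln (F N x))"
        using FN fin emeasure_kac_sphere[OF N1] by (intro integrable_of_entropy_finite) (auto simp: prob_density_on_def)
      then have H: "sphere_entropy N (F N) = ereal h"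
        unfolding sphere_entropy_def h_def by (rule entropy_functional_eq_integral)
      have "ereal C_H \<le> sphere_entropy N (F N) / ereal (real N)"
        using C_H(2) N by (intro order_trans[OF C_H(2) INF_lower]) auto
      then have "C_H \<le> h / real N" unfolding H using N by simp
      then have h: "C_H * real N \<le> h" using N by (simp add: pos_le_divide_eq)
      then have h0: "0 \<le> h" using C_H(1) by (intro order_trans[OF _ h]) simp
      \<comment> \<open>The factor 4 of the second error term absorbs two losses of a factor 2:
        (2N)^\<epsilon> <= 2 N^\<epsilon>, and sqrt A_I <= 2 sqrt (A_I - 1), for which A_I >= 4/3
        suffices.\<close>
      have T: "T \<le> T2 * (C_H * real N)"
      proof -
        have "(2 * real N) powr \<epsilon> = 2 powr \<epsilon> * real N powr \<epsilon>" by (simp add: powr_mult)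
        also have "\<dots> \<le> 2 powr 1 * real N powr \<epsilon>" using \<epsilon> by (intro mult_right_mono powr_mono) auto
        finally have "(2 * real N) powr \<epsilon> \<le> 2 * real N powr \<epsilon>" by simp
        then have "real N / (2 * real N powr \<epsilon>) \<le> real N / (2 * real N) powr \<epsilon>"
          using NN by (intro divide_left_mono) auto
        moreover have "real N / (2 * real N powr \<epsilon>) = real N powr (1 - \<epsilon>) / 2"
          using NN by (simp add: powr_diff)
        ultimately have 1: "real N powr (1 - \<epsilon>) / 2 \<le> real N / (2 * real N) powr \<epsilon>" by simp
        have "sqrt (A_I / 4) \<le> sqrt (A_I - 1)" using A_I by (intro real_sqrt_le_mono) simp
        then have 2: "sqrt A_I / 2 \<le> (A_I - 1) powr (1 / 2)"
          using A_I by (simp add: real_sqrt_divide powr_half_sqrt)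
        have "T = 4 * K * 1 * (real N powr (1 - \<epsilon>) / 2) * (sqrt A_I / 2) * (1 + A_k) powr (1 / k)"
          by (simp add: T_def)
        also have "\<dots> \<le> 4 * K * g * (real N / (2 * real N) powr \<epsilon>) * (A_I - 1) powr (1 / 2) * (1 + A_k) powr (1 / k)"
          using g K 1 2 A_I by (intro mult_mono) auto
        also have "\<dots> = T2 * (C_H * real N)" using C_H(1) by (simp add: T2_def)
        finally show ?thesis .
      qed
      \<comment> \<open>Used with B = 1 + A_k, which is at least 1 and bounds the average k-th
        moment.\<close>
      have "?S \<le> ereal (h + T)"
        using entropy_subadditivity_defect[OF assms N FN fisher_fin fisher _ mom _ fin] A_I A_k
        by (simp add: h_def T_def K_def \<epsilon>_def)
      \<comment> \<open>The passage from additive to multiplicative: T <= T2 C_H N <= T2 h.\<close>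
      also have "h + T \<le> (1 + T1 + T2 + T3 + T4) * h"
      proof -
        have "T2 * (C_H * real N) \<le> T2 * h" using h T2 by (intro mult_left_mono)
        moreover have "0 \<le> T1 * h" "0 \<le> T3 * h" "0 \<le> T4 * h" using T1 T3 T4 h0 by auto
        ultimately show ?thesis using T by (simp add: distrib_right)
      qed
      finally show ?thesis unfolding H by simp
    qed
    then show ?thesis unfolding T1_def T2_def T3_def T4_def .
  qed
  show ?thesis
    by (rule exI[of _ 1], rule exI[of _ K]) (use K main in \<open>simp add: g_def \<epsilon>_def\<close>)
qed

end
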